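(* Let $\mathcal{P}$ be a partial order $\preceq$ on $\{1,\dots,N\}$ and let $\mathbf{k}$ be a field whose characteristic is either $0$ or greater than $N$. Let $\mathfrak{g}=\mathfrak{g}(\mathcal{P})$ be the Lie poset algebra of $\mathcal{P}$ over $\mathbf{k}$, $\mathfrak{h}$ its subalgebra of diagonal elements, $\mathfrak{c}$ the center of $\mathfrak{g}$, and $\Sigma$ the nerve of $\mathcal{P}$. Then $$H^2(\mathfrak{g},\mathfrak{g})\;\cong\;\Big(\bigwedge\nolimits^2\mathfrak{h}^{\vee}\otimes\mathfrak{c}\Big)\;\oplus\;\Big(\mathfrak{h}^{\vee}\otimes H^1(\Sigma,\mathbf{k})\Big)\;\oplus\;H^2(\Sigma,\mathbf{k}).$$
   Context: The associative poset algebra $A(\mathcal{P},\mathbf{k})$ is the $\mathbf{k}$-span of elements $e_{ij}$, $i\preceq j$, with $e_{ij}e_{j'k}=e_{ik}$ if $j=j'$ and $0$ otherwise. The Lie poset algebra $\mathfrak{g}(\mathcal{P})$ is the Lie algebra (under commutator) of all elements $\sum c_{ij}e_{ij}$ of $A(\mathcal{P},\mathbf{k})$ of trace $\sum c_{ii}=0$. $\mathfrak{h}$ is the Abelian subalgebra of elements $\sum_i c_{ii}e_{ii}$ of trace zero, and $\mathfrak{h}^\vee$ is its dual space. $H^*(\mathfrak{g},\mathfrak{g})$ is Chevalley–Eilenberg cohomology with coefficients in the adjoint module. The nerve $\Sigma$ is the simplicial complex whose $n$-simplices are the chains $i_0\prec i_1\prec\dots\prec i_n$ of $\mathcal{P}$,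 and $H^n(\Sigma,\mathbf{k})$ is its (unreduced) simplicial cohomology. *)

theory Defs
  imports
    "Jordan_Normal_Form.VS_Connect"
    "HOL-Algebra.AbelCoset"
    "HOL-Library.Poly_Mapping"
begin

text \<open>
  The ground field is a type \<open>'k\<close> of class \<^class>\<open>field\<close>. Vector spaces over it are
  \<^const>\<open>class_ring\<close>-modules in the sense of the record \<open>module\<close>, whose fields
  \<open>mult\<close> and \<open>one\<close> have no meaning for a mere vector space and are filled with zero,
  as in \<^const>\<open>direct_sum\<close> and \<^const>\<open>ring.func_space\<close>.
\<close>

section \<open>Constructions on vector spaces\<close>

abbreviation linear_maps ::
    "('k::field, 'v, 'm) module_scheme \<Rightarrow> ('k, 'w, 'n) module_scheme \<Rightarrow> ('v \<Rightarrow> 'w) set"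
  where "linear_maps \<equiv> LinearCombinations.module_hom class_ring"

definition linearly_isomorphic ::
    "('k::field, 'v, 'm) module_scheme \<Rightarrow> ('k, 'w, 'n) module_scheme \<Rightarrow> bool" (infix \<open>\<cong>\<^sub>k\<close> 50)
  where "V \<cong>\<^sub>k W \<longleftrightarrow>
    (\<exists>f \<in> linear_maps V W. bij_betw f (carrier V) (carrier W))"

definition quotient_space ::
    "('k::field, 'v, 'm) module_scheme \<Rightarrow> 'v set \<Rightarrow> ('k, 'v set) module"
  where "quotient_space V U =
    \<lparr>carrier = a_rcosets\<^bsub>V\<^esub> U,
     mult = (\<lambda>_ _. U),
     one = U,
     zero = U,
     add = set_add V,
     smult = (\<lambda>c X. \<Union>x\<in>X. U +>\<^bsub>V\<^esub> (c \<odot>\<^bsub>V\<^esub> x))\<rparr>"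

definition ground_space :: "('k::field, 'k) module"
  where "ground_space =
    \<lparr>carrier = UNIV, mult = (*), one = 1, zero = 0, add = (+), smult = (*)\<rparr>"

definition dual_space :: "('k::field, 'v, 'm) module_scheme \<Rightarrow> ('k, 'v \<Rightarrow> 'k) module"
  where "dual_space V =
    (ring.func_space class_ring (carrier V))
      \<lparr>carrier := linear_maps V ground_space \<inter> extensional (carrier V)\<rparr>"

definition free_space :: "'s set \<Rightarrow> ('k::field, 's \<Rightarrow>\<^sub>0 'k) module"
  where "free_space S =
    \<lparr>carrier = {p. Poly_Mapping.keys p \<subseteq> S},
     mult = (\<lambda>_ _. 0),
     one = 0,
     zero = 0,
     add = (+),
     smult = (\<lambda>c. Poly_Mapping.map ((*) c))\<rparr>"

definition bilinear_relations ::
    "('k::field, 'v, 'm) module_scheme \<Rightarrow> ('k, 'w, 'n) module_scheme \<Rightarrow> ('v \<times> 'w \<Rightarrow>\<^sub>0 'k) set"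
  where "bilinear_relations V W =
    {Poly_Mapping.single (x \<oplus>\<^bsub>V\<^esub> x', y) 1
       - Poly_Mapping.single (x, y) 1 - Poly_Mapping.single (x', y) 1 | x x' y.
       x \<in> carrier V \<and> x' \<in> carrier V \<and> y \<in> carrier W} \<union>
    {Poly_Mapping.single (x, y \<oplus>\<^bsub>W\<^esub> y') 1
       - Poly_Mapping.single (x, y) 1 - Poly_Mapping.single (x, y') 1 | x y y'.
       x \<in> carrier V \<and> y \<in> carrier W \<and> y' \<in> carrier W} \<union>
    {Poly_Mapping.single (c \<odot>\<^bsub>V\<^esub> x, y) 1 - Poly_Mapping.single (x, y) c | c x y.
       x \<in> carrier V \<and> y \<in> carrier W} \<union>
    {Poly_Mapping.single (x, c \<odot>\<^bsub>W\<^esub> y) 1 - Poly_Mapping.single (x, y) c | c x y.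
       x \<in> carrier V \<and> y \<in> carrier W}"

definition tensor_product ::
    "('k::field, 'v, 'm) module_scheme \<Rightarrow> ('k, 'w, 'n) module_scheme \<Rightarrow>
     ('k, ('v \<times> 'w \<Rightarrow>\<^sub>0 'k) set) module" (infixr \<open>\<otimes>\<^sub>k\<close> 75)
  where "V \<otimes>\<^sub>k W =
    (let F = free_space (carrier V \<times> carrier W)
     in quotient_space F (LinearCombinations.module.span class_ring F (bilinear_relations V W)))"

definition exterior_square ::
    "('k::field, 'v, 'm) module_scheme \<Rightarrow> ('k, ('v \<times> 'v \<Rightarrow>\<^sub>0 'k) set) module"
  where "exterior_square V =
    (let F = free_space (carrier V \<times> carrier V)
     in quotient_space F
          (LinearCombinations.module.span class_ring F
            (bilinear_relations V V \<union> {Poly_Mapping.single (x, x) 1 | x. x \<in> carrier V})))"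

notation direct_sum (infixr \<open>\<oplus>\<^sub>k\<close> 65)


section \<open>Cohomology of cochain complexes\<close>

definition cocycles ::
    "(nat \<Rightarrow> ('k::field, 'v) module) \<Rightarrow> (nat \<Rightarrow> 'v \<Rightarrow> 'v) \<Rightarrow> nat \<Rightarrow> 'v set"
  where "cocycles C d n = {f \<in> carrier (C n). d n f = \<zero>\<^bsub>C (Suc n)\<^esub>}"

definition coboundaries ::
    "(nat \<Rightarrow> ('k::field, 'v) module) \<Rightarrow> (nat \<Rightarrow> 'v \<Rightarrow> 'v) \<Rightarrow> nat \<Rightarrow> 'v set"
  where "coboundaries C d n =
    (case n of 0 \<Rightarrow> {\<zero>\<^bsub>C 0\<^esub>} | Suc m \<Rightarrow> d m ` carrier (C m))"

definition cohomology ::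
    "(nat \<Rightarrow> ('k::field, 'v) module) \<Rightarrow> (nat \<Rightarrow> 'v \<Rightarrow> 'v) \<Rightarrow> nat \<Rightarrow> ('k, 'v set) module"
  where "cohomology C d n =
    quotient_space ((C n)\<lparr>carrier := cocycles C d n\<rparr>) (coboundaries C d n)"

definition delete_nth :: "nat \<Rightarrow> 'a list \<Rightarrow> 'a list"
  where "delete_nth i xs = take i xs @ drop (Suc i) xs"


section \<open>Chevalley--Eilenberg cohomology\<close>

record ('k, 'g) lie_algebra = "('k, 'g) module" +
  bracket :: "'g \<Rightarrow> 'g \<Rightarrow> 'g"

definition tuples :: "('k, 'g, 'm) module_scheme \<Rightarrow> nat \<Rightarrow> 'g list set"
  where "tuples L n = {xs. length xs = n \<and> set xs \<subseteq> carrier L}"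

text \<open>Alternating \<open>n\<close>-linear maps from \<open>L\<close> to \<open>M\<close>.\<close>

definition ce_cochains ::
    "('k::field, 'g, 'l) module_scheme \<Rightarrow> ('k, 'v, 'm) module_scheme \<Rightarrow> nat \<Rightarrow>
     ('k, 'g list \<Rightarrow> 'v) module"
  where "ce_cochains L M n =
    \<lparr>carrier = {f \<in> tuples L n \<rightarrow>\<^sub>E carrier M.
        (\<forall>xs \<in> tuples L n. \<forall>i < n. (\<lambda>x. f (xs[i := x])) \<in> linear_maps L M) \<and>
        (\<forall>xs \<in> tuples L n. \<not> distinct xs \<longrightarrow> f xs = \<zero>\<^bsub>M\<^esub>)},
     mult = (\<lambda>_ _. \<lambda>xs \<in> tuples L n. \<zero>\<^bsub>M\<^esub>),
     one = (\<lambda>xs \<in> tuples L n. \<zero>\<^bsub>M\<^esub>),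
     zero = (\<lambda>xs \<in> tuples L n. \<zero>\<^bsub>M\<^esub>),
     add = (\<lambda>f g. \<lambda>xs \<in> tuples L n. f xs \<oplus>\<^bsub>M\<^esub> g xs),
     smult = (\<lambda>c f. \<lambda>xs \<in> tuples L n. c \<odot>\<^bsub>M\<^esub> f xs)\<rparr>"

text \<open>
  \<open>act\<close> is the action of \<open>L\<close> on \<open>M\<close>. Arguments are numbered from \<open>0\<close>. In the second sum
  \<open>i < j\<close>, so the entry at \<open>j\<close> is deleted first.
\<close>

definition ce_differential ::
    "('k::field, 'g, 'l) lie_algebra_scheme \<Rightarrow> ('k, 'v, 'm) module_scheme \<Rightarrow> ('g \<Rightarrow> 'v \<Rightarrow> 'v) \<Rightarrow>
     nat \<Rightarrow> ('g list \<Rightarrow> 'v) \<Rightarrow> 'g list \<Rightarrow> 'v"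
  where "ce_differential L M act n f = (\<lambda>xs \<in> tuples L (Suc n).
    (\<Oplus>\<^bsub>M\<^esub>i\<in>{..n}. (-1) ^ i \<odot>\<^bsub>M\<^esub> act (xs ! i) (f (delete_nth i xs)))
    \<oplus>\<^bsub>M\<^esub> (\<Oplus>\<^bsub>M\<^esub>j\<in>{..n}. \<Oplus>\<^bsub>M\<^esub>i\<in>{..<j}.
         (-1) ^ (i + j) \<odot>\<^bsub>M\<^esub>
           f (bracket L (xs ! i) (xs ! j) # delete_nth i (delete_nth j xs))))"

definition ce_cohomology ::
    "('k::field, 'g, 'l) lie_algebra_scheme \<Rightarrow> ('k, 'v, 'm) module_scheme \<Rightarrow> ('g \<Rightarrow> 'v \<Rightarrow> 'v) \<Rightarrow>
     nat \<Rightarrow> ('k, ('g list \<Rightarrow> 'v) set) module"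
  where "ce_cohomology L M act = cohomology (ce_cochains L M) (ce_differential L M act)"

definition adjoint_cohomology ::
    "nat \<Rightarrow> ('k::field, 'g, 'l) lie_algebra_scheme \<Rightarrow> ('k, ('g list \<Rightarrow> 'g) set) module"
  where "adjoint_cohomology n L = ce_cohomology L L (bracket L) n"

definition lie_center ::
    "('k::field, 'g, 'l) lie_algebra_scheme \<Rightarrow> ('k, 'g, 'l) lie_algebra_scheme"
  where "lie_center L =
    L\<lparr>carrier := {z \<in> carrier L. \<forall>x \<in> carrier L. bracket L z x = \<zero>\<^bsub>L\<^esub>}\<rparr>"


section \<open>Poset algebras\<close>

text \<open>
  A partial order is given by its graph \<open>r\<close>, and the element \<open>\<Sum> c i j e i j\<close> of the associative
  poset algebra by its coefficient function \<open>c\<close> on the pairs \<open>(i, j) \<in> r\<close>.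
\<close>

definition poset_algebra :: "'a rel \<Rightarrow> ('k::field, 'a \<times> 'a \<Rightarrow> 'k) module"
  where "poset_algebra r = (ring.func_space class_ring r)
    \<lparr>mult := (\<lambda>a b. \<lambda>(i, k) \<in> r. \<Sum>j | (i, j) \<in> r \<and> (j, k) \<in> r. a (i, j) * b (j, k)),
     one := (\<lambda>(i, j) \<in> r. if i = j then 1 else 0)\<rparr>"

definition poset_trace :: "'a rel \<Rightarrow> ('a \<times> 'a \<Rightarrow> 'k::field) \<Rightarrow> 'k"
  where "poset_trace r a = (\<Sum>i \<in> Field r. a (i, i))"

definition lie_poset_algebra :: "'a rel \<Rightarrow> ('k::field, 'a \<times> 'a \<Rightarrow> 'k) lie_algebra"
  where "lie_poset_algebra r =
    (let A = poset_algebra r in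
      \<lparr>carrier = {a \<in> carrier A. poset_trace r a = 0},
       mult = (\<lambda>_ _. \<zero>\<^bsub>A\<^esub>),
       one = \<zero>\<^bsub>A\<^esub>,
       zero = \<zero>\<^bsub>A\<^esub>,
       add = add A,
       smult = smult A,
       bracket = (\<lambda>a b. a \<otimes>\<^bsub>A\<^esub> b \<ominus>\<^bsub>A\<^esub> b \<otimes>\<^bsub>A\<^esub> a)\<rparr>)"

definition diagonal_subalgebra :: "'a rel \<Rightarrow> ('k::field, 'a \<times> 'a \<Rightarrow> 'k) lie_algebra"
  where "diagonal_subalgebra r = (lie_poset_algebra r)
    \<lparr>carrier := {a \<in> carrier (lie_poset_algebra r). \<forall>(i, j) \<in> r. i \<noteq> j \<longrightarrow> a (i, j) = 0}\<rparr>"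


section \<open>Simplicial cohomology of the nerve\<close>

text \<open>An \<open>n\<close>-simplex is listed in increasing order, which also fixes its orientation.\<close>

definition nerve_simplices :: "'a rel \<Rightarrow> nat \<Rightarrow> 'a list set"
  where "nerve_simplices r n =
    {s. length s = Suc n \<and> set s \<subseteq> Field r \<and> sorted_wrt (\<lambda>i j. (i, j) \<in> r \<and> i \<noteq> j) s}"

definition nerve_cochains :: "'a rel \<Rightarrow> nat \<Rightarrow> ('k::field, 'a list \<Rightarrow> 'k) module"
  where "nerve_cochains r n = ring.func_space class_ring (nerve_simplices r n)"

definition nerve_differential ::
    "'a rel \<Rightarrow> nat \<Rightarrow> ('a list \<Rightarrow> 'k::field) \<Rightarrow> 'a list \<Rightarrow> 'k"
  where "nerve_differential r n f =
    (\<lambda>s \<in> nerve_simplices r (Suc n). \<Sum>i\<le>Suc n. (-1) ^ i * f (delete_nth i s))"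

definition nerve_cohomology :: "nat \<Rightarrow> 'a rel \<Rightarrow> ('k::field, ('a list \<Rightarrow> 'k) set) module"
  where "nerve_cohomology n r = cohomology (nerve_cochains r) (nerve_differential r) n"

end

(*
  The diagonal h acts on 2-cochains with values in the adjoint module, and e_ij has weight
  h_i - h_j. By Cartan's formula h acts trivially on cohomology, so only the weight-zero part of a
  2-cocycle F matters. The bound on the characteristic guarantees that weights vanish on traceless
  diagonals only for formal reasons, so the weight-zero part consists of the diagonal of F(h, h'),
  the e_ij-coefficient of F(h, e_ij), and the e_ik-coefficient of F(e_ij, e_jk). The cocycle
  identities say precisely that the first is central, the second a 1-cocycle of the nerve for every
  h, and the third a 2-cocycle of the nerve. Coboundaries change the last two exactly by coboundaries
  of the nerve (the average over the diagonal corrects the trace) and leave the first unchanged.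
  Conversely all such data occur: cup products of functionals on h with central elements and with
  derivations, and the antisymmetrised Hochschild cocycle of a 2-cocycle of the nerve. Hence the
  2-cocycles of g cover both sides of the isomorphism, with the same kernel.
*)

theory Submission
  imports Defs "HOL-Library.Function_Algebras"
begin

section \<open>Linear algebra over the ground field\<close>

text \<open>No single diagonal element need invert all nonzero weights: over a small finite field
  each of them may be killed by some nonzero weight. Cartan's formula is therefore used weight by
  weight. On homogeneous arguments a single matrix entry of a cochain has one weight
  \<open>\<beta>\<close>, and a diagonal \<open>c\<close> with \<open>\<beta> c \<noteq> 0\<close>
  is chosen for that weight alone. The choice depends only on the values of \<open>\<beta>\<close>
  on the diagonal, and weights add along matrix products, so the pieces form one linear primitive
  without any splitting of the complex into weight spaces. Recognising weight zero compares at most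
  six indicator functions, hence integers of size at most 3; when six are needed, three distinct
  elements of the poset are present, so the bound by \<open>N\<close> applies. Antisymmetry gives
  every commutator zero diagonal. Functionals on the diagonal thus extend to cocycles with trivial
  coefficients, which is what the cup products require. On the target side the dual of the diagonal
  has an explicit finite basis, and tensoring with such a space means taking a finite power of the
  other factor.\<close>

lemma module_class_ringI:
  fixes V :: "('k::field, 'v, 'm) module_scheme"
  assumes "\<zero>\<^bsub>V\<^esub> \<in> carrier V"
    and "\<And>x y. x \<in> carrier V \<Longrightarrow> y \<in> carrier V \<Longrightarrow> x \<oplus>\<^bsub>V\<^esub> y \<in> carrier V"
    and "\<And>c x. x \<in> carrier V \<Longrightarrow> c \<odot>\<^bsub>V\<^esub> x \<in> carrier V"
    and "\<And>x y. x \<in> carrier V \<Longrightarrow> y \<in> carrier V \<Longrightarrow> x \<oplus>\<^bsub>V\<^esub> y = y \<oplus>\<^bsub>V\<^esub> x"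
    and "\<And>x y z. x \<in> carrier V \<Longrightarrow> y \<in> carrier V \<Longrightarrow> z \<in> carrier V \<Longrightarrow>
           (x \<oplus>\<^bsub>V\<^esub> y) \<oplus>\<^bsub>V\<^esub> z = x \<oplus>\<^bsub>V\<^esub> (y \<oplus>\<^bsub>V\<^esub> z)"
    and "\<And>x. x \<in> carrier V \<Longrightarrow> x \<oplus>\<^bsub>V\<^esub> \<zero>\<^bsub>V\<^esub> = x"
    and "\<And>x. x \<in> carrier V \<Longrightarrow> 0 \<odot>\<^bsub>V\<^esub> x = \<zero>\<^bsub>V\<^esub>"
    and "\<And>x. x \<in> carrier V \<Longrightarrow> 1 \<odot>\<^bsub>V\<^esub> x = x"
    and "\<And>a b x. x \<in> carrier V \<Longrightarrow> (a * b) \<odot>\<^bsub>V\<^esub> x = a \<odot>\<^bsub>V\<^esub> (b \<odot>\<^bsub>V\<^esub> x)"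
    and "\<And>a b x. x \<in> carrier V \<Longrightarrow> (a + b) \<odot>\<^bsub>V\<^esub> x = a \<odot>\<^bsub>V\<^esub> x \<oplus>\<^bsub>V\<^esub> b \<odot>\<^bsub>V\<^esub> x"
    and "\<And>a x y. x \<in> carrier V \<Longrightarrow> y \<in> carrier V \<Longrightarrow>
           a \<odot>\<^bsub>V\<^esub> (x \<oplus>\<^bsub>V\<^esub> y) = a \<odot>\<^bsub>V\<^esub> x \<oplus>\<^bsub>V\<^esub> a \<odot>\<^bsub>V\<^esub> y"
  shows "module class_ring V"
proof (rule module_criteria)
  show "cring (class_ring :: 'k ring)" ..
  \<comment> \<open>The negative of x is built from scalars: x + (-1) x = (1 + (-1)) x = 0
    x.\<close>
  have "x \<oplus>\<^bsub>V\<^esub> (- 1) \<odot>\<^bsub>V\<^esub> x = \<zero>\<^bsub>V\<^esub>" if "x \<in> carrier V" for x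
    using assms(10)[OF that, of 1 "-1"] assms(7,8) that by simp
  then show "\<forall>v\<in>carrier V. \<exists>w\<in>carrier V. v \<oplus>\<^bsub>V\<^esub> w = \<zero>\<^bsub>V\<^esub>"
    using assms(3) by blast
qed (use assms in auto)

lemma module_class_ring_simps:
  fixes V :: "('k::field, 'v, 'm) module_scheme"
  assumes "module class_ring V"
  shows "x \<in> carrier V \<Longrightarrow> (a + b) \<odot>\<^bsub>V\<^esub> x = a \<odot>\<^bsub>V\<^esub> x \<oplus>\<^bsub>V\<^esub> b \<odot>\<^bsub>V\<^esub> x"
    and "x \<in> carrier V \<Longrightarrow> y \<in> carrier V \<Longrightarrow>
      a \<odot>\<^bsub>V\<^esub> (x \<oplus>\<^bsub>V\<^esub> y) = a \<odot>\<^bsub>V\<^esub> x \<oplus>\<^bsub>V\<^esub> a \<odot>\<^bsub>V\<^esub> y"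
    and "x \<in> carrier V \<Longrightarrow> (a * b) \<odot>\<^bsub>V\<^esub> x = a \<odot>\<^bsub>V\<^esub> (b \<odot>\<^bsub>V\<^esub> x)"
    and "x \<in> carrier V \<Longrightarrow> 0 \<odot>\<^bsub>V\<^esub> x = \<zero>\<^bsub>V\<^esub>"
    and "x \<in> carrier V \<Longrightarrow> 1 \<odot>\<^bsub>V\<^esub> x = x"
    and "a \<odot>\<^bsub>V\<^esub> \<zero>\<^bsub>V\<^esub> = \<zero>\<^bsub>V\<^esub>"
proof -
  interpret V: Module.module class_ring V by fact
  show "x \<in> carrier V \<Longrightarrow> (a + b) \<odot>\<^bsub>V\<^esub> x = a \<odot>\<^bsub>V\<^esub> x \<oplus>\<^bsub>V\<^esub> b \<odot>\<^bsub>V\<^esub> x"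
    using V.smult_l_distr[of a b x] by simp
  show "x \<in> carrier V \<Longrightarrow> y \<in> carrier V \<Longrightarrow>
      a \<odot>\<^bsub>V\<^esub> (x \<oplus>\<^bsub>V\<^esub> y) = a \<odot>\<^bsub>V\<^esub> x \<oplus>\<^bsub>V\<^esub> a \<odot>\<^bsub>V\<^esub> y"
    using V.smult_r_distr[of a x y] by simp
  show "x \<in> carrier V \<Longrightarrow> (a * b) \<odot>\<^bsub>V\<^esub> x = a \<odot>\<^bsub>V\<^esub> (b \<odot>\<^bsub>V\<^esub> x)"
    using V.smult_assoc1[of a b x] by simp
  show "x \<in> carrier V \<Longrightarrow> 0 \<odot>\<^bsub>V\<^esub> x = \<zero>\<^bsub>V\<^esub>" "x \<in> carrier V \<Longrightarrow> 1 \<odot>\<^bsub>V\<^esub> x = x"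
    using V.smult_l_null[of x] V.smult_one[of x] by simp_all
  show "a \<odot>\<^bsub>V\<^esub> \<zero>\<^bsub>V\<^esub> = \<zero>\<^bsub>V\<^esub>"
    using V.smult_r_null[of a] by simp
qed

lemma minus_eq_zeroD:
  assumes "module class_ring V" "x \<in> carrier V" "y \<in> carrier V" "x \<ominus>\<^bsub>V\<^esub> y = \<zero>\<^bsub>V\<^esub>"
  shows "x = y"
proof -
  interpret V: Module.module class_ring V by fact
  show ?thesis
    using assms V.minus_equality[of x "\<ominus>\<^bsub>V\<^esub> y"] by (simp add: V.minus_eq)
qed

lemma linear_mapsI:
  assumes "\<And>x. x \<in> carrier V \<Longrightarrow> f x \<in> carrier W"
    and "\<And>x y. x \<in> carrier V \<Longrightarrow> y \<in> carrier V \<Longrightarrow> f (x \<oplus>\<^bsub>V\<^esub> y) = f x \<oplus>\<^bsub>W\<^esub> f y"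
    and "\<And>c x. x \<in> carrier V \<Longrightarrow> f (c \<odot>\<^bsub>V\<^esub> x) = c \<odot>\<^bsub>W\<^esub> f x"
  shows "f \<in> linear_maps V W"
  using assms by (auto simp: LinearCombinations.module_hom_def)

lemma linear_mapsD:
  assumes "f \<in> linear_maps V W"
  shows "x \<in> carrier V \<Longrightarrow> f x \<in> carrier W"
    and "x \<in> carrier V \<Longrightarrow> y \<in> carrier V \<Longrightarrow> f (x \<oplus>\<^bsub>V\<^esub> y) = f x \<oplus>\<^bsub>W\<^esub> f y"
    and "x \<in> carrier V \<Longrightarrow> f (c \<odot>\<^bsub>V\<^esub> x) = c \<odot>\<^bsub>W\<^esub> f x"
  using assms by (auto simp: LinearCombinations.module_hom_def)

lemma submodule_class_ringI:
  fixes V :: "('k::field, 'v, 'm) module_scheme"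
  assumes "module class_ring V" "U \<subseteq> carrier V" "\<zero>\<^bsub>V\<^esub> \<in> U"
    and "\<And>x y. x \<in> U \<Longrightarrow> y \<in> U \<Longrightarrow> x \<oplus>\<^bsub>V\<^esub> y \<in> U"
    and "\<And>c x. x \<in> U \<Longrightarrow> c \<odot>\<^bsub>V\<^esub> x \<in> U"
  shows "LinearCombinations.submodule class_ring U V"
  using assms by (auto intro: submodule.intro)

lemma mod_hom_linear_maps:
  assumes "module class_ring V" "module class_ring W" "f \<in> linear_maps V W"
  shows "mod_hom class_ring V W f"
  using assms by (auto simp: mod_hom_def mod_hom_axioms_def)

lemma submodule_vimage:
  fixes V :: "('k::field, 'v, 'm) module_scheme"
  assumes "module class_ring V" "module class_ring W" "f \<in> linear_maps V W" "LinearCombinations.submodule class_ring T W"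
  shows "LinearCombinations.submodule class_ring {x \<in> carrier V. f x \<in> T} V"
proof -
  interpret V: Module.module class_ring V by fact
  interpret h: mod_hom class_ring V W f by (rule mod_hom_linear_maps) fact+
  interpret T: LinearCombinations.submodule class_ring T W by fact
  show ?thesis
    by (rule submodule_class_ringI) (use assms(1) in auto)
qed

text \<open>Both spaces are quotients of the set \<open>X\<close> by the same equivalence relation.\<close>

lemma linearly_isomorphic_common_cover:
  assumes f: "f ` X = carrier V" and g: "g ` X = carrier W"
    and eq: "\<And>x y. x \<in> X \<Longrightarrow> y \<in> X \<Longrightarrow> f x = f y \<longleftrightarrow> g x = g y"
    and add: "\<And>x y. x \<in> X \<Longrightarrow> y \<in> X \<Longrightarrow>
      \<exists>z\<in>X. f z = f x \<oplus>\<^bsub>V\<^esub> f y \<and> g z = g x \<oplus>\<^bsub>W\<^esub> g y"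
    and smult: "\<And>c x. x \<in> X \<Longrightarrow> \<exists>z\<in>X. f z = c \<odot>\<^bsub>V\<^esub> f x \<and> g z = c \<odot>\<^bsub>W\<^esub> g x"
  shows "V \<cong>\<^sub>k W"
proof -
  define h where "h = g \<circ> inv_into X f"
  have h: "h (f x) = g x" if "x \<in> X" for x
    using eq that inv_into_into[of "f x" f X] f_inv_into_f[of "f x" f X]
    by (metis comp_apply h_def image_eqI)
  have ex: "\<exists>x\<in>X. v = f x" if "v \<in> carrier V" for v
    using that f by auto
  have "h \<in> linear_maps V W"
  proof (rule linear_mapsI)
    show "h x \<in> carrier W" if "x \<in> carrier V" for x
      using ex[OF that] h g by auto
    show "h (x \<oplus>\<^bsub>V\<^esub> y) = h x \<oplus>\<^bsub>W\<^esub> h y" if "x \<in> carrier V" "y \<in> carrier V" for x y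
      using ex[OF that(1)] ex[OF that(2)] add h by metis
    show "h (c \<odot>\<^bsub>V\<^esub> x) = c \<odot>\<^bsub>W\<^esub> h x" if "x \<in> carrier V" for c x
      using ex[OF that(1)] smult h by metis
  qed
  moreover have "bij_betw h (carrier V) (carrier W)"
  proof (rule bij_betw_imageI)
    show "inj_on h (carrier V)"
      unfolding inj_on_def using h eq ex by metis
    show "h ` carrier V = carrier W"
      unfolding f[symmetric] g[symmetric] using h by (auto simp: image_image)
  qed
  ultimately show ?thesis
    by (auto simp: linearly_isomorphic_def)
qed

text \<open>Phrased through submodules instead of linear combinations, so that it is itself an
  induction principle: a property whose solutions form a submodule has to be checked on
  \<open>S\<close> only.\<close>

definition spanning :: "('k::field, 'v, 'm) module_scheme \<Rightarrow> 'v set \<Rightarrow> bool"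
  where "spanning V S \<longleftrightarrow> S \<subseteq> carrier V \<and>
    (\<forall>T. submodule class_ring T V \<longrightarrow> S \<subseteq> T \<longrightarrow> carrier V \<subseteq> T)"

lemma spanning_induct:
  assumes "spanning V S" "LinearCombinations.submodule class_ring T V" "S \<subseteq> T" "x \<in> carrier V"
  shows "x \<in> T"
  using assms by (auto simp: spanning_def)

lemma spanning_image:
  fixes V :: "('k::field, 'v, 'm) module_scheme"
  assumes "module class_ring V" "module class_ring W" "f \<in> linear_maps V W"
    and "f ` carrier V = carrier W" "spanning V S"
  shows "spanning W (f ` S)"
  unfolding spanning_def
proof (intro conjI allI impI)
  show "f ` S \<subseteq> carrier W"
    using assms by (auto simp: spanning_def)
  fix T assume T: "LinearCombinations.submodule class_ring T W" "f ` S \<subseteq> T"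
  have "LinearCombinations.submodule class_ring {x \<in> carrier V. f x \<in> T} V"
    by (rule submodule_vimage) fact+
  moreover have "S \<subseteq> {x \<in> carrier V. f x \<in> T}"
    using assms(5) T(2) by (auto simp: spanning_def)
  ultimately have "x \<in> {x \<in> carrier V. f x \<in> T}" if "x \<in> carrier V" for x
    by (rule spanning_induct[OF assms(5)]) fact
  then show "carrier W \<subseteq> T"
    unfolding assms(4)[symmetric] by blast
qed


subsection \<open>Quotients\<close>

locale quotient_module =
  fixes V :: "('k::field, 'v, 'm) module_scheme" and U
  assumes module: "module class_ring V" and submodule: "LinearCombinations.submodule class_ring U V"
begin

sublocale V: Module.module class_ring V by (rule module)
sublocale U: LinearCombinations.submodule class_ring U V by (rule submodule)

sublocale ab: abelian_subgroup U V
proof (rule abelian_subgroupI3)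
  have "\<ominus>\<^bsub>V\<^esub> x \<in> U" if "x \<in> U" for x
  proof -
    have "\<ominus>\<^bsub>V\<^esub> x = (- 1) \<odot>\<^bsub>V\<^esub> x"
      using V.smult_minus_1[of x] that U.subset by (auto simp: class_ring_simps)
    then show ?thesis
      using that by simp
  qed
  then show "additive_subgroup U V"
    using U.subset
    by (intro additive_subgroupI subgroup.intro) (auto simp flip: a_inv_def)
  show "abelian_group V" ..
qed

abbreviation Q where "Q \<equiv> quotient_space V U"

definition coset where "coset x = U +>\<^bsub>V\<^esub> x"

lemma coset_eq_iff:
  assumes "x \<in> carrier V" "y \<in> carrier V"
  shows "coset x = coset y \<longleftrightarrow> x \<ominus>\<^bsub>V\<^esub> y \<in> U"
  unfolding coset_def using assms ab.a_rcos_module[of y x]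
  by (metis V.minus_eq ab.a_repr_independence' ab.a_repr_independenceD)

lemma carrier_quotient: "carrier Q = coset ` carrier V"
  by (auto simp: quotient_space_def A_RCOSETS_def RCOSETS_def coset_def a_r_coset_def)

lemma coset_add:
  "x \<in> carrier V \<Longrightarrow> y \<in> carrier V \<Longrightarrow> coset (x \<oplus>\<^bsub>V\<^esub> y) = coset x \<oplus>\<^bsub>Q\<^esub> coset y"
  by (simp add: quotient_space_def coset_def ab.a_rcos_sum)

text \<open>Scaling in \<open>quotient_space\<close> is a union over all representatives. Since
  \<open>U\<close> is closed under scaling, every member of the union is the same coset, and the
  union is over a nonempty set because x lies in its own coset.\<close>

lemma coset_smult:
  assumes "x \<in> carrier V"
  shows "coset (c \<odot>\<^bsub>V\<^esub> x) = c \<odot>\<^bsub>Q\<^esub> coset x"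
proof -
  have "coset (c \<odot>\<^bsub>V\<^esub> y) = coset (c \<odot>\<^bsub>V\<^esub> x)" if "y \<in> coset x" for y
  proof -
    have y: "y \<in> carrier V"
      using that assms ab.a_elemrcos_carrier by (auto simp: coset_def)
    have "y \<ominus>\<^bsub>V\<^esub> x \<in> U"
      using that assms y ab.a_rcos_module_imp[of x y] by (simp add: coset_def V.minus_eq)
    then have "c \<odot>\<^bsub>V\<^esub> (y \<ominus>\<^bsub>V\<^esub> x) \<in> U"
      by simp
    then show ?thesis
      using assms y V.smult_r_minus[of c x] by (simp add: coset_eq_iff V.minus_eq V.smult_r_distr)
  qed
  note indep = this
  have "c \<odot>\<^bsub>Q\<^esub> coset x = (\<Union>y\<in>coset x. coset (c \<odot>\<^bsub>V\<^esub> y))"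
    by (simp add: quotient_space_def coset_def)
  also have "\<dots> = (\<Union>y\<in>coset x. coset (c \<odot>\<^bsub>V\<^esub> x))"
    by (intro SUP_cong refl indep)
  also have "\<dots> = coset (c \<odot>\<^bsub>V\<^esub> x)"
    using assms ab.a_rcos_self[of x] by (auto simp: coset_def)
  finally show ?thesis ..
qed

lemma coset_zero: "coset \<zero>\<^bsub>V\<^esub> = \<zero>\<^bsub>Q\<^esub>"
  by (simp add: coset_def quotient_space_def ab.a_rcos_const)

lemma coset_linear: "coset \<in> linear_maps V Q"
  by (rule linear_mapsI) (auto simp: coset_add coset_smult carrier_quotient)

lemma module_quotient: "module class_ring Q"
  by (rule module_class_ringI)
    (auto simp: carrier_quotient V.a_ac module_class_ring_simps[OF module]
      simp flip: coset_add coset_smult coset_zero)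

text \<open>The map is evaluated at a chosen representative; two representatives differ by an
  element of \<open>U\<close>, which \<open>f\<close> kills.\<close>

lemma induced_map:
  assumes "module class_ring W" "f \<in> linear_maps V W" "\<And>u. u \<in> U \<Longrightarrow> f u = \<zero>\<^bsub>W\<^esub>"
  obtains g where "g \<in> linear_maps Q W" "\<And>x. x \<in> carrier V \<Longrightarrow> g (coset x) = f x"
proof -
  interpret h: mod_hom class_ring V W f
    by (rule mod_hom_linear_maps) (rule module assms)+
  define g where "g X = f (inv_into (carrier V) coset X)" for X
  have g: "g (coset x) = f x" if x: "x \<in> carrier V" for x
  proof -
    define y where "y = inv_into (carrier V) coset (coset x)"
    have "coset x \<in> coset ` carrier V"
      using x by simp
    then have y: "y \<in> carrier V" "coset y = coset x"
      unfolding y_def by (rule inv_into_into, rule f_inv_into_f)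
    then have "y \<ominus>\<^bsub>V\<^esub> x \<in> U"
      using x coset_eq_iff by auto
    then have "f y \<ominus>\<^bsub>W\<^esub> f x = \<zero>\<^bsub>W\<^esub>"
      using assms(3) x y h.f_minus by metis
    then have "f y = f x"
      using x y minus_eq_zeroD[OF assms(1), of "f y" "f x"] by simp
    then show ?thesis
      by (simp add: g_def y_def)
  qed
  have "g \<in> linear_maps Q W"
    by (rule linear_mapsI)
      (auto simp: carrier_quotient g simp flip: coset_add coset_smult)
  with g show ?thesis
    by (auto intro: that)
qed

end


subsection \<open>Free spaces\<close>

lemma lookup_map_mult: "Poly_Mapping.lookup (Poly_Mapping.map ((*) (c::'k::field)) p) s = c * Poly_Mapping.lookup p s"
  by (simp add: Poly_Mapping.map.rep_eq when_def)

lemma keys_map_mult: "Poly_Mapping.keys (Poly_Mapping.map ((*) (c::'k::field)) p) \<subseteq> Poly_Mapping.keys p"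
  by (auto simp: in_keys_iff lookup_map_mult)

lemma free_space_simps:
  "carrier (free_space S) = {p. Poly_Mapping.keys p \<subseteq> S}"
  "\<zero>\<^bsub>free_space S\<^esub> = 0"
  "p \<oplus>\<^bsub>free_space S\<^esub> q = p + q"
  "c \<odot>\<^bsub>free_space S\<^esub> p = Poly_Mapping.map ((*) c) p"
  by (simp_all add: free_space_def)

lemma module_free_space: "module class_ring (free_space S :: ('k::field, 's \<Rightarrow>\<^sub>0 'k) module)"
proof (rule module_class_ringI)
  show "p \<oplus>\<^bsub>free_space S\<^esub> q \<in> carrier (free_space S)"
    if "p \<in> carrier (free_space S)" "q \<in> carrier (free_space S)" for p q :: "'s \<Rightarrow>\<^sub>0 'k"
    using that Poly_Mapping.keys_add[of p q] by (auto simp: free_space_simps)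
  show "c \<odot>\<^bsub>free_space S\<^esub> p \<in> carrier (free_space S)"
    if "p \<in> carrier (free_space S)" for c and p :: "'s \<Rightarrow>\<^sub>0 'k"
    using that keys_map_mult[of c p] by (auto simp: free_space_simps)
qed (auto simp: free_space_simps ac_simps lookup_map_mult lookup_add distrib_left distrib_right
      intro!: poly_mapping_eqI)

text \<open>Induction on the support: giving a fresh key \<open>a\<close> the value \<open>b\<close>
  is the same as adding \<open>b\<close> times the basis vector at \<open>a\<close>.\<close>

lemma spanning_free_space:
  "spanning (free_space S :: ('k::field, 's \<Rightarrow>\<^sub>0 'k) module) ((\<lambda>s. Poly_Mapping.single s 1) ` S)"
  unfolding spanning_def
proof (intro conjI allI impI subsetI)
  fix T :: "('s \<Rightarrow>\<^sub>0 'k) set" and p :: "'s \<Rightarrow>\<^sub>0 'k"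
  assume "LinearCombinations.submodule class_ring T (free_space S)"
    and S: "(\<lambda>s. Poly_Mapping.single s 1) ` S \<subseteq> T" and p: "p \<in> carrier (free_space S)"
  then interpret T: LinearCombinations.submodule class_ring T "free_space S" by simp
  have "Poly_Mapping.keys p \<subseteq> S \<Longrightarrow> p \<in> T"
  proof (induction p rule: update_induct)
    case const
    then show ?case
      using T.zero_closed by (simp add: free_space_simps)
  next
    case (update p a b)
    have k: "Poly_Mapping.keys (Poly_Mapping.update a b p) = insert a (Poly_Mapping.keys p)"
      using update by (simp add: keys_update)
    have "Poly_Mapping.update a b p = p + Poly_Mapping.map ((*) b) (Poly_Mapping.single a 1)"
      using update by (intro poly_mapping_eqI)
        (auto simp: lookup_update lookup_add lookup_map_mult lookup_single in_keys_iff when_def)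
    moreover have "p \<in> T" "Poly_Mapping.single a 1 \<in> T"
      using update S k by auto
    ultimately show ?case
      using T.m_closed[of p "Poly_Mapping.map ((*) b) (Poly_Mapping.single a 1)"]
        T.smult_closed[of b "Poly_Mapping.single a 1"]
      by (simp add: free_space_simps)
  qed
  then show "p \<in> T"
    using p by (simp add: free_space_simps)
qed (auto simp: free_space_simps)

lemma linear_extension:
  fixes M :: "('k::field, 'v, 'm) module_scheme"
  assumes "module class_ring M" and g: "\<And>s. s \<in> S \<Longrightarrow> g s \<in> carrier M"
  obtains f where "f \<in> linear_maps (free_space S) M"
    "\<And>s c. s \<in> S \<Longrightarrow> f (Poly_Mapping.single s c) = c \<odot>\<^bsub>M\<^esub> g s"
proof -
  interpret M: Module.module class_ring M by fact
  note M = module_class_ring_simps[OF assms(1)]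
  define f where "f p = (\<Oplus>\<^bsub>M\<^esub>s\<in>Poly_Mapping.keys p. Poly_Mapping.lookup p s \<odot>\<^bsub>M\<^esub> g s)" for p
  \<comment> \<open>Zero coefficients contribute nothing, so any finite set containing the support
    may carry the sum. Additivity is then read off over the union of the two supports.\<close>
  have f: "f p = (\<Oplus>\<^bsub>M\<^esub>s\<in>A. Poly_Mapping.lookup p s \<odot>\<^bsub>M\<^esub> g s)"
    if "finite A" "Poly_Mapping.keys p \<subseteq> A" "A \<subseteq> S" for p A
    unfolding f_def using that g
    by (intro M.add.finprod_mono_neutral_cong_left) (auto simp: in_keys_iff M)
  have fin: "finite (Poly_Mapping.keys p)" for p :: "'a \<Rightarrow>\<^sub>0 'k" by simp
  have "f \<in> linear_maps (free_space S) M"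
  proof (rule linear_mapsI)
    show "f p \<in> carrier M" if "p \<in> carrier (free_space S)" for p
      unfolding f_def using that g by (intro M.finsum_closed) (auto simp: free_space_simps)
    show "f (p \<oplus>\<^bsub>free_space S\<^esub> q) = f p \<oplus>\<^bsub>M\<^esub> f q"
      if "p \<in> carrier (free_space S)" "q \<in> carrier (free_space S)" for p q
    proof -
      let ?A = "Poly_Mapping.keys p \<union> Poly_Mapping.keys q"
      have A: "?A \<subseteq> S" "Poly_Mapping.keys (p + q) \<subseteq> ?A"
        using that Poly_Mapping.keys_add[of p q] by (auto simp: free_space_simps)
      have "f (p + q) = (\<Oplus>\<^bsub>M\<^esub>s\<in>?A. Poly_Mapping.lookup p s \<odot>\<^bsub>M\<^esub> g s \<oplus>\<^bsub>M\<^esub> Poly_Mapping.lookup q s \<odot>\<^bsub>M\<^esub> g s)"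
        unfolding f[OF _ A(2,1), simplified] using A g
        by (intro M.finsum_cong') (auto simp: lookup_add M)
      also have "\<dots> = f p \<oplus>\<^bsub>M\<^esub> f q"
        using A g by (subst M.finsum_addf) (auto simp: f[of ?A])
      finally show ?thesis
        by (simp add: free_space_simps)
    qed
    show "f (c \<odot>\<^bsub>free_space S\<^esub> p) = c \<odot>\<^bsub>M\<^esub> f p" if "p \<in> carrier (free_space S)" for c p
    proof -
      let ?A = "Poly_Mapping.keys p"
      have A: "?A \<subseteq> S" "Poly_Mapping.keys (Poly_Mapping.map ((*) c) p) \<subseteq> ?A"
        using that keys_map_mult[of c p] by (auto simp: free_space_simps)
      have "f (Poly_Mapping.map ((*) c) p) = (\<Oplus>\<^bsub>M\<^esub>s\<in>?A. c \<odot>\<^bsub>M\<^esub> (Poly_Mapping.lookup p s \<odot>\<^bsub>M\<^esub> g s))"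
        unfolding f[OF _ A(2,1), simplified] using A g
        by (intro M.finsum_cong') (auto simp: lookup_map_mult M)
      also have "\<dots> = c \<odot>\<^bsub>M\<^esub> f p"
        unfolding f_def using A g by (intro M.finsum_smult[symmetric]) auto
      finally show ?thesis
        by (simp add: free_space_simps)
    qed
  qed
  moreover have "f (Poly_Mapping.single s c) = c \<odot>\<^bsub>M\<^esub> g s" if "s \<in> S" for s c
    using that g by (subst f[of "{s}"]) (auto simp: lookup_single)
  ultimately show ?thesis
    by (rule that)
qed


subsection \<open>Universal bilinear maps\<close>

definition bilinear :: "('k::field, 'v, 'm) module_scheme \<Rightarrow> ('k, 'w, 'n) module_scheme \<Rightarrow>
    ('k, 'u, 'l) module_scheme \<Rightarrow> ('v \<Rightarrow> 'w \<Rightarrow> 'u) \<Rightarrow> bool"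
  where "bilinear V W M b \<longleftrightarrow>
    (\<forall>x\<in>carrier V. b x \<in> linear_maps W M) \<and> (\<forall>y\<in>carrier W. (\<lambda>x. b x y) \<in> linear_maps V M)"

lemma bilinearD:
  assumes "bilinear V W M b" "x \<in> carrier V" "y \<in> carrier W"
  shows "b x y \<in> carrier M"
    and "x' \<in> carrier V \<Longrightarrow> b (x \<oplus>\<^bsub>V\<^esub> x') y = b x y \<oplus>\<^bsub>M\<^esub> b x' y"
    and "y' \<in> carrier W \<Longrightarrow> b x (y \<oplus>\<^bsub>W\<^esub> y') = b x y \<oplus>\<^bsub>M\<^esub> b x y'"
    and "b (c \<odot>\<^bsub>V\<^esub> x) y = c \<odot>\<^bsub>M\<^esub> b x y"
    and "b x (c \<odot>\<^bsub>W\<^esub> y) = c \<odot>\<^bsub>M\<^esub> b x y"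
  using assms by (auto simp: bilinear_def LinearCombinations.module_hom_def)

lemma bilinearI:
  assumes "\<And>x y. x \<in> carrier V \<Longrightarrow> y \<in> carrier W \<Longrightarrow> b x y \<in> carrier M"
    and "\<And>x x' y. x \<in> carrier V \<Longrightarrow> x' \<in> carrier V \<Longrightarrow> y \<in> carrier W \<Longrightarrow>
      b (x \<oplus>\<^bsub>V\<^esub> x') y = b x y \<oplus>\<^bsub>M\<^esub> b x' y"
    and "\<And>x y y'. x \<in> carrier V \<Longrightarrow> y \<in> carrier W \<Longrightarrow> y' \<in> carrier W \<Longrightarrow>
      b x (y \<oplus>\<^bsub>W\<^esub> y') = b x y \<oplus>\<^bsub>M\<^esub> b x y'"
    and "\<And>c x y. x \<in> carrier V \<Longrightarrow> y \<in> carrier W \<Longrightarrow> b (c \<odot>\<^bsub>V\<^esub> x) y = c \<odot>\<^bsub>M\<^esub> b x y"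
    and "\<And>c x y. x \<in> carrier V \<Longrightarrow> y \<in> carrier W \<Longrightarrow> b x (c \<odot>\<^bsub>W\<^esub> y) = c \<odot>\<^bsub>M\<^esub> b x y"
  shows "bilinear V W M b"
  using assms by (auto simp: bilinear_def LinearCombinations.module_hom_def)

text \<open>
  Both the tensor product and the exterior square are obtained from the free space on pairs by
  imposing a set \<open>R\<close> of relations that contains the bilinear ones.
\<close>

locale bilinear_quotient =
  fixes V :: "('k::field, 'v, 'm) module_scheme" and W :: "('k, 'w, 'n) module_scheme" and R
  assumes module_V: "module class_ring V" and module_W: "module class_ring W"
    and relations: "bilinear_relations V W \<subseteq> R" "R \<subseteq> carrier (free_space (carrier V \<times> carrier W))"
begin

abbreviation F :: "('k, 'v \<times> 'w \<Rightarrow>\<^sub>0 'k) module"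
  where "F \<equiv> free_space (carrier V \<times> carrier W)"

sublocale V: Module.module class_ring V by (rule module_V)
sublocale W: Module.module class_ring W by (rule module_W)

sublocale F: quotient_module F "LinearCombinations.module.span class_ring F R"
  by (rule quotient_module.intro)
    (auto simp: module_free_space intro!: LinearCombinations.module.span_is_submodule relations)

definition pure where "pure x y = F.coset (Poly_Mapping.single (x, y) 1)"

lemma free_minus:
  assumes "p \<in> carrier F" "q \<in> carrier F"
  shows "p \<ominus>\<^bsub>F\<^esub> q = p - q"
proof -
  have "- q \<in> carrier F"
    using assms by (simp add: free_space_simps)
  then have "\<ominus>\<^bsub>F\<^esub> q = - q"
    using assms by (intro F.V.minus_equality) (auto simp: free_space_simps)
  then show ?thesis
    by (simp add: F.V.minus_eq free_space_simps)
qed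

lemma single_in_F: "x \<in> carrier V \<Longrightarrow> y \<in> carrier W \<Longrightarrow> Poly_Mapping.single (x, y) c \<in> carrier F"
  by (simp add: free_space_simps)

lemma coset_eqI:
  "p \<in> carrier F \<Longrightarrow> q \<in> carrier F \<Longrightarrow> p - q \<in> R \<Longrightarrow> F.coset p = F.coset q"
  using F.V.in_own_span[OF relations(2)] by (auto simp: F.coset_eq_iff free_minus)

lemma coset_single:
  assumes "x \<in> carrier V" "y \<in> carrier W"
  shows "F.coset (Poly_Mapping.single (x, y) c) = c \<odot>\<^bsub>F.Q\<^esub> pure x y"
  unfolding pure_def using F.coset_smult[of "Poly_Mapping.single (x, y) 1" c] assms
  by (simp add: single_in_F) (simp add: free_space_simps)

lemma coset_single_add:
  assumes "x \<in> carrier V" "y \<in> carrier W" "x' \<in> carrier V" "y' \<in> carrier W"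
  shows "F.coset (Poly_Mapping.single (x, y) 1 + Poly_Mapping.single (x', y') 1) =
    pure x y \<oplus>\<^bsub>F.Q\<^esub> pure x' y'"
  unfolding pure_def using assms
  by (subst F.coset_add[symmetric]) (auto simp: free_space_simps)

text \<open>For each identity the difference of the two sides, taken in the free space, is literally
  one of the generators in \<open>bilinear_relations\<close>.\<close>

lemma bilinear_pure: "bilinear V W F.Q pure"
proof (rule bilinearI)
  show "pure x y \<in> carrier F.Q" if "x \<in> carrier V" "y \<in> carrier W" for x y
    using that unfolding pure_def F.carrier_quotient by (intro imageI single_in_F)
  have add: "p + q \<in> carrier F" if "p \<in> carrier F" "q \<in> carrier F" for p q
    using F.V.a_closed[OF that] by (simp add: free_space_simps)
  fix x y assume xy: "x \<in> carrier V" "y \<in> carrier W"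
  show "pure (x \<oplus>\<^bsub>V\<^esub> x') y = pure x y \<oplus>\<^bsub>F.Q\<^esub> pure x' y" if "x' \<in> carrier V" for x'
    unfolding coset_single_add[OF xy that xy(2), symmetric] using that xy
    by (subst pure_def, intro coset_eqI add single_in_F V.a_closed subsetD[OF relations(1)])
      (auto simp: bilinear_relations_def diff_diff_eq)
  show "pure x (y \<oplus>\<^bsub>W\<^esub> y') = pure x y \<oplus>\<^bsub>F.Q\<^esub> pure x y'" if "y' \<in> carrier W" for y'
    unfolding coset_single_add[OF xy xy(1) that, symmetric] using that xy
    by (subst pure_def, intro coset_eqI add single_in_F W.a_closed subsetD[OF relations(1)])
      (auto simp: bilinear_relations_def diff_diff_eq)
  show "pure (c \<odot>\<^bsub>V\<^esub> x) y = c \<odot>\<^bsub>F.Q\<^esub> pure x y" for c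
    unfolding coset_single[OF xy, symmetric] using xy
    by (subst pure_def, intro coset_eqI single_in_F V.smult_closed subsetD[OF relations(1)])
      (auto simp: bilinear_relations_def)
  show "pure x (c \<odot>\<^bsub>W\<^esub> y) = c \<odot>\<^bsub>F.Q\<^esub> pure x y" for c
    unfolding coset_single[OF xy, symmetric] using xy
    by (subst pure_def, intro coset_eqI single_in_F W.smult_closed subsetD[OF relations(1)])
      (auto simp: bilinear_relations_def)
qed

lemma spanning_pure: "spanning F.Q {pure x y | x y. x \<in> carrier V \<and> y \<in> carrier W}"
proof -
  have "spanning F.Q (F.coset ` (\<lambda>s. Poly_Mapping.single s 1) ` (carrier V \<times> carrier W))"
    by (intro spanning_image[OF F.module F.module_quotient F.coset_linear])
      (auto simp: F.carrier_quotient spanning_free_space)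
  also have "F.coset ` (\<lambda>s. Poly_Mapping.single s 1) ` (carrier V \<times> carrier W) =
      {pure x y | x y. x \<in> carrier V \<and> y \<in> carrier W}"
    unfolding pure_def by auto
  finally show ?thesis .
qed

text \<open>The linear extension of \<open>b\<close> to the free space kills the bilinear relations
  by bilinearity, so what is left to the user are the additional relations in \<open>R\<close>: none
  for the tensor product, the squares for the exterior square.\<close>

lemma induced_bilinear:
  fixes M :: "('k, 'u, 'l) module_scheme"
  assumes M: "module class_ring M" and b: "bilinear V W M b"
    and R: "\<And>f p. f \<in> linear_maps F M \<Longrightarrow>
      (\<And>x y c. x \<in> carrier V \<Longrightarrow> y \<in> carrier W \<Longrightarrow> f (Poly_Mapping.single (x, y) c) = c \<odot>\<^bsub>M\<^esub> b x y) \<Longrightarrow>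
      p \<in> R - bilinear_relations V W \<Longrightarrow> f p = \<zero>\<^bsub>M\<^esub>"
  obtains g where "g \<in> linear_maps F.Q M"
    "\<And>x y. x \<in> carrier V \<Longrightarrow> y \<in> carrier W \<Longrightarrow> g (pure x y) = b x y"
proof -
  interpret M: Module.module class_ring M by fact
  note Ms = module_class_ring_simps[OF M]
  obtain f where f: "f \<in> linear_maps F M"
    and fs: "\<And>x y c. x \<in> carrier V \<Longrightarrow> y \<in> carrier W \<Longrightarrow> f (Poly_Mapping.single (x, y) c) = c \<odot>\<^bsub>M\<^esub> b x y"
    by (rule linear_extension[OF M, of "carrier V \<times> carrier W" "\<lambda>(x, y). b x y"])
      (use b in \<open>auto dest: bilinearD(1)\<close>)
  interpret f: mod_hom class_ring F M f
    by (rule mod_hom_linear_maps) (fact F.module M f)+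
  have minus: "f (p - q) = f p \<ominus>\<^bsub>M\<^esub> f q" if "p \<in> carrier F" "q \<in> carrier F" for p q
    using that f.f_minus[OF that] by (simp add: free_minus)
  have closed: "p - q \<in> carrier F" if "p \<in> carrier F" "q \<in> carrier F" for p q
    using that F.V.minus_closed[OF that] by (simp add: free_minus)
  have zero: "f p = \<zero>\<^bsub>M\<^esub>" if "p \<in> R" for p
  proof (cases "p \<in> bilinear_relations V W")
    case True
    \<comment> \<open>All four families of bilinear relations are mapped to one of these two
      cancelling expressions.\<close>
    have eq: "u \<oplus>\<^bsub>M\<^esub> w \<ominus>\<^bsub>M\<^esub> u \<ominus>\<^bsub>M\<^esub> w = \<zero>\<^bsub>M\<^esub>" "u \<ominus>\<^bsub>M\<^esub> u = \<zero>\<^bsub>M\<^esub>"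
      if "u \<in> carrier M" "w \<in> carrier M" for u w
    proof -
      have self: "u \<ominus>\<^bsub>M\<^esub> u = \<zero>\<^bsub>M\<^esub>" if "u \<in> carrier M" for u
        using that by (simp add: M.minus_eq M.r_neg)
      then show "u \<ominus>\<^bsub>M\<^esub> u = \<zero>\<^bsub>M\<^esub>"
        using that by simp
      from self[of "u \<oplus>\<^bsub>M\<^esub> w"] show "u \<oplus>\<^bsub>M\<^esub> w \<ominus>\<^bsub>M\<^esub> u \<ominus>\<^bsub>M\<^esub> w = \<zero>\<^bsub>M\<^esub>"
        using that by (simp add: M.minus_eq M.minus_add M.a_assoc)
    qed
    from True show ?thesis
      unfolding bilinear_relations_def
      by (auto simp: minus closed single_in_F fs bilinearD[OF b] Ms eq)
  qed (use that R f fs in auto)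
  have "submodule class_ring f.ker F"
    by (rule f.ker_is_submodule)
  moreover have "R \<subseteq> f.ker"
    using zero relations(2) by (auto simp: f.ker_def)
  ultimately have "LinearCombinations.module.span class_ring F R \<subseteq> f.ker"
    by (intro F.V.span_is_subset)
  then have "f u = \<zero>\<^bsub>M\<^esub>" if "u \<in> LinearCombinations.module.span class_ring F R" for u
    using that by (auto simp: f.ker_def)
  then obtain g where "g \<in> linear_maps F.Q M" "\<And>p. p \<in> carrier F \<Longrightarrow> g (F.coset p) = f p"
    by (rule F.induced_map[OF M f]) auto
  then show ?thesis
    by (intro that[of g]) (auto simp: pure_def single_in_F fs Ms bilinearD[OF b])
qed

end


subsection \<open>Dual bases\<close>

text \<open>The power of \<open>W\<close> indexed by \<open>B\<close>: the coordinate model of the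
  tensor product of \<open>V\<close> and \<open>W\<close> when \<open>B\<close> indexes a basis of
  \<open>V\<close>.\<close>

definition function_space :: "'b set \<Rightarrow> ('k::field, 'w, 'n) module_scheme \<Rightarrow> ('k, 'b \<Rightarrow> 'w) module"
  where "function_space B W =
    \<lparr>carrier = B \<rightarrow>\<^sub>E carrier W,
     mult = (\<lambda>_ _. \<lambda>b\<in>B. \<zero>\<^bsub>W\<^esub>),
     one = (\<lambda>b\<in>B. \<zero>\<^bsub>W\<^esub>),
     zero = (\<lambda>b\<in>B. \<zero>\<^bsub>W\<^esub>),
     add = (\<lambda>f g. \<lambda>b\<in>B. f b \<oplus>\<^bsub>W\<^esub> g b),
     smult = (\<lambda>c f. \<lambda>b\<in>B. c \<odot>\<^bsub>W\<^esub> f b)\<rparr>"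

lemma function_space_simps:
  "carrier (function_space B W) = B \<rightarrow>\<^sub>E carrier W"
  "\<zero>\<^bsub>function_space B W\<^esub> = (\<lambda>b\<in>B. \<zero>\<^bsub>W\<^esub>)"
  "f \<oplus>\<^bsub>function_space B W\<^esub> g = (\<lambda>b\<in>B. f b \<oplus>\<^bsub>W\<^esub> g b)"
  "c \<odot>\<^bsub>function_space B W\<^esub> f = (\<lambda>b\<in>B. c \<odot>\<^bsub>W\<^esub> f b)"
  by (simp_all add: function_space_def)

lemma module_function_space:
  assumes "module class_ring W"
  shows "module class_ring (function_space B W)"
proof -
  interpret W: Module.module class_ring W by fact
  have W: "f b \<in> carrier W" if "f \<in> B \<rightarrow>\<^sub>E carrier W" "b \<in> B" for f b
    using that by auto
  show ?thesis
    by (rule module_class_ringI)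
      (auto simp: function_space_simps module_class_ring_simps[OF assms] W W.a_ac
        intro!: restrict_ext extensionalityI[of _ B] cong: restrict_cong)
qed

lemma ground_space_simps:
  "carrier ground_space = UNIV" "\<zero>\<^bsub>ground_space\<^esub> = 0"
  "x \<oplus>\<^bsub>ground_space\<^esub> y = x + y" "c \<odot>\<^bsub>ground_space\<^esub> x = c * x"
  by (simp_all add: ground_space_def)

lemma module_ground_space: "module class_ring (ground_space :: ('k::field, 'k) module)"
  by (rule module_class_ringI) (auto simp: ground_space_simps algebra_simps)

text \<open>Linear independence is encoded by biorthogonal functionals. They are what is used later:
  contracting with \<open>l b\<close> reads off the coordinate at \<open>b\<close>.\<close>

locale dual_basis =
  fixes V :: "('k::field, 'v, 'm) module_scheme" and B :: "'b set" and v l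
  assumes module_V: "module class_ring V" and finite_B: "finite B"
    and v_closed: "b \<in> B \<Longrightarrow> v b \<in> carrier V"
    and spanning_v: "spanning V (v ` B)"
    and l_linear: "b \<in> B \<Longrightarrow> l b \<in> linear_maps V ground_space"
    and l_v: "b \<in> B \<Longrightarrow> c \<in> B \<Longrightarrow> l b (v c) = (if b = c then 1 else 0)"
begin

sublocale V: Module.module class_ring V by (rule module_V)

lemma l_simps:
  assumes "b \<in> B"
  shows "x \<in> carrier V \<Longrightarrow> y \<in> carrier V \<Longrightarrow> l b (x \<oplus>\<^bsub>V\<^esub> y) = l b x + l b y"
    and "x \<in> carrier V \<Longrightarrow> l b (c \<odot>\<^bsub>V\<^esub> x) = c * l b x"
  using linear_mapsD[OF l_linear[OF assms]] by (auto simp: ground_space_simps)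

end

lemma bilinear_relations_subset:
  assumes "module class_ring V" "module class_ring W"
  shows "bilinear_relations V W \<subseteq> carrier (free_space (carrier V \<times> carrier W))"
proof -
  interpret V: Module.module class_ring V by fact
  interpret W: Module.module class_ring W by fact
  let ?F = "free_space (carrier V \<times> carrier W) :: ('a, 'b \<times> 'd \<Rightarrow>\<^sub>0 'a) module"
  have d: "p - q \<in> carrier ?F" if "p \<in> carrier ?F" "q \<in> carrier ?F" for p q
    using that keys_diff[of p q] by (auto simp: free_space_simps)
  have s: "Poly_Mapping.single (x, y) c \<in> carrier ?F" if "x \<in> carrier V" "y \<in> carrier W" for x y c
    using that by (simp add: free_space_simps)
  show ?thesis
    unfolding bilinear_relations_def by (auto intro!: d s)
qed

lemma linear_maps_finsum:
  assumes "module class_ring V" "module class_ring W" "f \<in> linear_maps V W"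
    and "finite A" "\<And>a. a \<in> A \<Longrightarrow> g a \<in> carrier V"
  shows "f (\<Oplus>\<^bsub>V\<^esub>a\<in>A. g a) = (\<Oplus>\<^bsub>W\<^esub>a\<in>A. f (g a))"
proof -
  interpret V: Module.module class_ring V by fact
  interpret W: Module.module class_ring W by fact
  interpret f: mod_hom class_ring V W f
    by (rule mod_hom_linear_maps) fact+
  show ?thesis
    using assms(4,5) by (induction A) (simp_all add: Pi_iff)
qed

text \<open>The isomorphism sends \<open>w\<close> to the sum of the tensors of \<open>v b\<close>
  with \<open>w b\<close>. It is injective because contraction with \<open>l b\<close> returns
  \<open>w b\<close>, and onto because its image is a submodule that contains all pure
  tensors.\<close>

lemma tensor_product_dual_basis:
  fixes W :: "('k::field, 'w, 'n) module_scheme"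
  assumes "dual_basis V B v l" and W: "module class_ring W"
  shows "function_space B W \<cong>\<^sub>k V \<otimes>\<^sub>k W"
proof -
  interpret dual_basis V B v l by fact
  interpret T: bilinear_quotient V W "bilinear_relations V W"
    by (rule bilinear_quotient.intro[OF module_V W order_refl bilinear_relations_subset[OF module_V W]])
  interpret Q: Module.module class_ring T.F.Q by (rule T.F.module_quotient)
  let ?Q = T.F.Q
  note Qs = module_class_ring_simps[OF T.F.module_quotient]
  note Ws = module_class_ring_simps[OF W]
  note bl = bilinearD[OF T.bilinear_pure]
  have Q: "V \<otimes>\<^sub>k W = T.F.Q"
    by (simp add: tensor_product_def Let_def)
  have pe: "w b \<in> carrier W" if "w \<in> B \<rightarrow>\<^sub>E carrier W" "b \<in> B" for w b
    using that by auto
  define f where "f w = (\<Oplus>\<^bsub>T.F.Q\<^esub>b\<in>B. T.pure (v b) (w b))" for w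
  have pure: "T.pure (v b) (w b) \<in> carrier T.F.Q" if "w \<in> B \<rightarrow>\<^sub>E carrier W" "b \<in> B" for w b
    using that by (intro bl v_closed pe)
  have f_closed: "f w \<in> carrier T.F.Q" if "w \<in> B \<rightarrow>\<^sub>E carrier W" for w
    unfolding f_def using pure[OF that] by (intro Q.finsum_closed) auto
  have f_linear: "f \<in> linear_maps (function_space B W) T.F.Q"
  proof (rule linear_mapsI)
    show "f (x \<oplus>\<^bsub>function_space B W\<^esub> y) = f x \<oplus>\<^bsub>T.F.Q\<^esub> f y"
      if "x \<in> carrier (function_space B W)" "y \<in> carrier (function_space B W)" for x y
    proof -
      have "f (x \<oplus>\<^bsub>function_space B W\<^esub> y) =
          (\<Oplus>\<^bsub>T.F.Q\<^esub>b\<in>B. T.pure (v b) (x b) \<oplus>\<^bsub>T.F.Q\<^esub> T.pure (v b) (y b))"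
        unfolding f_def using that v_closed
        by (intro Q.finsum_cong') (auto simp: function_space_simps pure bl pe)
      also have "\<dots> = f x \<oplus>\<^bsub>T.F.Q\<^esub> f y"
        unfolding f_def using that by (intro Q.finsum_addf) (auto simp: function_space_simps pure)
      finally show ?thesis .
    qed
    show "f (c \<odot>\<^bsub>function_space B W\<^esub> x) = c \<odot>\<^bsub>T.F.Q\<^esub> f x"
      if "x \<in> carrier (function_space B W)" for c x
    proof -
      have "f (c \<odot>\<^bsub>function_space B W\<^esub> x) =
          (\<Oplus>\<^bsub>T.F.Q\<^esub>b\<in>B. c \<odot>\<^bsub>T.F.Q\<^esub> T.pure (v b) (x b))"
        unfolding f_def using that v_closed
        by (intro Q.finsum_cong') (auto simp: function_space_simps pure bl pe)
      also have "\<dots> = c \<odot>\<^bsub>T.F.Q\<^esub> f x"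
        unfolding f_def using that finite_B
        by (intro Q.finsum_smult[symmetric]) (auto simp: function_space_simps pure)
      finally show ?thesis .
    qed
  qed (auto simp: function_space_simps f_closed)
  interpret f: mod_hom class_ring "function_space B W" T.F.Q f
    by (rule mod_hom_linear_maps) (fact module_function_space[OF W] T.F.module_quotient f_linear)+

  have "w b = w' b"
    if w: "w \<in> B \<rightarrow>\<^sub>E carrier W" "w' \<in> B \<rightarrow>\<^sub>E carrier W" "f w = f w'" and b: "b \<in> B" for w w' b
  proof -
    \<comment> \<open>This bilinear map is the contraction of the first factor with
      \<open>l b\<close>.\<close>
    have "bilinear V W W (\<lambda>x y. l b x \<odot>\<^bsub>W\<^esub> y)"
    proof (rule bilinearI)
      show "l b x \<odot>\<^bsub>W\<^esub> (c \<odot>\<^bsub>W\<^esub> y) = c \<odot>\<^bsub>W\<^esub> (l b x \<odot>\<^bsub>W\<^esub> y)" if "y \<in> carrier W" for c x y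
        using that by (metis Ws(3) mult.commute)
    qed (auto simp: Ws l_simps[OF b])
    then obtain g where g: "g \<in> linear_maps T.F.Q W"
      "\<And>x y. x \<in> carrier V \<Longrightarrow> y \<in> carrier W \<Longrightarrow> g (T.pure x y) = l b x \<odot>\<^bsub>W\<^esub> y"
      by (rule T.induced_bilinear[OF W]) auto
    interpret g: mod_hom class_ring T.F.Q W g
      by (rule mod_hom_linear_maps) (fact W T.F.module_quotient g)+
    have gf: "g (f w) = w b" if w: "w \<in> B \<rightarrow>\<^sub>E carrier W" for w
    proof -
      have "g (f w) = (\<Oplus>\<^bsub>W\<^esub>c\<in>B. g (T.pure (v c) (w c)))"
        unfolding f_def using finite_B pure[OF w]
        by (intro linear_maps_finsum[OF T.F.module_quotient W g(1)])
      also have "\<dots> = (\<Oplus>\<^bsub>W\<^esub>c\<in>B. if b = c then w c else \<zero>\<^bsub>W\<^esub>)"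
        using w v_closed b by (intro T.W.finsum_cong') (auto simp: g l_v Ws pe)
      also have "\<dots> = w b"
        using w b finite_B by (intro T.W.finsum_singleton) auto
      finally show ?thesis .
    qed
    show ?thesis
      using gf[OF w(1)] gf[OF w(2)] w(3) by simp
  qed
  then have inj: "inj_on f (carrier (function_space B W))"
    unfolding function_space_simps by (intro inj_onI PiE_ext[of _ B "\<lambda>_. carrier W"])

  have im: "submodule class_ring f.im T.F.Q"
    by (rule f.im_is_submodule)
  have vb: "T.pure (v b) y \<in> f.im" if b: "b \<in> B" and y: "y \<in> carrier W" for b y
  proof -
    \<comment> \<open>Concentrated at \<open>b\<close>, so that the sum defining \<open>f w\<close>
      has a single nonzero term.\<close>
    define w where "w = (\<lambda>c\<in>B. if b = c then y else \<zero>\<^bsub>W\<^esub>)"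
    have w: "w \<in> B \<rightarrow>\<^sub>E carrier W"
      using y by (auto simp: w_def)
    have "T.pure (v c) \<zero>\<^bsub>W\<^esub> = \<zero>\<^bsub>T.F.Q\<^esub>" if "c \<in> B" for c
      using bl(5)[OF v_closed[OF that] T.W.zero_closed, of 0] v_closed[OF that]
      by (simp add: Ws Qs bl(1))
    then have "f w = (\<Oplus>\<^bsub>T.F.Q\<^esub>c\<in>B. if b = c then T.pure (v c) y else \<zero>\<^bsub>T.F.Q\<^esub>)"
      unfolding f_def using v_closed y T.bilinear_pure
      by (intro Q.finsum_cong') (auto simp: w_def bilinearD)
    also have "\<dots> = T.pure (v b) y"
      using b finite_B v_closed y T.bilinear_pure by (intro Q.finsum_singleton) (auto simp: bilinearD)
    finally show ?thesis
      using w by (auto simp: f.im_def function_space_simps intro!: image_eqI[of _ _ w])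
  qed
  have "T.pure x y \<in> f.im" if "x \<in> carrier V" "y \<in> carrier W" for x y
  proof -
    have "(\<lambda>x. T.pure x y) \<in> linear_maps V T.F.Q"
      using T.bilinear_pure that by (auto simp: bilinear_def)
    then have "submodule class_ring {x \<in> carrier V. T.pure x y \<in> f.im} V"
      by (intro submodule_vimage[OF module_V T.F.module_quotient _ im])
    from spanning_induct[OF spanning_v this, of x] show ?thesis
      using that vb v_closed by auto
  qed
  then have "{T.pure x y | x y. x \<in> carrier V \<and> y \<in> carrier W} \<subseteq> f.im"
    by auto
  then have "f.im = carrier T.F.Q"
    using spanning_induct[OF T.spanning_pure im] f_closed by (auto simp: f.im_def function_space_simps)
  then have "bij_betw f (carrier (function_space B W)) (carrier T.F.Q)"
    using inj by (simp add: bij_betw_def f.im_def)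
  then show ?thesis
    unfolding Q linearly_isomorphic_def using f_linear by blast
qed

text \<open>The basis consists of the wedges of \<open>v a\<close> and \<open>v b\<close> with a <
  b. The dual functionals are 2 by 2 minors; they vanish on squares and so descend to the quotient.
  The linear order on the index type selects one of each two opposite wedges.\<close>

lemma exterior_square_dual_basis:
  fixes V :: "('k::field, 'v, 'm) module_scheme" and B :: "'b::linorder set"
  assumes "dual_basis V B v l"
  obtains v' l' where "dual_basis (exterior_square V) {(a, b). a \<in> B \<and> b \<in> B \<and> a < b} v' l'"
proof -
  interpret dual_basis V B v l by fact
  define A where "A = {Poly_Mapping.single (x, x) (1::'k) | x. x \<in> carrier V}"
  interpret T: bilinear_quotient V V "bilinear_relations V V \<union> A"
    using module_V bilinear_relations_subset[OF module_V module_V]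
    by unfold_locales (auto simp: A_def free_space_simps)
  interpret Q: Module.module class_ring T.F.Q by (rule T.F.module_quotient)
  note Qs = module_class_ring_simps[OF T.F.module_quotient]
  note bl = bilinearD[OF T.bilinear_pure]
  have Q: "exterior_square V = T.F.Q"
    by (simp add: exterior_square_def A_def Let_def)
  have alt: "T.pure x x = \<zero>\<^bsub>T.F.Q\<^esub>" if x: "x \<in> carrier V" for x
    unfolding T.pure_def T.F.coset_zero[symmetric] using x T.F.V.zero_closed
    by (intro T.coset_eqI) (auto simp: A_def free_space_simps)
  \<comment> \<open>Polarisation: the square of x + y vanishes, and so do those of x and y.\<close>
  have anti: "T.pure y x = (-1) \<odot>\<^bsub>T.F.Q\<^esub> T.pure x y" if xy: "x \<in> carrier V" "y \<in> carrier V" for x y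
  proof -
    have "T.pure (x \<oplus>\<^bsub>V\<^esub> y) (x \<oplus>\<^bsub>V\<^esub> y) = \<zero>\<^bsub>T.F.Q\<^esub>"
      using xy by (intro alt) auto
    moreover have "T.pure (x \<oplus>\<^bsub>V\<^esub> y) (x \<oplus>\<^bsub>V\<^esub> y) =
        (T.pure x x \<oplus>\<^bsub>T.F.Q\<^esub> T.pure y x) \<oplus>\<^bsub>T.F.Q\<^esub> (T.pure x y \<oplus>\<^bsub>T.F.Q\<^esub> T.pure y y)"
      using xy by (simp add: bl)
    ultimately have "T.pure x y \<oplus>\<^bsub>T.F.Q\<^esub> T.pure y x = \<zero>\<^bsub>T.F.Q\<^esub>"
      using xy by (simp add: bl alt[OF xy(1)] alt[OF xy(2)] Q.a_comm)
    then have "T.pure y x = \<ominus>\<^bsub>T.F.Q\<^esub> T.pure x y"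
      using xy by (metis Q.minus_equality Q.a_comm bl(1))
    also have "\<dots> = (-1) \<odot>\<^bsub>T.F.Q\<^esub> T.pure x y"
      using Q.smult_minus_1[of "T.pure x y"] xy by (simp add: bl class_ring_simps)
    finally show ?thesis .
  qed
  define P where "P = {(a, b). a \<in> B \<and> b \<in> B \<and> a < b}"
  define v' where "v' = (\<lambda>(a, b). T.pure (v a) (v b))"
  have "\<exists>g. g \<in> linear_maps T.F.Q ground_space \<and>
      (\<forall>x y. x \<in> carrier V \<longrightarrow> y \<in> carrier V \<longrightarrow> g (T.pure x y) = l a x * l b y - l a y * l b x)"
    if "a \<in> B" "b \<in> B" for a b
  proof -
    have "bilinear V V ground_space (\<lambda>x y. l a x * l b y - l a y * l b x)"
      using that by (intro bilinearI) (auto simp: ground_space_simps l_simps algebra_simps)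
    then show ?thesis
      by (rule T.induced_bilinear[OF module_ground_space]) (auto simp: A_def ground_space_simps)
  qed
  then have "\<exists>g. g \<in> linear_maps T.F.Q ground_space \<and>
      (\<forall>x y. x \<in> carrier V \<longrightarrow> y \<in> carrier V \<longrightarrow>
        g (T.pure x y) = l (fst p) x * l (snd p) y - l (fst p) y * l (snd p) x)"
    if "p \<in> P" for p
    using that unfolding P_def by auto
  then obtain l' where l': "\<And>p. p \<in> P \<Longrightarrow> l' p \<in> linear_maps T.F.Q ground_space"
    "\<And>p x y. p \<in> P \<Longrightarrow> x \<in> carrier V \<Longrightarrow> y \<in> carrier V \<Longrightarrow>
        l' p (T.pure x y) = l (fst p) x * l (snd p) y - l (fst p) y * l (snd p) x"
    by metis
  have "dual_basis T.F.Q P v' l'"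
  proof (rule dual_basis.intro)
    show "module class_ring T.F.Q"
      by (rule T.F.module_quotient)
    show "finite P"
      by (rule finite_subset[of _ "B \<times> B"]) (auto simp: P_def finite_B)
    show closed: "v' p \<in> carrier T.F.Q" if "p \<in> P" for p
      using that by (auto simp: P_def v'_def intro!: bl v_closed)
    show "l' p \<in> linear_maps T.F.Q ground_space" if "p \<in> P" for p
      using l'(1)[OF that] .
    show "l' p (v' q) = (if p = q then 1 else 0)" if "p \<in> P" "q \<in> P" for p q
      using that by (auto simp: l' v'_def P_def v_closed l_v split: prod.splits)
    show "spanning T.F.Q (v' ` P)"
      unfolding spanning_def
    proof (intro conjI allI impI subsetI)
      fix T x assume T: "submodule class_ring T T.F.Q" and PT: "v' ` P \<subseteq> T" and x: "x \<in> carrier T.F.Q"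
      interpret T': LinearCombinations.submodule class_ring T T.F.Q by fact
      have "T.pure (v a) (v b) \<in> T" if ab: "a \<in> B" "b \<in> B" for a b
      proof (cases a b rule: linorder_cases)
        case less
        then show ?thesis
          using PT ab by (force simp: P_def v'_def)
      next
        case equal
        then show ?thesis
          using alt v_closed ab by simp
      next
        case greater
        then have "T.pure (v b) (v a) \<in> T"
          using PT ab by (force simp: P_def v'_def)
        then show ?thesis
          using anti[of "v b" "v a"] v_closed ab by simp
      qed
      then have vT: "v ` B \<subseteq> {x \<in> carrier V. T.pure x (v b) \<in> T}" if "b \<in> B" for b
        using that v_closed by auto
      have "submodule class_ring {x \<in> carrier V. T.pure x y \<in> T} V" if "y \<in> carrier V" for y
        using T.bilinear_pure that
        by (intro submodule_vimage[OF module_V T.F.module_quotient _ T]) (auto simp: bilinear_def)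
      \<comment> \<open>Two spanning inductions in a row: the first factor becomes arbitrary while
        the second is still a basis vector, then the second one follows.\<close>
      then have "T.pure x (v b) \<in> T" if "x \<in> carrier V" "b \<in> B" for x b
        using spanning_induct[OF spanning_v _ vT, of b x] that v_closed by auto
      then have vT: "v ` B \<subseteq> {y \<in> carrier V. T.pure x y \<in> T}" if "x \<in> carrier V" for x
        using that v_closed by auto
      have "submodule class_ring {y \<in> carrier V. T.pure x y \<in> T} V" if "x \<in> carrier V" for x
        using T.bilinear_pure that
        by (intro submodule_vimage[OF module_V T.F.module_quotient _ T]) (auto simp: bilinear_def)
      then have "T.pure x y \<in> T" if "x \<in> carrier V" "y \<in> carrier V" for x y
        using spanning_induct[OF spanning_v _ vT, of x y] that by auto
      then show "x \<in> T"
        using spanning_induct[OF T.spanning_pure T _ x] by auto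
    qed (use closed in auto)
  qed
  then show ?thesis
    unfolding P_def Q[symmetric] by (rule that)
qed


section \<open>Low-degree Chevalley--Eilenberg cochains\<close>

lemma tuples_1: "tuples L (Suc 0) = {[x] | x. x \<in> carrier L}"
  by (auto simp: tuples_def length_Suc_conv)

lemma tuples_2: "tuples L 2 = {[x, y] | x y. x \<in> carrier L \<and> y \<in> carrier L}"
  by (auto simp: tuples_def length_Suc_conv numeral_2_eq_2)

lemma tuples_3:
  "tuples L (Suc 2) = {[x, y, w] | x y w. x \<in> carrier L \<and> y \<in> carrier L \<and> w \<in> carrier L}"
  by (auto simp: tuples_def length_Suc_conv numeral_2_eq_2)

lemma ce_cochains_simps:
  "\<zero>\<^bsub>ce_cochains L M n\<^esub> = (\<lambda>xs \<in> tuples L n. \<zero>\<^bsub>M\<^esub>)"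
  "f \<oplus>\<^bsub>ce_cochains L M n\<^esub> g = (\<lambda>xs \<in> tuples L n. f xs \<oplus>\<^bsub>M\<^esub> g xs)"
  "c \<odot>\<^bsub>ce_cochains L M n\<^esub> f = (\<lambda>xs \<in> tuples L n. c \<odot>\<^bsub>M\<^esub> f xs)"
  by (simp_all only: ce_cochains_def ring.simps module.simps)

lemma ce_cochains_1_iff:
  "f \<in> carrier (ce_cochains L M (Suc 0)) \<longleftrightarrow>
    f \<in> extensional (tuples L (Suc 0)) \<and> (\<lambda>x. f [x]) \<in> linear_maps L M"
proof
  assume "f \<in> carrier (ce_cochains L M (Suc 0))"
  then show "f \<in> extensional (tuples L (Suc 0)) \<and> (\<lambda>x. f [x]) \<in> linear_maps L M"
    by (cases "carrier L = {}")
      (auto simp: ce_cochains_def tuples_1 LinearCombinations.module_hom_def PiE_def)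
next
  assume f: "f \<in> extensional (tuples L (Suc 0)) \<and> (\<lambda>x. f [x]) \<in> linear_maps L M"
  then have "f \<in> tuples L (Suc 0) \<rightarrow>\<^sub>E carrier M"
    by (auto simp: PiE_def tuples_1 dest: linear_mapsD)
  with f show "f \<in> carrier (ce_cochains L M (Suc 0))"
    by (auto simp: ce_cochains_def tuples_1)
qed

lemma ce_cochains_2_iff:
  "f \<in> carrier (ce_cochains L M 2) \<longleftrightarrow> f \<in> extensional (tuples L 2) \<and>
    bilinear L L M (\<lambda>x y. f [x, y]) \<and> (\<forall>x \<in> carrier L. f [x, x] = \<zero>\<^bsub>M\<^esub>)"
proof
  assume f: "f \<in> carrier (ce_cochains L M 2)"
  have "(\<lambda>x. f [x, y]) \<in> linear_maps L M" "f [y, y] = \<zero>\<^bsub>M\<^esub>" if "y \<in> carrier L" for y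
  proof -
    \<comment> \<open>Overwriting entry 0 discards the first y, so this tuple yields linearity in
      the first argument; having a repeated entry, it also yields alternation.\<close>
    have y: "[y, y] \<in> tuples L 2"
      using that by (auto simp: tuples_2)
    have "(\<lambda>x. f ([y, y][0 := x])) \<in> linear_maps L M"
      using f y by (fastforce simp: ce_cochains_def)
    then show "(\<lambda>x. f [x, y]) \<in> linear_maps L M"
      by simp
    show "f [y, y] = \<zero>\<^bsub>M\<^esub>"
      using f y by (fastforce simp: ce_cochains_def)
  qed
  moreover have "(\<lambda>y. f [x, y]) \<in> linear_maps L M" if "x \<in> carrier L" for x
  proof -
    have y: "[x, x] \<in> tuples L 2"
      using that by (auto simp: tuples_2)
    have "\<forall>i<2. (\<lambda>y. f ([x, x][i := y])) \<in> linear_maps L M"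
      using f y by (auto simp: ce_cochains_def)
    then have "(\<lambda>y. f ([x, x][1 := y])) \<in> linear_maps L M"
      by (rule allE[of _ 1]) simp
    then show ?thesis
      by simp
  qed
  ultimately show "f \<in> extensional (tuples L 2) \<and>
    bilinear L L M (\<lambda>x y. f [x, y]) \<and> (\<forall>x \<in> carrier L. f [x, x] = \<zero>\<^bsub>M\<^esub>)"
    using f by (auto simp: bilinear_def ce_cochains_def PiE_def)
next
  assume f: "f \<in> extensional (tuples L 2) \<and>
    bilinear L L M (\<lambda>x y. f [x, y]) \<and> (\<forall>x \<in> carrier L. f [x, x] = \<zero>\<^bsub>M\<^esub>)"
  then have ext: "f \<in> extensional (tuples L 2)" and bil: "bilinear L L M (\<lambda>x y. f [x, y])"
    and alt: "\<And>x. x \<in> carrier L \<Longrightarrow> f [x, x] = \<zero>\<^bsub>M\<^esub>"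
    by auto
  have "f xs \<in> carrier M" if xs: "xs \<in> tuples L 2" for xs
    using xs bilinearD(1)[OF bil] unfolding tuples_2 by blast
  then have "f \<in> tuples L 2 \<rightarrow>\<^sub>E carrier M"
    using ext by (simp add: PiE_def)
  moreover have "(\<lambda>x. f (xs[i := x])) \<in> linear_maps L M" if xs: "xs \<in> tuples L 2" and "i < 2" for xs i
  proof -
    obtain x y where xs: "xs = [x, y]" "x \<in> carrier L" "y \<in> carrier L"
      using xs by (auto simp: tuples_2)
    from \<open>i < 2\<close> have "i = 0 \<or> i = Suc 0"
      by (auto simp: less_2_cases_iff)
    then show ?thesis
      using bil xs by (auto simp: bilinear_def)
  qed
  moreover have "f xs = \<zero>\<^bsub>M\<^esub>" if xs: "xs \<in> tuples L 2" and "\<not> distinct xs" for xs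
  proof -
    obtain x y where "xs = [x, y]" "x \<in> carrier L" "y \<in> carrier L"
      using xs by (auto simp: tuples_2)
    then show ?thesis
      using alt \<open>\<not> distinct xs\<close> by simp
  qed
  ultimately show "f \<in> carrier (ce_cochains L M 2)"
    unfolding ce_cochains_def partial_object.simps by (intro CollectI conjI ballI allI impI) simp_all
qed

text \<open>The membership hypotheses list the summands: a sum in a module unfolds term by term only
  if the terms are known to lie in the carrier.\<close>

lemma ce_differential_1:
  fixes M :: "('k::field, 'v, 'm) module_scheme"
  assumes "module class_ring M"
    and "x \<in> carrier L" "y \<in> carrier L"
    and "act x (f [y]) \<in> carrier M" "act y (f [x]) \<in> carrier M" "f [bracket L x y] \<in> carrier M"
  shows "ce_differential L M act (Suc 0) f [x, y] =
    act x (f [y]) \<oplus>\<^bsub>M\<^esub> (- 1) \<odot>\<^bsub>M\<^esub> act y (f [x]) \<oplus>\<^bsub>M\<^esub> (- 1) \<odot>\<^bsub>M\<^esub> f [bracket L x y]"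
proof -
  interpret M: Module.module class_ring M by fact
  note Ms = module_class_ring_simps[OF assms(1)]
  have "[x, y] \<in> tuples L (Suc (Suc 0))"
    using assms by (auto simp: tuples_def)
  moreover have "(\<Oplus>\<^bsub>M\<^esub>i\<in>{..Suc 0}. (- 1) ^ i \<odot>\<^bsub>M\<^esub> act ([x, y] ! i) (f (delete_nth i [x, y]))) =
      act x (f [y]) \<oplus>\<^bsub>M\<^esub> (- 1) \<odot>\<^bsub>M\<^esub> act y (f [x])"
    using assms M.a_comm by (simp add: delete_nth_def Pi_iff atMost_Suc Ms)
  moreover have "(\<Oplus>\<^bsub>M\<^esub>j\<in>{..Suc 0}. \<Oplus>\<^bsub>M\<^esub>i\<in>{..<j}. (- 1) ^ (i + j) \<odot>\<^bsub>M\<^esub>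
      f (bracket L ([x, y] ! i) ([x, y] ! j) # delete_nth i (delete_nth j [x, y]))) =
      (- 1) \<odot>\<^bsub>M\<^esub> f [bracket L x y]"
    using assms by (simp add: delete_nth_def Pi_iff atMost_Suc lessThan_Suc)
  ultimately show ?thesis
    by (simp add: ce_differential_def)
qed

lemma ce_differential_2:
  fixes M :: "('k::field, 'v, 'm) module_scheme"
  assumes "module class_ring M"
    and "x \<in> carrier L" "y \<in> carrier L" "w \<in> carrier L"
    and "act x (f [y, w]) \<in> carrier M" "act y (f [x, w]) \<in> carrier M" "act w (f [x, y]) \<in> carrier M"
    and "f [bracket L x y, w] \<in> carrier M" "f [bracket L x w, y] \<in> carrier M"
      "f [bracket L y w, x] \<in> carrier M"
  shows "ce_differential L M act 2 f [x, y, w] =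
    (act w (f [x, y]) \<oplus>\<^bsub>M\<^esub> ((- 1) \<odot>\<^bsub>M\<^esub> act y (f [x, w]) \<oplus>\<^bsub>M\<^esub> act x (f [y, w]))) \<oplus>\<^bsub>M\<^esub>
    ((- 1) \<odot>\<^bsub>M\<^esub> f [bracket L y w, x] \<oplus>\<^bsub>M\<^esub> f [bracket L x w, y] \<oplus>\<^bsub>M\<^esub> (- 1) \<odot>\<^bsub>M\<^esub> f [bracket L x y, w])"
proof -
  interpret M: Module.module class_ring M by fact
  note Ms = module_class_ring_simps[OF assms(1)]
  have "[x, y, w] \<in> tuples L (Suc 2)"
    using assms by (auto simp: tuples_def)
  moreover have "(\<Oplus>\<^bsub>M\<^esub>i\<in>{..2}. (- 1) ^ i \<odot>\<^bsub>M\<^esub> act ([x, y, w] ! i) (f (delete_nth i [x, y, w]))) =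
      act w (f [x, y]) \<oplus>\<^bsub>M\<^esub> ((- 1) \<odot>\<^bsub>M\<^esub> act y (f [x, w]) \<oplus>\<^bsub>M\<^esub> act x (f [y, w]))"
    using assms by (simp add: delete_nth_def Pi_iff atMost_Suc Ms numeral_2_eq_2)
  moreover have "(\<Oplus>\<^bsub>M\<^esub>j\<in>{..2}. \<Oplus>\<^bsub>M\<^esub>i\<in>{..<j}. (- 1) ^ (i + j) \<odot>\<^bsub>M\<^esub>
      f (bracket L ([x, y, w] ! i) ([x, y, w] ! j) # delete_nth i (delete_nth j [x, y, w]))) =
      (- 1) \<odot>\<^bsub>M\<^esub> f [bracket L y w, x] \<oplus>\<^bsub>M\<^esub> f [bracket L x w, y] \<oplus>\<^bsub>M\<^esub> (- 1) \<odot>\<^bsub>M\<^esub> f [bracket L x y, w]"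
    using assms by (simp add: delete_nth_def Pi_iff atMost_Suc lessThan_Suc Ms numeral_2_eq_2)
  ultimately show ?thesis
    by (simp add: ce_differential_def)
qed


section \<open>The Lie poset algebra in coordinates\<close>

lemma sum_fun_apply [simp]: "(\<Sum>a\<in>A. f a) p = (\<Sum>a\<in>A. f a p)"
  by (induction A rule: infinite_finite_induct) auto

text \<open>Elements of the algebra are extensional functions, with value \<open>undefined\<close>
  outside \<open>r\<close>; \<open>cut\<close> puts zeros there and so turns them into genuine
  matrices.\<close>

definition cut :: "'a rel \<Rightarrow> ('a \<times> 'a \<Rightarrow> 'k::field) \<Rightarrow> 'a \<times> 'a \<Rightarrow> 'k"
  where "cut r x p = (if p \<in> r then x p else 0)"

text \<open>The zeros supplied by \<open>cut\<close> let the sum run over all of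
  \<open>Field r\<close> instead of the interval between the two indices. Associativity is then an
  exchange of sums over one fixed set, and the product does not see values outside
  \<open>r\<close>.\<close>

definition mat_mult :: "'a rel \<Rightarrow> ('a \<times> 'a \<Rightarrow> 'k::field) \<Rightarrow> ('a \<times> 'a \<Rightarrow> 'k) \<Rightarrow> 'a \<times> 'a \<Rightarrow> 'k"
  where "mat_mult r x y p = (\<Sum>j\<in>Field r. cut r x (fst p, j) * cut r y (j, snd p))"

definition commutator :: "'a rel \<Rightarrow> ('a \<times> 'a \<Rightarrow> 'k::field) \<Rightarrow> ('a \<times> 'a \<Rightarrow> 'k) \<Rightarrow> 'a \<times> 'a \<Rightarrow> 'k"
  where "commutator r x y = mat_mult r x y - mat_mult r y x"

definition scale :: "'k::field \<Rightarrow> ('a \<Rightarrow> 'k) \<Rightarrow> 'a \<Rightarrow> 'k"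
  where "scale c x p = c * x p"

lemma cut_restrict [simp]: "cut r (restrict x r) = cut r x"
  by (auto simp: cut_def)

lemma mat_mult_restrict [simp]:
  "mat_mult r (restrict x r) y = mat_mult r x y" "mat_mult r x (restrict y r) = mat_mult r x y"
  by (simp_all add: mat_mult_def fun_eq_iff)

lemma commutator_restrict [simp]:
  "commutator r (restrict x r) y = commutator r x y"
  "commutator r x (restrict y r) = commutator r x y"
  by (simp_all add: commutator_def)

lemma mat_mult_linear:
  "mat_mult r (x + x') y = mat_mult r x y + mat_mult r x' y"
  "mat_mult r x (y + y') = mat_mult r x y + mat_mult r x y'"
  "mat_mult r (x - x') y = mat_mult r x y - mat_mult r x' y"
  "mat_mult r x (y - y') = mat_mult r x y - mat_mult r x y'"
  "mat_mult r (scale c x) y = scale c (mat_mult r x y)"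
  "mat_mult r x (scale c y) = scale c (mat_mult r x y)"
  "mat_mult r 0 y = 0" "mat_mult r x 0 = 0"
proof -
  have c: "cut r (u + v) = cut r u + cut r v" "cut r (u - v) = cut r u - cut r v"
    "cut r (scale c u) = scale c (cut r u)" "cut r 0 = 0" for u v :: "'a \<times> 'a \<Rightarrow> 'b"
    by (auto simp: cut_def scale_def fun_eq_iff)
  show "mat_mult r (x + x') y = mat_mult r x y + mat_mult r x' y"
    "mat_mult r x (y + y') = mat_mult r x y + mat_mult r x y'"
    "mat_mult r (x - x') y = mat_mult r x y - mat_mult r x' y"
    "mat_mult r x (y - y') = mat_mult r x y - mat_mult r x y'"
    "mat_mult r (scale c x) y = scale c (mat_mult r x y)"
    "mat_mult r x (scale c y) = scale c (mat_mult r x y)"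
    "mat_mult r 0 y = 0" "mat_mult r x 0 = 0"
    by (auto simp: mat_mult_def fun_eq_iff c algebra_simps sum.distrib sum_subtractf scale_def
        sum_distrib_left intro!: sum.cong)
qed

lemma scale_linear:
  "scale c (x + y) = scale c x + scale c y" "scale c (x - y) = scale c x - scale c y"
  "scale (a + b) x = scale a x + scale b x" "scale (a * b) x = scale a (scale b x)"
  "scale c 0 = 0" "scale 0 x = 0" "scale 1 x = x" "scale (- 1) x = - x"
  by (auto simp: scale_def fun_eq_iff algebra_simps)

lemma commutator_linear:
  "commutator r (x + x') y = commutator r x y + commutator r x' y"
  "commutator r x (y + y') = commutator r x y + commutator r x y'"
  "commutator r (x - x') y = commutator r x y - commutator r x' y"
  "commutator r x (y - y') = commutator r x y - commutator r x y'"
  "commutator r (scale c x) y = scale c (commutator r x y)"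
  "commutator r x (scale c y) = scale c (commutator r x y)"
  "commutator r 0 y = 0" "commutator r x 0 = 0" "commutator r x x = 0"
  by (auto simp: commutator_def mat_mult_linear scale_linear algebra_simps)

lemma commutator_swap: "commutator r x y = - commutator r y x"
  by (simp add: commutator_def)

section \<open>The Lie algebra of a fixed finite poset\<close>

locale poset_lie =
  fixes N :: nat and r :: "nat rel" and k_type :: "'k::field itself"
  assumes partial_order: "partial_order_on {1..N} r"
    and char_k: "CHAR('k) = 0 \<or> CHAR('k) > N"
begin

lemma r_subset: "(i, j) \<in> r \<Longrightarrow> 1 \<le> i \<and> i \<le> N \<and> 1 \<le> j \<and> j \<le> N"
  and r_refl: "1 \<le> i \<Longrightarrow> i \<le> N \<Longrightarrow> (i, i) \<in> r"
  and r_trans: "(i, j) \<in> r \<Longrightarrow> (j, k) \<in> r \<Longrightarrow> (i, k) \<in> r"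
  and r_antisym: "(i, j) \<in> r \<Longrightarrow> (j, i) \<in> r \<Longrightarrow> i = j"
proof -
  note po = partial_order_onD[OF partial_order]
  show "(i, j) \<in> r \<Longrightarrow> 1 \<le> i \<and> i \<le> N \<and> 1 \<le> j \<and> j \<le> N"
    using po(4) by auto
  show "1 \<le> i \<Longrightarrow> i \<le> N \<Longrightarrow> (i, i) \<in> r"
    using po(1) by (auto simp: refl_on_def)
  show "(i, j) \<in> r \<Longrightarrow> (j, k) \<in> r \<Longrightarrow> (i, k) \<in> r"
    using po(2) by (auto dest: transD)
  show "(i, j) \<in> r \<Longrightarrow> (j, i) \<in> r \<Longrightarrow> i = j"
    using po(3) by (auto dest: antisymD)
qed

lemma Field_r: "Field r = {1..N}"
  using r_subset r_refl by (auto simp: Field_def) blast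

lemma r_diag: "i \<in> Field r \<Longrightarrow> (i, i) \<in> r"
  by (simp add: Field_r r_refl)

lemma finite_r: "finite r"
  by (rule finite_subset[of _ "{1..N} \<times> {1..N}"]) (auto dest: r_subset)

lemma r_refls: "(i, j) \<in> r \<Longrightarrow> (i, i) \<in> r" "(i, j) \<in> r \<Longrightarrow> (j, j) \<in> r"
  using r_subset r_refl by auto

abbreviation mm :: "(nat \<times> nat \<Rightarrow> 'k) \<Rightarrow> (nat \<times> nat \<Rightarrow> 'k) \<Rightarrow> nat \<times> nat \<Rightarrow> 'k"
  where "mm \<equiv> mat_mult r"
abbreviation br :: "(nat \<times> nat \<Rightarrow> 'k) \<Rightarrow> (nat \<times> nat \<Rightarrow> 'k) \<Rightarrow> nat \<times> nat \<Rightarrow> 'k"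
  where "br \<equiv> commutator r"
abbreviation rest :: "(nat \<times> nat \<Rightarrow> 'k) \<Rightarrow> nat \<times> nat \<Rightarrow> 'k"
  where "rest x \<equiv> restrict x r"
abbreviation L :: "('k, nat \<times> nat \<Rightarrow> 'k) lie_algebra"
  where "L \<equiv> lie_poset_algebra r"

text \<open>Transitivity: outside \<open>r\<close> no intermediate index is possible, so a product
  already vanishes there and can be multiplied again without cutting.\<close>

lemma cut_mm: "cut r (mm x y) = mm x y"
proof (rule ext)
  fix p
  have "cut r x (fst p, j) * cut r y (j, snd p) = 0" if "p \<notin> r" for j
    using that r_trans[of "fst p" j "snd p"] by (auto simp: cut_def)
  then show "cut r (mm x y) p = mm x y p"
    by (auto simp: cut_def[of _ "mm x y"] mat_mult_def)
qed

lemma mm_assoc: "mm (mm x y) w = mm x (mm y w)"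
proof (rule ext)
  fix p
  have "mm (mm x y) w p = (\<Sum>k\<in>Field r. \<Sum>j\<in>Field r. cut r x (fst p, j) * cut r y (j, k) * cut r w (k, snd p))"
    unfolding mat_mult_def[of _ "mm x y"] cut_mm by (simp add: mat_mult_def sum_distrib_right)
  also have "\<dots> = (\<Sum>j\<in>Field r. \<Sum>k\<in>Field r. cut r x (fst p, j) * cut r y (j, k) * cut r w (k, snd p))"
    by (rule sum.swap)
  also have "\<dots> = mm x (mm y w) p"
    unfolding mat_mult_def[of _ x] cut_mm by (simp add: mat_mult_def sum_distrib_left mult.assoc)
  finally show "mm (mm x y) w p = mm x (mm y w) p" .
qed

lemma jacobi: "br x (br y w) = br (br x y) w + br y (br x w)"
  by (simp add: commutator_def mat_mult_linear mm_assoc algebra_simps)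

lemma mm_sum:
  assumes "(i, k) \<in> r"
  shows "mm x y (i, k) = (\<Sum>j | (i, j) \<in> r \<and> (j, k) \<in> r. x (i, j) * y (j, k))"
proof -
  have "mm x y (i, k) = (\<Sum>j\<in>Field r. if (i, j) \<in> r \<and> (j, k) \<in> r then x (i, j) * y (j, k) else 0)"
    unfolding mat_mult_def by (intro sum.cong) (auto simp: cut_def)
  also have "\<dots> = (\<Sum>j\<in>{j \<in> Field r. (i, j) \<in> r \<and> (j, k) \<in> r}. x (i, j) * y (j, k))"
    by (rule sum.inter_filter[symmetric]) (simp add: Field_r)
  also have "{j \<in> Field r. (i, j) \<in> r \<and> (j, k) \<in> r} = {j. (i, j) \<in> r \<and> (j, k) \<in> r}"
    by (auto simp: Field_def)
  finally show ?thesis .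
qed

text \<open>By antisymmetry only i itself lies between i and i. Diagonals therefore multiply
  entrywise, and commutators have zero diagonal, not merely zero trace.\<close>

lemma mm_diag: "(i, i) \<in> r \<Longrightarrow> mm x y (i, i) = x (i, i) * y (i, i)"
proof -
  assume i: "(i, i) \<in> r"
  then have "{j. (i, j) \<in> r \<and> (j, i) \<in> r} = {i}"
    using r_antisym by auto
  then show ?thesis
    by (simp add: mm_sum[OF i])
qed

lemma br_diag: "(i, i) \<in> r \<Longrightarrow> br x y (i, i) = 0"
  by (simp add: commutator_def mm_diag)

lemma module_poset_algebra: "module class_ring (poset_algebra r :: ('k, nat \<times> nat \<Rightarrow> 'k) module)"
  by (rule module_class_ringI)
    (auto simp: poset_algebra_def class_ring.func_space_def algebra_simps PiE_def intro!: restrict_ext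
      extensionalityI[of _ r])

lemma carrier_L: "x \<in> carrier L \<longleftrightarrow> x \<in> extensional r \<and> (\<Sum>i\<in>Field r. x (i, i)) = 0"
  by (auto simp: lie_poset_algebra_def Let_def poset_algebra_def class_ring.func_space_def poset_trace_def
      PiE_def)

text \<open>Every operation of \<open>L\<close> becomes a pointwise operation on total functions
  followed by one restriction to \<open>r\<close>, so identities in \<open>L\<close> can be checked
  on entries in \<open>r\<close>.\<close>

lemma L_ops:
  "\<zero>\<^bsub>L\<^esub> = rest 0" "x \<oplus>\<^bsub>L\<^esub> y = rest (x + y)" "c \<odot>\<^bsub>L\<^esub> x = rest (scale c x)"
  by (auto simp: lie_poset_algebra_def Let_def poset_algebra_def class_ring.func_space_def scale_def
      intro!: restrict_ext)

lemma L_eqI: "x \<in> carrier L \<Longrightarrow> y \<in> carrier L \<Longrightarrow> (\<And>p. p \<in> r \<Longrightarrow> x p = y p) \<Longrightarrow> x = y"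
  by (auto simp: carrier_L intro: extensionalityI)

lemma rest_in_L: "rest x \<in> carrier L \<longleftrightarrow> (\<Sum>i\<in>Field r. x (i, i)) = 0"
proof -
  have "(\<Sum>i\<in>Field r. rest x (i, i)) = (\<Sum>i\<in>Field r. x (i, i))"
    by (intro sum.cong) (auto simp: r_diag)
  then show ?thesis
    by (simp add: carrier_L)
qed

lemma bracket_L:
  assumes "x \<in> carrier L" "y \<in> carrier L"
  shows "bracket L x y = rest (br x y)"
proof -
  let ?A = "poset_algebra r :: ('k, nat \<times> nat \<Rightarrow> 'k) module"
  interpret A: Module.module class_ring ?A by (rule module_poset_algebra)
  have m: "u \<otimes>\<^bsub>?A\<^esub> v = rest (mm u v)" for u v
    by (auto simp: poset_algebra_def mm_sum intro!: restrict_ext)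
  have c: "rest u \<in> carrier ?A" for u
    by (auto simp: poset_algebra_def class_ring.func_space_def)
  have "\<ominus>\<^bsub>?A\<^esub> rest u = (- 1) \<odot>\<^bsub>?A\<^esub> rest u" for u
    using A.smult_minus_1[OF c, of u] by (simp add: class_ring_simps)
  then have "rest u \<ominus>\<^bsub>?A\<^esub> rest v = rest (u - v)" for u v
    by (auto simp: A.minus_eq) (auto simp: poset_algebra_def class_ring.func_space_def intro!: restrict_ext)
  moreover have "bracket L x y = x \<otimes>\<^bsub>?A\<^esub> y \<ominus>\<^bsub>?A\<^esub> y \<otimes>\<^bsub>?A\<^esub> x"
    by (simp add: lie_poset_algebra_def Let_def)
  ultimately show ?thesis
    by (simp add: m commutator_def)
qed

lemma sum_diag_linear:
  "(\<Sum>i\<in>Field r. (x + y) (i, i)) = (\<Sum>i\<in>Field r. x (i, i)) + (\<Sum>i\<in>Field r. y (i, i))"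
  "(\<Sum>i\<in>Field r. (x - y) (i, i)) = (\<Sum>i\<in>Field r. x (i, i)) - (\<Sum>i\<in>Field r. y (i, i))"
  "(\<Sum>i\<in>Field r. scale c x (i, i)) = c * (\<Sum>i\<in>Field r. x (i, i))"
  for x y :: "nat \<times> nat \<Rightarrow> 'k"
  by (simp_all add: sum.distrib sum_subtractf scale_def sum_distrib_left)

lemma bracket_closed [simp]:
  assumes "x \<in> carrier L" "y \<in> carrier L"
  shows "bracket L x y \<in> carrier L" "rest (br x y) \<in> carrier L"
  using assms by (simp_all add: bracket_L rest_in_L br_diag r_diag)

lemma L_trace: "x \<in> carrier L \<Longrightarrow> (\<Sum>i\<in>Field r. x (i, i)) = 0"
  and rest_L [simp]: "x \<in> carrier L \<Longrightarrow> rest x = x"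
  by (auto simp: carrier_L extensional_restrict)

lemma L_closed:
  "rest 0 \<in> carrier L"
  "x \<in> carrier L \<Longrightarrow> y \<in> carrier L \<Longrightarrow> rest (x + y) \<in> carrier L"
  "x \<in> carrier L \<Longrightarrow> y \<in> carrier L \<Longrightarrow> rest (x - y) \<in> carrier L"
  "x \<in> carrier L \<Longrightarrow> rest (scale c x) \<in> carrier L"
  by (simp_all add: rest_in_L L_trace sum_diag_linear del: plus_fun_apply minus_apply)

lemma module_L: "module class_ring L"
  by (rule module_class_ringI)
    (auto simp: L_ops L_closed scale_def algebra_simps dest: rest_L
      intro!: restrict_ext L_eqI)

end


subsection \<open>The adjoint complex in degrees one to three\<close>

context poset_lie
begin

lemma rest_eq_iff: "rest x = rest y \<longleftrightarrow> (\<forall>p\<in>r. x p = y p)"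
  by (auto simp: fun_eq_iff restrict_def)

lemma rest_rest_linear [simp]:
  "rest (rest x + y) = rest (x + y)" "rest (x + rest y) = rest (x + y)"
  "rest (rest x - y) = rest (x - y)" "rest (x - rest y) = rest (x - y)"
  "rest (scale c (rest x)) = rest (scale c x)" "rest (- rest x) = rest (- x)"
  by (auto simp: scale_def intro!: restrict_ext)

abbreviation C where "C \<equiv> ce_cochains L L"
abbreviation d where "d \<equiv> ce_differential L L (bracket L)"

lemma C1_D:
  assumes "G \<in> carrier (C (Suc 0))"
  shows "x \<in> carrier L \<Longrightarrow> G [x] \<in> carrier L"
    and "x \<in> carrier L \<Longrightarrow> y \<in> carrier L \<Longrightarrow> G [rest (x + y)] = rest (G [x] + G [y])"
    and "x \<in> carrier L \<Longrightarrow> G [rest (scale c x)] = rest (scale c (G [x]))"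
proof -
  have "(\<lambda>x. G [x]) \<in> linear_maps L L"
    using assms by (simp add: ce_cochains_1_iff)
  from linear_mapsD[OF this]
  show "x \<in> carrier L \<Longrightarrow> G [x] \<in> carrier L"
    and "x \<in> carrier L \<Longrightarrow> y \<in> carrier L \<Longrightarrow> G [rest (x + y)] = rest (G [x] + G [y])"
    and "x \<in> carrier L \<Longrightarrow> G [rest (scale c x)] = rest (scale c (G [x]))"
    by (simp_all add: L_ops)
qed

lemma C2_D:
  assumes "F \<in> carrier (C 2)" and x: "x \<in> carrier L" and y: "y \<in> carrier L"
  shows "F [x, y] \<in> carrier L"
    and "x' \<in> carrier L \<Longrightarrow> F [rest (x + x'), y] = rest (F [x, y] + F [x', y])"
    and "y' \<in> carrier L \<Longrightarrow> F [x, rest (y + y')] = rest (F [x, y] + F [x, y'])"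
    and "F [rest (scale c x), y] = rest (scale c (F [x, y]))"
    and "F [x, rest (scale c y)] = rest (scale c (F [x, y]))"
    and "F [x, x] = rest 0"
    and "F [y, x] = rest (- F [x, y])"
proof -
  have b: "bilinear L L L (\<lambda>x y. F [x, y])" and alt: "F [x, x] = rest 0" if "x \<in> carrier L" for x
    using assms(1) that by (auto simp: ce_cochains_2_iff L_ops)
  note b = bilinearD[OF b, OF x]
  show "F [x, y] \<in> carrier L"
    by (rule b x y)+
  show "x' \<in> carrier L \<Longrightarrow> F [rest (x + x'), y] = rest (F [x, y] + F [x', y])"
    using b(2)[OF x y] by (simp add: L_ops)
  show "y' \<in> carrier L \<Longrightarrow> F [x, rest (y + y')] = rest (F [x, y] + F [x, y'])"
    using b(3)[OF x y] by (simp add: L_ops)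
  show "F [rest (scale c x), y] = rest (scale c (F [x, y]))"
    using b(4)[OF x y] by (simp add: L_ops)
  show "F [x, rest (scale c y)] = rest (scale c (F [x, y]))"
    using b(5)[OF x y] by (simp add: L_ops)
  show "F [x, x] = rest 0"
    using alt x by simp
  \<comment> \<open>Antisymmetry comes from expanding \<open>F\<close> at the pair (x + y, x + y),
    where it vanishes.\<close>
  have xy: "rest (x + y) \<in> carrier L"
    using x y by (rule L_closed)
  have "F [rest (x + y), rest (x + y)] = rest (F [x, rest (x + y)] + F [y, rest (x + y)])"
    using b(2)[OF x xy y] by (simp add: L_ops)
  also have "\<dots> = rest ((F [x, x] + F [x, y]) + (F [y, x] + F [y, y]))"
    using b(3)[OF x x y] b(3)[OF y x y] by (simp add: L_ops)
  also have "\<dots> = rest (F [x, y] + F [y, x])"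
    using alt x y by (simp add: rest_eq_iff)
  finally have "rest (F [x, y] + F [y, x]) = rest 0"
    using alt[OF xy] by simp
  then have "rest (F [y, x]) = rest (- F [x, y])"
    unfolding rest_eq_iff by (auto simp: fun_Compl_def eq_neg_iff_add_eq_0 add.commute)
  then show "F [y, x] = rest (- F [x, y])"
    using b(1)[OF y x] by simp
qed

text \<open>Antisymmetry transfers linearity from the first argument to the second. Vanishing at
  equal arguments is asked for separately, which avoids dividing by 2.\<close>

lemma C2_I:
  assumes "\<And>x y. x \<in> carrier L \<Longrightarrow> y \<in> carrier L \<Longrightarrow> F [x, y] \<in> carrier L"
    and "\<And>x x' y. x \<in> carrier L \<Longrightarrow> x' \<in> carrier L \<Longrightarrow> y \<in> carrier L \<Longrightarrow>
      F [rest (x + x'), y] = rest (F [x, y] + F [x', y])"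
    and "\<And>c x y. x \<in> carrier L \<Longrightarrow> y \<in> carrier L \<Longrightarrow> F [rest (scale c x), y] = rest (scale c (F [x, y]))"
    and "\<And>x y. x \<in> carrier L \<Longrightarrow> y \<in> carrier L \<Longrightarrow> F [y, x] = rest (- F [x, y])"
    and "\<And>x. x \<in> carrier L \<Longrightarrow> F [x, x] = rest 0"
    and "F \<in> extensional (tuples L 2)"
  shows "F \<in> carrier (C 2)"
  unfolding ce_cochains_2_iff
proof (intro conjI ballI)
  show "bilinear L L L (\<lambda>x y. F [x, y])"
  proof (rule bilinearI)
    fix x y assume xy: "x \<in> carrier L" "y \<in> carrier L"
    show "F [x, y \<oplus>\<^bsub>L\<^esub> y'] = F [x, y] \<oplus>\<^bsub>L\<^esub> F [x, y']" if "y' \<in> carrier L" for y'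
      using xy that assms(4)[of "rest (y + y')" x] assms(4)[of y x] assms(4)[of y' x]
      by (simp add: L_ops L_closed assms(2) rest_eq_iff)
    show "F [x, c \<odot>\<^bsub>L\<^esub> y] = c \<odot>\<^bsub>L\<^esub> F [x, y]" for c
      using xy assms(4)[of "rest (scale c y)" x] assms(4)[of y x]
      by (simp add: L_ops L_closed assms(3) rest_eq_iff scale_def)
  qed (simp_all add: L_ops assms(1-3))
qed (simp_all add: L_ops assms(5,6))

lemma d1_eq:
  assumes "G \<in> carrier (C (Suc 0))" "x \<in> carrier L" "y \<in> carrier L"
  shows "d (Suc 0) G [x, y] = rest (br x (G [y]) - br y (G [x]) - G [rest (br x y)])"
proof -
  have "d (Suc 0) G [x, y] = rest (br x (G [y]) + (scale (- 1) (br y (G [x])) + scale (- 1) (G [rest (br x y)])))"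
    using C1_D(1)[OF assms(1)] assms(2,3)
    by (subst ce_differential_1[OF module_L]) (simp_all add: bracket_L L_ops add.assoc)
  then show ?thesis
    by (simp add: scale_linear algebra_simps)
qed

text \<open>The Chevalley-Eilenberg differential of a 2-cochain as a function on all pairs of
  indices, before restriction to \<open>r\<close>; only the brackets fed back into \<open>f\<close>
  are restricted, to stay in \<open>L\<close>.\<close>

definition cyc where
  "cyc f x y w = br x (f y w) - br y (f x w) + br w (f x y)
    - f (rest (br x y)) w + f (rest (br x w)) y - f (rest (br y w)) x"

lemma d2_eq:
  assumes "F \<in> carrier (C 2)" "x \<in> carrier L" "y \<in> carrier L" "w \<in> carrier L"
  shows "d 2 F [x, y, w] = rest (cyc (\<lambda>x y. F [x, y]) x y w)"
proof -
  have "d 2 F [x, y, w] = rest ((br w (F [x, y]) + (scale (- 1) (br y (F [x, w])) + br x (F [y, w])))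
      + (scale (- 1) (F [rest (br y w), x]) + (F [rest (br x w), y] + scale (- 1) (F [rest (br x y), w]))))"
    using C2_D(1)[OF assms(1)] assms(2-)
    by (subst ce_differential_2[OF module_L]) (simp_all add: bracket_L L_ops add.assoc)
  also have "\<dots> = rest (cyc (\<lambda>x y. F [x, y]) x y w)"
    by (rule arg_cong[of _ _ rest]) (simp add: cyc_def scale_linear algebra_simps)
  finally show ?thesis .
qed

lemma d1_in_C2:
  assumes "G \<in> carrier (C (Suc 0))"
  shows "d (Suc 0) G \<in> carrier (C 2)"
proof (rule C2_I)
  note G = C1_D[OF assms]
  note d = d1_eq[OF assms]
  show "d (Suc 0) G [x, y] \<in> carrier L" if "x \<in> carrier L" "y \<in> carrier L" for x y
  proof -
    have "d (Suc 0) G [x, y] = rest (rest (rest (br x (G [y])) - rest (br y (G [x]))) - G [rest (br x y)])"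
      using that by (simp add: d)
    also have "\<dots> \<in> carrier L"
      using that G by (intro L_closed(3) bracket_closed) auto
    finally show ?thesis .
  qed
  show "d (Suc 0) G [rest (x + x'), y] = rest (d (Suc 0) G [x, y] + d (Suc 0) G [x', y])"
    if "x \<in> carrier L" "x' \<in> carrier L" "y \<in> carrier L" for x x' y
  proof -
    have "rest (br (x + x') y) = rest (rest (br x y) + rest (br x' y))"
      by (simp add: commutator_linear)
    then have "G [rest (br (x + x') y)] = rest (G [rest (br x y)] + G [rest (br x' y)])"
      using that G(2)[of "rest (br x y)" "rest (br x' y)"] by simp
    then show ?thesis
      using that by (simp add: d L_closed G commutator_linear rest_eq_iff)
  qed
  show "d (Suc 0) G [rest (scale c x), y] = rest (scale c (d (Suc 0) G [x, y]))"
    if "x \<in> carrier L" "y \<in> carrier L" for c x y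
  proof -
    have "rest (br (scale c x) y) = rest (scale c (rest (br x y)))"
      by (simp add: commutator_linear)
    then have "G [rest (br (scale c x) y)] = rest (scale c (G [rest (br x y)]))"
      using that G(3)[of "rest (br x y)" c] by simp
    then show ?thesis
      using that by (simp add: d L_closed G commutator_linear scale_linear)
  qed
  show "d (Suc 0) G [y, x] = rest (- d (Suc 0) G [x, y])"
    if "x \<in> carrier L" "y \<in> carrier L" for x y
  proof -
    have "rest (br y x) = rest (scale (- 1) (rest (br x y)))"
      by (simp add: scale_linear commutator_swap[of _ y x])
    then have "G [rest (br y x)] = rest (- G [rest (br x y)])"
      using that G(3)[of "rest (br x y)" "-1"] by (simp add: scale_linear)
    then show ?thesis
      using that by (simp add: d rest_eq_iff)
  qed
  show "d (Suc 0) G [x, x] = rest 0" if "x \<in> carrier L" for x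
  proof -
    have "rest (br x x) = rest (scale 0 x)"
      by (simp add: commutator_linear scale_linear)
    then have "G [rest (br x x)] = rest 0"
      using that G(3)[of x 0] by (simp add: scale_linear)
    then show ?thesis
      using that by (simp add: d)
  qed
qed (simp add: ce_differential_def numeral_2_eq_2)

text \<open>The terms in which two elements act on a value of \<open>G\<close> cancel by the Jacobi
  identity applied to that value; the terms with \<open>G\<close> of a double bracket cancel by the
  Jacobi identity inside \<open>G\<close>. This makes coboundaries cocycles.\<close>

lemma d2_d1:
  assumes G: "G \<in> carrier (C (Suc 0))" and xyw: "x \<in> carrier L" "y \<in> carrier L" "w \<in> carrier L"
  shows "rest (cyc (\<lambda>x y. d (Suc 0) G [x, y]) x y w) = rest 0"
proof -
  note C = C1_D[OF G]
  \<comment> \<open>\<open>g\<close> extends \<open>G\<close> to unrestricted matrices, so that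
    nested restrictions disappear from its arguments.\<close>
  define g where "g x = G [rest x]" for x
  have g: "G [rest x] = g x" for x
    by (simp add: g_def)
  have gr: "g (rest x) = g x" for x
    by (simp add: g_def)
  have dG: "d (Suc 0) G [x, y] = rest (br x (g y) - br y (g x) - g (br x y))"
    if "x \<in> carrier L" "y \<in> carrier L" for x y
    using that d1_eq[OF G that] by (simp add: g_def)
  \<comment> \<open>Jacobi arranged with plus signs only, the form to which additivity of
    \<open>G\<close> applies directly.\<close>
  have "br (br x w) y = br (br x y) w + br (br y w) x"
    using jacobi[of x y w] by (simp add: commutator_swap[of _ x "br y w"] commutator_swap[of _ y "br x w"] algebra_simps)
  then have "rest (br (br x w) y) = rest (rest (br (rest (br x y)) w) + rest (br (rest (br y w)) x))"
    by simp
  then have "g (br (br x w) y) = rest (g (br (br x y) w) + g (br (br y w) x))"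
    unfolding g_def using C(2)[of "rest (br (rest (br x y)) w)" "rest (br (rest (br y w)) x)"] xyw
    by (simp add: bracket_closed del: commutator_restrict)
      (simp add: bracket_closed)
  then have gj: "rest (g (br (br x w) y)) = rest (g (br (br x y) w) + g (br (br y w) x))"
    by simp
  have "rest (cyc (\<lambda>x y. d (Suc 0) G [x, y]) x y w) =
      rest (- g (br (br x w) y) + (g (br (br x y) w) + g (br (br y w) x)))"
    using xyw jacobi[of x y "g w"] jacobi[of x w "g y"] jacobi[of y w "g x"]
    by (simp add: rest_eq_iff cyc_def dG gr commutator_linear)
  also have "\<dots> = rest 0"
    using gj by (simp add: rest_eq_iff)
  finally show ?thesis .
qed

end


subsection \<open>Diagonal elements, matrix units and weights\<close>

context poset_lie
begin

abbreviation D :: "(nat \<times> nat \<Rightarrow> 'k) set"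
  where "D \<equiv> carrier (diagonal_subalgebra r)"

definition dg :: "(nat \<times> nat \<Rightarrow> 'k) \<Rightarrow> nat \<times> nat \<Rightarrow> 'k"
  where "dg x = rest (\<lambda>(i, j). if i = j then x (i, i) else 0)"

definition E :: "nat \<times> nat \<Rightarrow> nat \<times> nat \<Rightarrow> 'k"
  where "E p = rest (\<lambda>q. if q = p then 1 else 0)"

text \<open>The traceless diagonal matrix with 1 at s and -1 at t. Fixing t = \<open>N\<close> and
  letting s range below \<open>N\<close> gives the basis \<open>H\<close> of the diagonal.\<close>

definition HH :: "nat \<Rightarrow> nat \<Rightarrow> nat \<times> nat \<Rightarrow> 'k"
  where "HH s t = rest (\<lambda>(i, j). if i = j then (if i = s then 1 else 0) - (if i = t then 1 else 0) else 0)"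

abbreviation H :: "nat \<Rightarrow> nat \<times> nat \<Rightarrow> 'k"
  where "H b \<equiv> HH b N"

definition off :: "(nat \<times> nat) set"
  where "off = {(i, j). (i, j) \<in> r \<and> i \<noteq> j}"

text \<open>The root by which the diagonal acts on the matrix unit at \<open>p\<close>; it is zero
  when \<open>p\<close> is a diagonal position.\<close>

definition wt :: "nat \<times> nat \<Rightarrow> (nat \<times> nat \<Rightarrow> 'k) \<Rightarrow> 'k"
  where "wt p h = h (fst p, fst p) - h (snd p, snd p)"

lemma off_iff: "(i, j) \<in> off \<longleftrightarrow> (i, j) \<in> r \<and> i \<noteq> j"
  by (simp add: off_def)

lemma finite_off: "finite off"
  by (rule finite_subset[OF _ finite_r]) (auto simp: off_def)

lemma D_iff: "x \<in> D \<longleftrightarrow> x \<in> carrier L \<and> (\<forall>i j. (i, j) \<in> off \<longrightarrow> x (i, j) = 0)"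
  by (auto simp: diagonal_subalgebra_def off_iff)

lemma D_L: "x \<in> D \<Longrightarrow> x \<in> carrier L"
  by (simp add: D_iff)

lemma dg_D [simp]: "x \<in> carrier L \<Longrightarrow> dg x \<in> D"
  by (auto simp: D_iff dg_def rest_in_L L_trace off_iff)

lemma dg_id: "x \<in> D \<Longrightarrow> dg x = x"
  by (rule L_eqI) (auto simp: D_L, auto simp: dg_def D_iff off_iff)

lemma E_L [simp]: "p \<in> off \<Longrightarrow> E p \<in> carrier L"
  by (cases p) (auto simp: E_def rest_in_L off_iff intro!: sum.neutral)

lemma HH_D [simp]: "s \<in> Field r \<Longrightarrow> t \<in> Field r \<Longrightarrow> HH s t \<in> D"
proof -
  assume "s \<in> Field r" "t \<in> Field r"
  then have "(\<Sum>i\<in>Field r. (if i = s then 1 else 0) - (if i = t then 1 else (0::'k))) = 0"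
    by (simp add: sum_subtractf Field_r)
  then show ?thesis
    by (auto simp: D_iff HH_def rest_in_L off_iff)
qed

lemma D_closed:
  "rest 0 \<in> D"
  "x \<in> D \<Longrightarrow> y \<in> D \<Longrightarrow> rest (x + y) \<in> D"
  "x \<in> D \<Longrightarrow> rest (scale c x) \<in> D"
  by (auto simp: D_iff L_closed off_iff scale_def)

lemma L_sum_mem:
  assumes U: "rest 0 \<in> U" "\<And>x y. x \<in> U \<Longrightarrow> y \<in> U \<Longrightarrow> rest (x + y) \<in> U"
    "\<And>c x. x \<in> U \<Longrightarrow> rest (scale c x) \<in> U"
    and "finite A" "\<And>a. a \<in> A \<Longrightarrow> e a \<in> U"
  shows "rest (\<Sum>a\<in>A. scale (f a) (e a)) \<in> U"
  using assms(4,5)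
proof (induction A)
  case (insert a A)
  then have "rest (\<Sum>a\<in>A. scale (f a) (e a)) \<in> U" "rest (scale (f a) (e a)) \<in> U"
    using U(3) by blast+
  then have "rest (rest (scale (f a) (e a)) + rest (\<Sum>a\<in>A. scale (f a) (e a))) \<in> U"
    by (intro U(2))
  then show ?case
    unfolding sum.insert[OF insert.hyps] rest_rest_linear .
qed (use U in simp)

text \<open>A traceless diagonal x is the combination of the \<open>H b\<close> with coefficients
  \<open>x (b, b)\<close> for b below \<open>N\<close>.\<close>

lemma D_induct:
  assumes U: "rest 0 \<in> U" "\<And>x y. x \<in> U \<Longrightarrow> y \<in> U \<Longrightarrow> rest (x + y) \<in> U"
    "\<And>c x. x \<in> U \<Longrightarrow> rest (scale c x) \<in> U"
    and H: "\<And>b. b \<in> {1..<N} \<Longrightarrow> H b \<in> U" and x: "x \<in> D"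
  shows "x \<in> U"
proof -
  let ?y = "rest (\<Sum>b\<in>{1..<N}. scale (x (b, b)) (H b))"
  have "?y \<in> U"
    by (rule L_sum_mem) (use U H in auto)
  moreover have "?y = x"
  proof (rule L_eqI)
    show "x \<in> carrier L"
      using x by (rule D_L)
    have "?y \<in> D"
      by (rule L_sum_mem) (auto simp: D_closed Field_r)
    then show "?y \<in> carrier L"
      by (rule D_L)
    fix p assume p: "p \<in> r"
    obtain i j where ij: "p = (i, j)"
      by (cases p)
    show "?y p = x p"
    proof (cases "i = j")
      case False
      then show ?thesis
        using p x ij by (auto simp: scale_def HH_def D_iff off_iff)
    next
      case True
      have i: "1 \<le> i" "i \<le> N"
        using p ij r_subset by auto
      \<comment> \<open>Each \<open>H b\<close> has -1 at position \<open>N\<close>; the trace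
        condition is what makes the last entry come out right.\<close>
      have tr: "(\<Sum>b\<in>{1..<N}. x (b, b)) + x (N, N) = 0"
      proof -
        have "{1..N} = insert N {1..<N}"
          using i by auto
        then show ?thesis
          using L_trace[OF D_L[OF x]] by (simp add: Field_r add.commute)
      qed
      have "?y p = (\<Sum>b\<in>{1..<N}. x (b, b) * ((if i = b then 1 else 0) - (if i = N then 1 else 0)))"
        using p ij True by (simp add: scale_def HH_def)
      also have "\<dots> = (if i = N then - (\<Sum>b\<in>{1..<N}. x (b, b)) else x (i, i))"
        using i by (auto simp: sum_negf if_distrib[of "(*) _"] cong: if_cong)
      also have "\<dots> = x p"
        using tr ij True by (auto simp: eq_neg_iff_add_eq_0 add.commute minus_unique)
      finally show ?thesis .
    qed
  qed
  ultimately show ?thesis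
    by simp
qed

lemma L_decomp: "x \<in> carrier L \<Longrightarrow> x = rest (dg x + (\<Sum>p\<in>off. scale (x p) (E p)))"
proof -
  assume x: "x \<in> carrier L"
  have "rest x = rest (dg x + (\<Sum>p\<in>off. scale (x p) (E p)))"
    unfolding rest_eq_iff
  proof
    fix p assume p: "p \<in> r"
    have "(\<Sum>q\<in>off. scale (x q) (E q)) p = (\<Sum>q\<in>off. if p = q then x q else 0)"
      using p by (auto simp: scale_def E_def intro!: sum.cong)
    then show "x p = (dg x + (\<Sum>q\<in>off. scale (x q) (E q))) p"
      using p finite_off by (cases p) (auto simp: dg_def off_iff)
  qed
  then show ?thesis
    using x by simp
qed

lemma L_induct:
  assumes U: "rest 0 \<in> U" "\<And>x y. x \<in> U \<Longrightarrow> y \<in> U \<Longrightarrow> rest (x + y) \<in> U"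
    "\<And>c x. x \<in> U \<Longrightarrow> rest (scale c x) \<in> U"
    and D: "D \<subseteq> U" and E: "\<And>p. p \<in> off \<Longrightarrow> E p \<in> U" and x: "x \<in> carrier L"
  shows "x \<in> U"
proof -
  have "rest (dg x + rest (\<Sum>p\<in>off. scale (x p) (E p))) \<in> U"
    using D x by (intro U L_sum_mem finite_off E) auto
  then show ?thesis
    using L_decomp[OF x] by simp
qed

lemma E_eval: "p \<in> r \<Longrightarrow> E q p = (if p = q then 1 else 0)"
  by (simp add: E_def)

lemma mm_E_left: "(i, j) \<in> r \<Longrightarrow> (a, c) \<in> r \<Longrightarrow> mm (E (i, j)) y (a, c) = (if a = i \<and> (j, c) \<in> r then y (j, c) else 0)"
proof -
  assume *: "(i, j) \<in> r" "(a, c) \<in> r"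
  have "mm (E (i, j)) y (a, c) = (\<Sum>l\<in>Field r. if l = j then (if a = i then cut r y (j, c) else 0) else 0)"
    unfolding mat_mult_def using * by (intro sum.cong) (auto simp: E_def cut_def)
  also have "\<dots> = (if a = i \<and> (j, c) \<in> r then y (j, c) else 0)"
    using * r_subset[of i j] by (auto simp: Field_r cut_def)
  finally show ?thesis .
qed

lemma mm_E_right: "(i, j) \<in> r \<Longrightarrow> (a, c) \<in> r \<Longrightarrow> mm y (E (i, j)) (a, c) = (if c = j \<and> (a, i) \<in> r then y (a, i) else 0)"
proof -
  assume *: "(i, j) \<in> r" "(a, c) \<in> r"
  have "mm y (E (i, j)) (a, c) = (\<Sum>l\<in>Field r. if l = i then (if c = j then cut r y (a, i) else 0) else 0)"
    unfolding mat_mult_def using * by (intro sum.cong) (auto simp: E_def cut_def)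
  also have "\<dots> = (if c = j \<and> (a, i) \<in> r then y (a, i) else 0)"
    using * r_subset[of i j] by (auto simp: Field_r cut_def)
  finally show ?thesis .
qed

lemma br_E:
  assumes "(i, j) \<in> r" "(a, c) \<in> r"
  shows "br (E (i, j)) y (a, c) =
    (if a = i \<and> (j, c) \<in> r then y (j, c) else 0) - (if c = j \<and> (a, i) \<in> r then y (a, i) else 0)"
  using assms by (simp add: commutator_def mm_E_left mm_E_right)

lemma br_D:
  assumes h: "h \<in> D" and p: "p \<in> r"
  shows "br h y p = wt p h * y p"
proof -
  obtain a c where ac: "p = (a, c)" by (cases p)
  have h0: "cut r h (i, j) = (if i = j then h (i, i) else 0)" if "i \<in> Field r" "j \<in> Field r" for i j
    using h that by (auto simp: cut_def D_iff off_iff r_diag)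
  have f: "a \<in> Field r" "c \<in> Field r"
    using p ac by (auto simp: Field_def)
  have "mm h y p = (\<Sum>j\<in>Field r. if a = j then h (a, a) * y (a, c) else 0)"
    unfolding mat_mult_def using p ac f by (intro sum.cong) (auto simp: h0, auto simp: cut_def)
  moreover have "mm y h p = (\<Sum>j\<in>Field r. if j = c then y (a, c) * h (c, c) else 0)"
    unfolding mat_mult_def using p ac f by (intro sum.cong) (auto simp: h0, auto simp: cut_def)
  ultimately show ?thesis
    using f ac by (simp add: commutator_def wt_def Field_r algebra_simps)
qed

lemma bracket_generators:
  "h \<in> D \<Longrightarrow> p \<in> off \<Longrightarrow> rest (br h (E p)) = rest (scale (wt p h) (E p))"
  "h \<in> D \<Longrightarrow> h' \<in> D \<Longrightarrow> rest (br h h') = rest 0"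
  "(i, j) \<in> off \<Longrightarrow> (j, k) \<in> off \<Longrightarrow> rest (br (E (i, j)) (E (j, k))) = E (i, k)"
  "(i, j) \<in> off \<Longrightarrow> (k, l) \<in> off \<Longrightarrow> j \<noteq> k \<Longrightarrow> l \<noteq> i \<Longrightarrow> rest (br (E (i, j)) (E (k, l))) = rest 0"
proof -
  show "h \<in> D \<Longrightarrow> p \<in> off \<Longrightarrow> rest (br h (E p)) = rest (scale (wt p h) (E p))"
    unfolding rest_eq_iff by (auto simp: br_D scale_def E_def)
  show "h \<in> D \<Longrightarrow> h' \<in> D \<Longrightarrow> rest (br h h') = rest 0"
    unfolding rest_eq_iff by (auto simp: br_D wt_def D_iff off_iff) metis
  show "(i, j) \<in> off \<Longrightarrow> (j, k) \<in> off \<Longrightarrow> rest (br (E (i, j)) (E (j, k))) = E (i, k)"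
    unfolding E_def[of "(i, k)"] rest_eq_iff
    by (auto simp: off_iff br_E E_eval dest: r_antisym split: if_splits)
  show "(i, j) \<in> off \<Longrightarrow> (k, l) \<in> off \<Longrightarrow> j \<noteq> k \<Longrightarrow> l \<noteq> i \<Longrightarrow> rest (br (E (i, j)) (E (k, l))) = rest 0"
    unfolding rest_eq_iff by (auto simp: off_iff br_E E_eval)
qed

text \<open>
  The weights \<open>h i - h j\<close> only matter as functions on traceless diagonals; the bound on the
  characteristic makes small integral combinations of them vanish only for formal reasons.
\<close>

lemma of_int_eq_0_imp: "of_int c = (0::'k) \<Longrightarrow> \<bar>c\<bar> \<le> int N \<Longrightarrow> c = 0"
proof (rule ccontr)
  assume *: "of_int c = (0::'k)" "\<bar>c\<bar> \<le> int N" "c \<noteq> 0"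
  then have dvd: "int CHAR('k) dvd c"
    by (simp add: of_int_eq_0_iff_char_dvd)
  with *(3) have "CHAR('k) \<noteq> 0"
    by auto
  moreover have "int CHAR('k) \<le> \<bar>c\<bar>"
    using dvd *(3) zdvd_imp_le[of "int CHAR('k)" "\<bar>c\<bar>"] by auto
  ultimately show False
    using char_k *(2) by auto
qed

text \<open>Testing against the differences \<open>HH s t\<close> shows that c is constant as a
  function into \<open>'k\<close>. Its sum is zero and \<open>N\<close> is invertible, so the
  constant is zero in \<open>'k\<close>; the bound on \<open>c s\<close> lifts this to the
  integers.\<close>

lemma weight_zero:
  fixes c :: "nat \<Rightarrow> int"
  assumes zero: "\<And>h. h \<in> D \<Longrightarrow> (\<Sum>t\<in>Field r. of_int (c t) * h (t, t)) = (0::'k)"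
    and sum0: "(\<Sum>t\<in>Field r. c t) = 0" and s: "s \<in> Field r" and "\<bar>c s\<bar> \<le> int N"
  shows "c s = 0"
proof -
  have eq: "of_int (c s) = (of_int (c t) :: 'k)" if t: "t \<in> Field r" for t
  proof -
    have "of_int (c u) * HH s t (u, u) = (if u = s then of_int (c u) else 0) - (if u = t then of_int (c u) else (0::'k))"
      if "u \<in> Field r" for u
      using that by (simp add: HH_def r_diag)
    then have "(\<Sum>u\<in>Field r. of_int (c u) * HH s t (u, u)) = (of_int (c s) - of_int (c t) :: 'k)"
      using s t by (simp add: sum_subtractf Field_r)
    then show ?thesis
      using zero[OF HH_D[OF s t]] by simp
  qed
  have "of_nat N * of_int (c s) = (\<Sum>t\<in>Field r. of_int (c s) :: 'k)"
    by (simp add: Field_r)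
  also have "\<dots> = (\<Sum>t\<in>Field r. of_int (c t))"
    using eq by (intro sum.cong) auto
  also have "\<dots> = 0"
    using sum0 by (simp flip: of_int_sum)
  finally have "of_nat N = (0::'k) \<or> of_int (c s) = (0::'k)"
    by simp
  moreover have "of_nat N \<noteq> (0::'k)"
    using of_int_eq_0_imp[of "int N"] s by (auto simp: Field_r)
  ultimately show ?thesis
    using of_int_eq_0_imp[of "c s"] assms by auto
qed

text \<open>Integer valued, because a comparison of weights has to end in equations over the
  integers, where sums of indicators can be solved by inequalities.\<close>

definition ind :: "nat \<Rightarrow> nat \<Rightarrow> int"
  where "ind i t = (if t = i then 1 else 0)"

lemma ind_sum: "i \<in> Field r \<Longrightarrow> (\<Sum>t\<in>Field r. of_int (ind i t) * h (t, t)) = (h (i, i) :: 'k)"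
  "i \<in> Field r \<Longrightarrow> (\<Sum>t\<in>Field r. ind i t) = 1"
proof -
  assume i: "i \<in> Field r"
  have "(\<Sum>t\<in>Field r. of_int (ind i t) * h (t, t)) = (\<Sum>t\<in>Field r. if t = i then h (t, t) else 0)"
    by (intro sum.cong) (auto simp: ind_def)
  then show "(\<Sum>t\<in>Field r. of_int (ind i t) * h (t, t)) = (h (i, i) :: 'k)"
    using i by (simp add: Field_r)
  show "(\<Sum>t\<in>Field r. ind i t) = 1"
    using i by (simp add: ind_def Field_r)
qed

lemma in_Field: "(i, j) \<in> r \<Longrightarrow> i \<in> Field r" "(i, j) \<in> r \<Longrightarrow> j \<in> Field r"
  by (auto simp: Field_def)

text \<open>A difference of two indicators takes values of size at most 1, so
  \<open>weight_zero\<close> applies as soon as the poset is nonempty.\<close>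

lemma weight_1:
  assumes "(i, j) \<in> off"
  obtains h where "h \<in> D" "wt (i, j) h \<noteq> 0"
proof -
  have "\<exists>h\<in>D. wt (i, j) h \<noteq> 0"
  proof (rule ccontr)
  assume "\<not> (\<exists>h\<in>D. wt (i, j) h \<noteq> 0)"
  then have 0: "wt (i, j) h = 0" if "h \<in> D" for h
    using that by auto
  have ij: "i \<in> Field r" "j \<in> Field r" "i \<noteq> j"
    using assms in_Field by (auto simp: off_iff)
  have "ind i i - ind j i = 0"
  proof (rule weight_zero[where c = "\<lambda>t. ind i t - ind j t"])
    show "(\<Sum>t\<in>Field r. of_int (ind i t - ind j t) * h (t, t)) = (0::'k)" if "h \<in> D" for h
      using ij 0[OF that] by (simp add: left_diff_distrib sum_subtractf ind_sum wt_def)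
    show "(\<Sum>t\<in>Field r. ind i t - ind j t) = 0"
      using ij by (simp add: sum_subtractf ind_sum)
  qed (use ij in \<open>auto simp: ind_def Field_r\<close>)
  then show False
    using ij by (simp add: ind_def)
  qed
  then show ?thesis
    using that by blast
qed

text \<open>Four indicators give integers of size at most 2, and the two distinct elements i and j
  give \<open>2 \<le> N\<close>. Hence the entry of weight zero in the image of a matrix unit under
  an operator is the one at its own position.\<close>

lemma weight_2:
  assumes "(i, j) \<in> off" "(m, n) \<in> r" "\<And>h. h \<in> D \<Longrightarrow> wt (m, n) h = wt (i, j) h"
  shows "m = i \<and> n = j"
proof -
  have F: "i \<in> Field r" "j \<in> Field r" "m \<in> Field r" "n \<in> Field r" "i \<noteq> j"
    using assms in_Field by (auto simp: off_iff)
  then have N: "2 \<le> N"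
    by (auto simp: Field_r)
  have z: "ind m s - ind n s - ind i s + ind j s = 0" if "s \<in> Field r" for s
  proof (rule weight_zero[where c = "\<lambda>t. ind m t - ind n t - ind i t + ind j t"])
    show "(\<Sum>t\<in>Field r. of_int (ind m t - ind n t - ind i t + ind j t) * h (t, t)) = (0::'k)" if "h \<in> D" for h
      using F assms(3)[OF that]
      by (simp add: ring_distribs sum_subtractf sum.distrib ind_sum wt_def algebra_simps)
    show "(\<Sum>t\<in>Field r. ind m t - ind n t - ind i t + ind j t) = 0"
      using F by (simp add: sum_subtractf sum.distrib ind_sum)
    show "s \<in> Field r" by fact
  qed (use N in \<open>auto simp: ind_def\<close>)
  show ?thesis
    using z[OF F(1)] z[OF F(2)] z[OF F(3)] z[OF F(4)] F(5) by (auto simp: ind_def split: if_splits)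
qed

text \<open>Six indicators give integers of size at most 3. The two units are distinct, and by
  antisymmetry not opposite either, so they involve three distinct elements and
  \<open>3 \<le> N\<close>. The conclusion says that weight zero occurs only at composable units, in
  the position of their product.\<close>

lemma weight_3:
  assumes "(i, j) \<in> off" "(k, l) \<in> off" "(i, j) \<noteq> (k, l)" "(m, n) \<in> r"
    and eq: "\<And>h. h \<in> D \<Longrightarrow> wt (m, n) h = wt (i, j) h + wt (k, l) h"
  shows "j = k \<and> m = i \<and> n = l \<or> i = l \<and> m = k \<and> n = j"
proof -
  have F: "i \<in> Field r" "j \<in> Field r" "k \<in> Field r" "l \<in> Field r" "m \<in> Field r" "n \<in> Field r"
    and ne: "i \<noteq> j" "k \<noteq> l" "i \<noteq> k \<or> j \<noteq> l" "i \<noteq> l \<or> j \<noteq> k"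
    using assms in_Field r_antisym by (auto simp: off_iff)
  have N: "3 \<le> N"
    using F ne by (auto simp: Field_r)
  have z: "ind m s - ind n s - ind i s + ind j s - ind k s + ind l s = 0" if "s \<in> Field r" for s
  proof (rule weight_zero[where c = "\<lambda>t. ind m t - ind n t - ind i t + ind j t - ind k t + ind l t"])
    show "(\<Sum>t\<in>Field r. of_int (ind m t - ind n t - ind i t + ind j t - ind k t + ind l t) * h (t, t)) = (0::'k)"
      if "h \<in> D" for h
      using F eq[OF that]
      by (simp add: ring_distribs sum_subtractf sum.distrib ind_sum wt_def algebra_simps)
    show "(\<Sum>t\<in>Field r. ind m t - ind n t - ind i t + ind j t - ind k t + ind l t) = 0"
      using F by (simp add: sum_subtractf sum.distrib ind_sum)
    show "s \<in> Field r" by fact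
    have "0 \<le> ind x s \<and> ind x s \<le> 1" for x
      by (simp add: ind_def)
    from this[of i] this[of j] this[of k] this[of l] this[of m] this[of n]
    show "\<bar>ind m s - ind n s - ind i s + ind j s - ind k s + ind l s\<bar> \<le> int N"
      using N by linarith
  qed
  \<comment> \<open>The relation is evaluated at each of the four endpoints, after which bounds 0
    and 1 on indicators determine m and n.\<close>
  have i: "ind m i - ind n i - ind k i + ind l i = 1" and j: "ind m j - ind n j - ind k j + ind l j = -1"
    and k: "ind m k - ind n k - ind i k + ind j k = 1" and l: "ind m l - ind n l - ind i l + ind j l = -1"
  proof -
    have "ind i i = 1" "ind j i = 0" "ind i j = 0" "ind j j = 1"
      "ind k k = 1" "ind l k = 0" "ind k l = 0" "ind l l = 1"
      using ne(1,2) by (simp_all add: ind_def)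
    then show "ind m i - ind n i - ind k i + ind l i = 1" "ind m j - ind n j - ind k j + ind l j = -1"
      "ind m k - ind n k - ind i k + ind j k = 1" "ind m l - ind n l - ind i l + ind j l = -1"
      using z[OF F(1)] z[OF F(2)] z[OF F(3)] z[OF F(4)] by linarith+
  qed
  have bd: "0 \<le> ind x y" "ind x y \<le> 1" and one: "ind x y = 1 \<longleftrightarrow> y = x" and zero: "ind x y = 0 \<longleftrightarrow> y \<noteq> x"
    for x y
    by (simp_all add: ind_def)
  show ?thesis
  proof (cases "l = i")
    case True
    then have "k \<noteq> j"
      using ne by auto
    then have "ind j k = 0" "ind k j = 0" "ind l j = 0"
      using zero True ne(1) by auto
    then have "ind m k = 1" "ind n j = 1"
      using k j bd[of m k] bd[of n k] bd[of i k] bd[of m j] bd[of n j] by linarith+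
    then show ?thesis
      using True by (simp add: one)
  next
    case False
    then have "ind l i = 0"
      using zero by auto
    then have "ind m i = 1" "ind k i = 0"
      using i bd[of m i] bd[of n i] bd[of k i] by linarith+
    then have mi: "m = i" and "k \<noteq> i"
      using one zero by auto
    then have mil: "ind m k = 0" "ind i k = 0" "ind m l = 0" "ind i l = 0"
      using zero False by auto
    then have jk: "ind j k = 1"
      using k bd[of n k] bd[of j k] by linarith
    then have "ind j l = 0"
      using one zero ne(2) by auto
    then have "ind n l = 1"
      using l mil by linarith
    then show ?thesis
      using mi jk by (simp add: one)
  qed
qed

end


subsection \<open>Coefficients of weight zero\<close>

context poset_lie
begin

lemma cocycles_iff:
  "F \<in> cocycles C d 2 \<longleftrightarrow> F \<in> carrier (C 2) \<and>
    (\<forall>x\<in>carrier L. \<forall>y\<in>carrier L. \<forall>w\<in>carrier L. \<forall>p\<in>r. cyc (\<lambda>x y. F [x, y]) x y w p = 0)"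
  (is "_ \<longleftrightarrow> _ \<and> ?R")
proof -
  have "d 2 F = \<zero>\<^bsub>C (Suc 2)\<^esub> \<longleftrightarrow> ?R" if F: "F \<in> carrier (C 2)"
  proof -
    have "d 2 F = \<zero>\<^bsub>C (Suc 2)\<^esub> \<longleftrightarrow> (\<forall>xs\<in>tuples L (Suc 2). d 2 F xs = \<zero>\<^bsub>L\<^esub>)"
      unfolding ce_cochains_simps by (auto simp: ce_differential_def fun_eq_iff)
    also have "\<dots> \<longleftrightarrow> (\<forall>x\<in>carrier L. \<forall>y\<in>carrier L. \<forall>w\<in>carrier L. d 2 F [x, y, w] = \<zero>\<^bsub>L\<^esub>)"
      unfolding tuples_3 by blast
    also have "\<dots> \<longleftrightarrow> ?R"
      by (simp add: d2_eq[OF F] L_ops rest_eq_iff)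
    finally show ?thesis .
  qed
  then show ?thesis
    by (auto simp: cocycles_def)
qed

lemma coboundaries_eq: "coboundaries C d 2 = d (Suc 0) ` carrier (C (Suc 0))"
  by (simp add: coboundaries_def numeral_2_eq_2)

lemma C2_add: "F \<in> carrier (C 2) \<Longrightarrow> G \<in> carrier (C 2) \<Longrightarrow> x \<in> carrier L \<Longrightarrow> y \<in> carrier L \<Longrightarrow>
    (F \<oplus>\<^bsub>C 2\<^esub> G) [x, y] = rest (F [x, y] + G [x, y])"
  and C2_smult: "x \<in> carrier L \<Longrightarrow> y \<in> carrier L \<Longrightarrow> (c \<odot>\<^bsub>C 2\<^esub> F) [x, y] = rest (scale c (F [x, y]))"
  and C2_zero: "x \<in> carrier L \<Longrightarrow> y \<in> carrier L \<Longrightarrow> \<zero>\<^bsub>C 2\<^esub> [x, y] = rest 0"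
  by (simp_all add: ce_cochains_simps L_ops tuples_2)

lemma C2_eqI:
  assumes "F \<in> carrier (C 2)" "G \<in> carrier (C 2)"
    and "\<And>x y p. x \<in> carrier L \<Longrightarrow> y \<in> carrier L \<Longrightarrow> p \<in> r \<Longrightarrow> F [x, y] p = G [x, y] p"
  shows "F = G"
proof (rule extensionalityI)
  show "F \<in> extensional (tuples L 2)" "G \<in> extensional (tuples L 2)"
    using assms by (auto simp: ce_cochains_2_iff)
  fix xs assume "xs \<in> tuples L 2"
  then show "F xs = G xs"
    using assms C2_D(1) by (auto simp: tuples_2 intro!: L_eqI)
qed

lemma C2_closed:
  assumes F: "F \<in> carrier (C 2)"
  shows "G \<in> carrier (C 2) \<Longrightarrow> F \<oplus>\<^bsub>C 2\<^esub> G \<in> carrier (C 2)" and "c \<odot>\<^bsub>C 2\<^esub> F \<in> carrier (C 2)"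
proof -
  note F' = C2_D[OF F]
  show "F \<oplus>\<^bsub>C 2\<^esub> G \<in> carrier (C 2)" if G: "G \<in> carrier (C 2)"
  proof (rule C2_I)
    show "(F \<oplus>\<^bsub>C 2\<^esub> G) [y, x] = rest (- (F \<oplus>\<^bsub>C 2\<^esub> G) [x, y])" if "x \<in> carrier L" "y \<in> carrier L" for x y
      using that F'(7)[of x y] C2_D(7)[OF G, of x y] by (simp add: C2_add[OF F G] rest_eq_iff)
    show "F \<oplus>\<^bsub>C 2\<^esub> G \<in> extensional (tuples L 2)"
      by (simp add: ce_cochains_simps)
  qed (simp_all add: C2_add[OF F G] L_closed F'(1-6) C2_D(1-6)[OF G] rest_eq_iff scale_def algebra_simps)
  show "c \<odot>\<^bsub>C 2\<^esub> F \<in> carrier (C 2)"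
  proof (rule C2_I)
    show "(c \<odot>\<^bsub>C 2\<^esub> F) [y, x] = rest (- (c \<odot>\<^bsub>C 2\<^esub> F) [x, y])" if "x \<in> carrier L" "y \<in> carrier L" for x y
      using that F'(7)[of x y] by (simp add: C2_smult rest_eq_iff scale_def)
    show "c \<odot>\<^bsub>C 2\<^esub> F \<in> extensional (tuples L 2)"
      by (simp add: ce_cochains_simps)
  qed (simp_all add: C2_smult L_closed F'(1-6) rest_eq_iff scale_def algebra_simps)
qed

lemma C2_zero_closed: "\<zero>\<^bsub>C 2\<^esub> \<in> carrier (C 2)"
  by (rule C2_I) (simp_all add: C2_zero L_closed rest_eq_iff scale_def, simp add: ce_cochains_simps)

lemma module_C2: "module class_ring (C 2)"
  by (rule module_class_ringI; (intro C2_eqI)?)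
    (simp_all add: C2_zero_closed C2_closed C2_add C2_smult C2_zero C2_D(1) scale_def algebra_simps)

lemma cyc_add:
  assumes "F \<in> carrier (C 2)" "G \<in> carrier (C 2)" "x \<in> carrier L" "y \<in> carrier L" "w \<in> carrier L" "p \<in> r"
  shows "cyc (\<lambda>x y. (F \<oplus>\<^bsub>C 2\<^esub> G) [x, y]) x y w p =
    cyc (\<lambda>x y. F [x, y]) x y w p + cyc (\<lambda>x y. G [x, y]) x y w p"
  using assms by (simp add: cyc_def C2_add commutator_linear)

lemma cyc_smult:
  assumes "x \<in> carrier L" "y \<in> carrier L" "w \<in> carrier L" "p \<in> r"
  shows "cyc (\<lambda>x y. (c \<odot>\<^bsub>C 2\<^esub> F) [x, y]) x y w p = c * cyc (\<lambda>x y. F [x, y]) x y w p"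
  using assms by (simp add: cyc_def C2_smult commutator_linear) (simp add: scale_def algebra_simps)

lemma cyc_zero:
  assumes "x \<in> carrier L" "y \<in> carrier L" "w \<in> carrier L" "p \<in> r"
  shows "cyc (\<lambda>x y. \<zero>\<^bsub>C 2\<^esub> [x, y]) x y w p = 0"
  using assms by (simp add: cyc_def C2_zero commutator_linear)

lemma submodule_cocycles: "submodule class_ring (cocycles C d 2) (C 2)"
  by (rule submodule_class_ringI[OF module_C2])
    (auto simp: cocycles_iff C2_closed C2_zero_closed cyc_add cyc_smult cyc_zero)

abbreviation Z where "Z \<equiv> (C 2)\<lparr>carrier := cocycles C d 2\<rparr>"

lemma coboundary_cocycle:
  assumes "G \<in> carrier (C (Suc 0))"
  shows "d (Suc 0) G \<in> cocycles C d 2"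
  using d2_d1[OF assms] d1_in_C2[OF assms] by (simp add: cocycles_iff rest_eq_iff)

lemma C1_closed:
  "\<zero>\<^bsub>C (Suc 0)\<^esub> \<in> carrier (C (Suc 0))"
  "G \<in> carrier (C (Suc 0)) \<Longrightarrow> G' \<in> carrier (C (Suc 0)) \<Longrightarrow> G \<oplus>\<^bsub>C (Suc 0)\<^esub> G' \<in> carrier (C (Suc 0))"
  "G \<in> carrier (C (Suc 0)) \<Longrightarrow> c \<odot>\<^bsub>C (Suc 0)\<^esub> G \<in> carrier (C (Suc 0))"
proof -
  have iff: "G \<in> carrier (C (Suc 0)) \<longleftrightarrow> G \<in> extensional (tuples L (Suc 0)) \<and>
    (\<forall>x\<in>carrier L. G [x] \<in> carrier L) \<and>
    (\<forall>x\<in>carrier L. \<forall>y\<in>carrier L. G [rest (x + y)] = rest (G [x] + G [y])) \<and>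
    (\<forall>c. \<forall>x\<in>carrier L. G [rest (scale c x)] = rest (scale c (G [x])))" for G
    unfolding ce_cochains_1_iff by (auto simp: LinearCombinations.module_hom_def L_ops)
  have t: "[x] \<in> tuples L (Suc 0) \<longleftrightarrow> x \<in> carrier L" for x
    by (simp add: tuples_1)
  show "\<zero>\<^bsub>C (Suc 0)\<^esub> \<in> carrier (C (Suc 0))"
    by (simp add: iff ce_cochains_simps t L_ops L_closed rest_eq_iff scale_def)
  show "G \<in> carrier (C (Suc 0)) \<Longrightarrow> G' \<in> carrier (C (Suc 0)) \<Longrightarrow> G \<oplus>\<^bsub>C (Suc 0)\<^esub> G' \<in> carrier (C (Suc 0))"
    by (simp add: iff ce_cochains_simps t L_ops L_closed rest_eq_iff scale_def algebra_simps)
  show "G \<in> carrier (C (Suc 0)) \<Longrightarrow> c \<odot>\<^bsub>C (Suc 0)\<^esub> G \<in> carrier (C (Suc 0))"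
    by (simp add: iff ce_cochains_simps t L_ops L_closed rest_eq_iff scale_def algebra_simps)
qed

lemma quotient_CE: "quotient_module Z (coboundaries C d 2)"
proof (rule quotient_module.intro)
  interpret C2: Module.module class_ring "C 2" by (rule module_C2)
  show Z: "module class_ring Z"
    by (rule C2.submodule_is_module[OF submodule_cocycles])
  have t: "[x] \<in> tuples L (Suc 0) \<longleftrightarrow> x \<in> carrier L" for x
    by (simp add: tuples_1)
  have "\<zero>\<^bsub>C 2\<^esub> = d (Suc 0) \<zero>\<^bsub>C (Suc 0)\<^esub>"
    by (rule C2_eqI) (simp_all add: C2_zero_closed C1_closed d1_in_C2 C2_zero d1_eq,
      simp add: ce_cochains_simps t L_ops commutator_linear)
  moreover have "d (Suc 0) G \<oplus>\<^bsub>C 2\<^esub> d (Suc 0) G' = d (Suc 0) (G \<oplus>\<^bsub>C (Suc 0)\<^esub> G')"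
    if "G \<in> carrier (C (Suc 0))" "G' \<in> carrier (C (Suc 0))" for G G'
    by (rule C2_eqI) (simp_all add: that C2_closed C1_closed d1_in_C2 C2_add d1_eq,
      simp add: ce_cochains_simps t L_ops commutator_linear)
  moreover have "c \<odot>\<^bsub>C 2\<^esub> d (Suc 0) G = d (Suc 0) (c \<odot>\<^bsub>C (Suc 0)\<^esub> G)"
    if "G \<in> carrier (C (Suc 0))" for G c
    by (rule C2_eqI) (simp_all add: that C2_closed C1_closed d1_in_C2 C2_smult d1_eq,
      simp add: ce_cochains_simps t L_ops commutator_linear, simp add: scale_def algebra_simps)
  ultimately show "submodule class_ring (coboundaries C d 2) Z"
    by (intro submodule_class_ringI[OF Z])
      (auto simp: coboundaries_eq coboundary_cocycle intro!: imageI C1_closed)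
qed

lemma cocycle_eq:
  assumes "F \<in> cocycles C d 2" "x \<in> carrier L" "y \<in> carrier L" "w \<in> carrier L" "p \<in> r"
  shows "br x (F [y, w]) p - br y (F [x, w]) p + br w (F [x, y]) p
    - F [rest (br x y), w] p + F [rest (br x w), y] p - F [rest (br y w), x] p = 0"
  using assms unfolding cocycles_iff by (simp add: cyc_def)

lemma C2_simps:
  assumes "F \<in> carrier (C 2)" "x \<in> carrier L" "p \<in> r"
  shows "F [rest 0, x] p = 0" "F [x, x] p = 0"
    and "y \<in> carrier L \<Longrightarrow> F [rest (scale c y), x] p = c * F [y, x] p"
  using C2_D(4)[OF assms(1,2,2), of 0] C2_D(6)[OF assms(1,2,2)] C2_D(4)[OF assms(1) _ assms(2), of y c] assms(3)
  by (simp_all add: scale_linear) (simp_all add: scale_def)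

lemma C2_swap:
  assumes "F \<in> carrier (C 2)" "x \<in> carrier L" "y \<in> carrier L" "p \<in> r"
  shows "F [y, x] p = - F [x, y] p"
  using C2_D(7)[OF assms(1-3)] assms(4) by simp

lemma off_trans: "(i, j) \<in> off \<Longrightarrow> (j, k) \<in> off \<Longrightarrow> (i, k) \<in> off"
  using r_trans r_antisym by (auto simp: off_iff)

lemma off_diag: "(i, j) \<in> off \<Longrightarrow> (i, i) \<in> r" "(i, j) \<in> off \<Longrightarrow> (j, j) \<in> r" "p \<in> off \<Longrightarrow> p \<in> r"
  using r_refls by (auto simp: off_def)

text \<open>The cocycle identity for h, h' and a matrix unit, at the position of that unit. The
  actions of h and h' cancel against the terms with their brackets, as both scale by the weight of
  the unit; the action of the unit on \<open>F [h, h']\<close> remains.\<close>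

lemma cocycle_DDE:
  assumes F: "F \<in> cocycles C d 2" and h: "h \<in> D" "h' \<in> D" and ij: "(i, j) \<in> off"
  shows "F [h, h'] (i, i) = F [h, h'] (j, j)"
proof -
  have F2: "F \<in> carrier (C 2)"
    using F by (simp add: cocycles_iff)
  have L: "h \<in> carrier L" "h' \<in> carrier L" "E (i, j) \<in> carrier L"
    using h ij by (auto simp: D_L)
  have r: "(i, j) \<in> r"
    using ij by (rule off_diag)
  show ?thesis
    using cocycle_eq[OF F L r] L r off_diag[OF ij] C2_swap[OF F2 L(1,3) r] C2_swap[OF F2 L(2,3) r]
    by (simp add: br_D[OF h(1)] br_D[OF h(2)] br_E bracket_generators(1)[OF h(1) ij] bracket_generators(1)[OF h(2) ij]
        bracket_generators(2)[OF h] C2_simps[OF F2])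
qed

text \<open>At position (i, k) the three terms containing \<open>F [E (i, j), E (j, k)]\<close>
  carry the weight of (i, k) minus those of (i, j) and (j, k), which is zero. What survives is the
  cocycle condition of the nerve.\<close>

lemma cocycle_DEE:
  assumes F: "F \<in> cocycles C d 2" and h: "h \<in> D" and ij: "(i, j) \<in> off" and jk: "(j, k) \<in> off"
  shows "F [h, E (j, k)] (j, k) - F [h, E (i, k)] (i, k) + F [h, E (i, j)] (i, j) = 0"
proof -
  have F2: "F \<in> carrier (C 2)"
    using F by (simp add: cocycles_iff)
  have ik: "(i, k) \<in> off"
    using ij jk by (rule off_trans)
  have L: "h \<in> carrier L" "E (i, j) \<in> carrier L" "E (j, k) \<in> carrier L" "E (i, k) \<in> carrier L"
    using h ij jk ik by (auto simp: D_L)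
  have r: "(i, k) \<in> r" "(i, j) \<in> r" "(j, k) \<in> r"
    using ij jk ik by (auto simp: off_diag)
  have ne: "i \<noteq> j" "j \<noteq> k" "i \<noteq> k"
    using ij jk ik by (auto simp: off_iff)
  have wt: "wt (i, k) h = wt (i, j) h + wt (j, k) h"
    by (simp add: wt_def)
  show ?thesis
    using cocycle_eq[OF F L(1-3) r(1)] L r ne C2_swap[OF F2 L(1,4) r(1)] C2_swap[OF F2 L(2,3) r(1)]
    by (simp add: br_D[OF h] br_E bracket_generators(1)[OF h ij] bracket_generators(1)[OF h jk]
        bracket_generators(3)[OF ij jk] C2_simps[OF F2] wt algebra_simps)
qed

text \<open>At position (i, l) the middle unit acts by zero, and the outer two units commute. The
  four remaining terms are the faces of the chain i, j, k, l.\<close>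

lemma cocycle_EEE:
  assumes F: "F \<in> cocycles C d 2" and ij: "(i, j) \<in> off" and jk: "(j, k) \<in> off" and kl: "(k, l) \<in> off"
  shows "F [E (j, k), E (k, l)] (j, l) - F [E (i, k), E (k, l)] (i, l)
    + F [E (i, j), E (j, l)] (i, l) - F [E (i, j), E (j, k)] (i, k) = 0"
proof -
  have F2: "F \<in> carrier (C 2)"
    using F by (simp add: cocycles_iff)
  have ik: "(i, k) \<in> off" and jl: "(j, l) \<in> off"
    using ij jk kl off_trans by blast+
  then have il: "(i, l) \<in> off"
    using ij off_trans by blast
  have L: "E (i, j) \<in> carrier L" "E (j, k) \<in> carrier L" "E (k, l) \<in> carrier L" "E (i, k) \<in> carrier L"
    "E (j, l) \<in> carrier L"
    using ij jk kl ik jl by auto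
  have r: "(i, l) \<in> r" "(i, j) \<in> r" "(j, k) \<in> r" "(k, l) \<in> r" "(i, k) \<in> r" "(j, l) \<in> r"
    using ij jk kl ik jl il by (auto simp: off_diag)
  have ne: "i \<noteq> j" "j \<noteq> k" "k \<noteq> l" "i \<noteq> k" "j \<noteq> l" "i \<noteq> l" "l \<noteq> i" "j \<noteq> i" "l \<noteq> k"
    using ij jk kl ik jl il by (auto simp: off_iff)
  show ?thesis
    using cocycle_eq[OF F L(1-3) r(1)] L r ne C2_swap[OF F2 L(1,5) r(1)]
    by (simp add: br_E bracket_generators(3)[OF ij jk] bracket_generators(3)[OF jk kl]
        bracket_generators(4)[OF ij kl] C2_simps[OF F2] algebra_simps)
qed

end


subsection \<open>Cocycles without coefficients of weight zero\<close>

context poset_lie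
begin

lemma L_linear_decomp:
  fixes \<phi> :: "(nat \<times> nat \<Rightarrow> 'k) \<Rightarrow> 'k"
  assumes add: "\<And>x y. x \<in> carrier L \<Longrightarrow> y \<in> carrier L \<Longrightarrow> \<phi> (rest (x + y)) = \<phi> x + \<phi> y"
    and scale: "\<And>c x. x \<in> carrier L \<Longrightarrow> \<phi> (rest (scale c x)) = c * \<phi> x" and x: "x \<in> carrier L"
  shows "\<phi> x = \<phi> (dg x) + (\<Sum>q\<in>off. x q * \<phi> (E q))"
proof -
  have sum: "rest (\<Sum>q\<in>A. scale (x q) (E q)) \<in> carrier L \<and>
      \<phi> (rest (\<Sum>q\<in>A. scale (x q) (E q))) = (\<Sum>q\<in>A. x q * \<phi> (E q))"
    if "finite A" "A \<subseteq> off" for A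
    using that
  proof (induction A)
    case empty
    have "\<phi> (rest 0) = 0"
      using scale[OF x, of 0] by (simp add: scale_linear)
    then show ?case
      unfolding sum.empty using L_closed(1) by blast
  next
    case (insert q A)
    then have "A \<subseteq> off" and q: "E q \<in> carrier L"
      by auto
    then have 1: "rest (\<Sum>q\<in>A. scale (x q) (E q)) \<in> carrier L"
        "\<phi> (rest (\<Sum>q\<in>A. scale (x q) (E q))) = (\<Sum>q\<in>A. x q * \<phi> (E q))"
      using insert.IH by blast+
    have 2: "rest (scale (x q) (E q)) \<in> carrier L" "\<phi> (rest (scale (x q) (E q))) = x q * \<phi> (E q)"
      using L_closed(4)[OF q] scale[OF q] by auto
    have eq: "rest (\<Sum>q\<in>insert q A. scale (x q) (E q)) =
        rest (rest (scale (x q) (E q)) + rest (\<Sum>q\<in>A. scale (x q) (E q)))"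
      unfolding sum.insert[OF insert.hyps] rest_rest_linear ..
    show ?case
      unfolding eq
      unfolding add[OF 2(1) 1(1)] 1(2) 2(2) sum.insert[OF insert.hyps]
      using L_closed(2)[OF 2(1) 1(1)] by blast
  qed
  have "\<phi> x = \<phi> (rest (dg x + rest (\<Sum>q\<in>off. scale (x q) (E q))))"
    using L_decomp[OF x] by simp
  also have "\<dots> = \<phi> (dg x) + \<phi> (rest (\<Sum>q\<in>off. scale (x q) (E q)))"
    using sum[OF finite_off order_refl] by (intro add D_L[OF dg_D[OF x]]) blast
  also have "\<phi> (rest (\<Sum>q\<in>off. scale (x q) (E q))) = (\<Sum>q\<in>off. x q * \<phi> (E q))"
    using sum[OF finite_off order_refl] by blast
  finally show ?thesis .
qed

definition gens :: "(nat \<times> nat \<Rightarrow> 'k) set"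
  where "gens = D \<union> E ` off"

lemma D_gens: "h \<in> D \<Longrightarrow> h \<in> gens" and E_gens: "q \<in> off \<Longrightarrow> E q \<in> gens"
  by (auto simp: gens_def)

lemma gens_L: "x \<in> gens \<Longrightarrow> x \<in> carrier L"
  by (auto simp: gens_def D_L)

lemma C2_eq_on_gens:
  assumes F: "F \<in> carrier (C 2)" and G: "G \<in> carrier (C 2)"
    and eq: "\<And>x y p. x \<in> gens \<Longrightarrow> y \<in> gens \<Longrightarrow> p \<in> r \<Longrightarrow> F [x, y] p = G [x, y] p"
  shows "F = G"
proof (rule C2_eqI[OF F G])
  note F' = C2_D[OF F]
  note G' = C2_D[OF G]
  have 1: "F [x, y] p = G [x, y] p" if "x \<in> carrier L" "y \<in> gens" "p \<in> r" for x y p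
  proof -
    have "x \<in> {x \<in> carrier L. F [x, y] p = G [x, y] p}"
      by (rule L_induct) (use that eq[OF _ that(2,3)] in \<open>auto simp: gens_L L_closed F'(2,4) G'(2,4) C2_simps[OF F] C2_simps[OF G]
          scale_def D_gens E_gens D_L\<close>)
    then show ?thesis
      by simp
  qed
  show "F [x, y] p = G [x, y] p" if "x \<in> carrier L" "y \<in> carrier L" "p \<in> r" for x y p
  proof -
    have z: "F [x, rest 0] p = G [x, rest 0] p"
      using C2_swap[OF F L_closed(1) that(1,3)] C2_swap[OF G L_closed(1) that(1,3)]
        C2_simps(1)[OF F that(1,3)] C2_simps(1)[OF G that(1,3)] by simp
    have "y \<in> {y \<in> carrier L. F [x, y] p = G [x, y] p}"
      by (rule L_induct) (use that 1[OF that(1) _ that(3)] z in \<open>auto simp: L_closed F'(3,5) G'(3,5) scale_def D_gens E_gens D_L\<close>)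
    then show ?thesis
      by simp
  qed
qed

text \<open>
  Cartan's formula: on the component of weight \<open>\<beta>\<close>, contraction with a diagonal \<open>c\<close> divided by
  \<open>\<beta> c \<noteq> 0\<close> inverts the differential on cocycles. One \<open>c\<close> is chosen for every \<open>\<beta>\<close>, and
  \<open>prim\<close> assembles the components.
\<close>

definition contr where
  "contr F \<beta> x = (if \<exists>c. c \<in> D \<and> \<beta> c \<noteq> 0
    then scale (1 / \<beta> (SOME c. c \<in> D \<and> \<beta> c \<noteq> 0)) (F [SOME c. c \<in> D \<and> \<beta> c \<noteq> 0, x]) else 0)"

lemma contr_cases:
  obtains "\<And>h. h \<in> D \<Longrightarrow> \<beta> h = (0::'k)" "\<And>x. contr F \<beta> x = 0"
  | c where "c \<in> D" "\<beta> c \<noteq> 0" "\<And>x. contr F \<beta> x = scale (1 / \<beta> c) (F [c, x])"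
proof (cases "\<exists>c. c \<in> D \<and> \<beta> c \<noteq> 0")
  case True
  then show ?thesis
    using someI_ex[OF True] by (intro that(2)) (auto simp: contr_def)
qed (auto intro!: that(1) simp: contr_def)

text \<open>The choice of c looks at \<open>\<beta>\<close> through its values on \<open>D\<close>
  only, so weights that agree there receive the same c. Contractions arising at different entries
  are thereby compatible.\<close>

lemma contr_cong:
  assumes "\<And>h. h \<in> D \<Longrightarrow> \<beta> h = \<beta>' h"
  shows "contr F \<beta> = contr F \<beta>'"
proof -
  have P: "(\<lambda>c. c \<in> D \<and> \<beta> c \<noteq> 0) = (\<lambda>c. c \<in> D \<and> \<beta>' c \<noteq> 0)"
    using assms by auto
  show ?thesis
  proof (cases "\<exists>c. c \<in> D \<and> \<beta>' c \<noteq> 0")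
    case True
    then show ?thesis
      using someI_ex[OF True] assms unfolding contr_def P by auto
  next
    case False
    show ?thesis
      unfolding contr_def P using False by (intro ext) (simp only: if_False)
  qed
qed

lemma contr_linear:
  assumes F: "F \<in> carrier (C 2)" and p: "p \<in> r" and x: "x \<in> carrier L"
  shows "y \<in> carrier L \<Longrightarrow> contr F \<beta> (rest (x + y)) p = contr F \<beta> x p + contr F \<beta> y p"
    and "contr F \<beta> (rest (scale a x)) p = a * contr F \<beta> x p"
proof -
  note F' = C2_D[OF F]
  show "y \<in> carrier L \<Longrightarrow> contr F \<beta> (rest (x + y)) p = contr F \<beta> x p + contr F \<beta> y p"
    using x p by (cases rule: contr_cases[of \<beta> F])
      (auto simp: F'(3) D_L scale_def algebra_simps add_divide_distrib)
  show "contr F \<beta> (rest (scale a x)) p = a * contr F \<beta> x p"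
    using x p by (cases rule: contr_cases[of \<beta> F]) (auto simp: F'(5) D_L scale_def)
qed

lemma contr_trace:
  assumes F: "F \<in> carrier (C 2)" and x: "x \<in> carrier L"
  shows "(\<Sum>i\<in>Field r. contr F \<beta> x (i, i)) = 0"
proof (cases rule: contr_cases[of \<beta> F])
  case (2 c)
  then show ?thesis
    using sum_diag_linear(3)[of "1 / \<beta> c" "F [c, x]"] L_trace[OF C2_D(1)[OF F D_L[OF 2(1)] x]] by simp
qed simp

text \<open>In the entry \<open>p\<close> of the image of the unit at \<open>q\<close> the relevant
  weight is \<open>wt p - wt q\<close>; on the diagonal part the argument has weight zero and
  \<open>wt p\<close> remains.\<close>

definition prim where
  "prim F x = rest (\<lambda>p. contr F (wt p) (dg x) p + (\<Sum>q\<in>off. x q * contr F (\<lambda>h. wt p h - wt q h) (E q) p))"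

text \<open>Homogeneity tested by values on \<open>D\<close>. The weight \<open>\<gamma>\<close> is
  an arbitrary function, so weights can be added and subtracted pointwise; the zero element has
  every weight.\<close>

definition of_weight :: "(nat \<times> nat \<Rightarrow> 'k) \<Rightarrow> ((nat \<times> nat \<Rightarrow> 'k) \<Rightarrow> 'k) \<Rightarrow> bool"
  where "of_weight x \<gamma> \<longleftrightarrow> x \<in> carrier L \<and> (\<forall>q\<in>r. x q \<noteq> 0 \<longrightarrow> (\<forall>h\<in>D. wt q h = \<gamma> h))"

lemma of_weightD: "of_weight x \<gamma> \<Longrightarrow> q \<in> r \<Longrightarrow> x q \<noteq> 0 \<Longrightarrow> h \<in> D \<Longrightarrow> wt q h = \<gamma> h"
  by (auto simp: of_weight_def)

text \<open>All nonzero coordinates of \<open>w\<close> have the same weight on \<open>D\<close>, so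
  by \<open>contr_cong\<close> one contraction serves all terms in the definition of
  \<open>prim\<close>, and linearity collects them.\<close>

lemma prim_of_weight:
  assumes F: "F \<in> carrier (C 2)" and w: "of_weight w \<gamma>" and p: "p \<in> r"
  shows "prim F w p = contr F (\<lambda>h. wt p h - \<gamma> h) w p"
proof -
  let ?\<phi> = "contr F (\<lambda>h. wt p h - \<gamma> h)"
  have wL: "w \<in> carrier L"
    using w by (simp add: of_weight_def)
  have off: "w q * contr F (\<lambda>h. wt p h - wt q h) (E q) p = w q * ?\<phi> (E q) p" if "q \<in> off" for q
  proof (cases "w q = 0")
    case False
    then have "contr F (\<lambda>h. wt p h - wt q h) = ?\<phi>"
      using of_weightD[OF w _ False] that by (intro contr_cong) (auto simp: off_diag)
    then show ?thesis
      by simp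
  qed simp
  have diag: "contr F (wt p) (dg w) p = ?\<phi> (dg w) p"
  \<comment> \<open>A nonzero diagonal entry forces \<open>\<gamma>\<close> to vanish on
    \<open>D\<close>; if there is none, both sides are zero.\<close>
  proof (cases "\<exists>i. (i, i) \<in> r \<and> w (i, i) \<noteq> 0")
    case True
    then obtain i where i: "(i, i) \<in> r" "w (i, i) \<noteq> 0"
      by auto
    have "\<gamma> h = 0" if "h \<in> D" for h
      using of_weightD[OF w i that] by (simp add: wt_def)
    then have "contr F (wt p) = ?\<phi>"
      by (intro contr_cong) simp
    then show ?thesis
      by simp
  next
    case False
    then have "dg w = rest (scale 0 w)"
      by (auto simp: dg_def scale_def rest_eq_iff)
    then show ?thesis
      using contr_linear(2)[OF F p wL, of _ 0] by simp
  qed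
  have "prim F w p = contr F (wt p) (dg w) p + (\<Sum>q\<in>off. w q * contr F (\<lambda>h. wt p h - wt q h) (E q) p)"
    using p by (simp add: prim_def)
  also have "\<dots> = ?\<phi> (dg w) p + (\<Sum>q\<in>off. w q * ?\<phi> (E q) p)"
    unfolding diag by (intro arg_cong2[of _ _ _ _ "(+)"] refl sum.cong off)
  also have "\<dots> = ?\<phi> w p"
    by (rule L_linear_decomp[symmetric], rule contr_linear(1)[OF F p], assumption+,
        rule contr_linear(2)[OF F p], assumption, rule wL)
  finally show ?thesis .
qed

lemma dg_linear: "dg (rest (x + y)) = rest (dg x + dg y)" "dg (rest (scale c x)) = rest (scale c (dg x))"
  unfolding dg_def by (auto simp: rest_eq_iff r_refls scale_def)

lemma prim_C1:
  assumes F: "F \<in> carrier (C 2)"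
  shows "(\<lambda>xs\<in>tuples L (Suc 0). prim F (hd xs)) \<in> carrier (C (Suc 0))"
  unfolding ce_cochains_1_iff
proof (intro conjI linear_mapsI)
  have t: "[x] \<in> tuples L (Suc 0) \<longleftrightarrow> x \<in> carrier L" for x
    by (simp add: tuples_1)
  fix x assume x: "x \<in> carrier L"
  have dx: "dg x \<in> carrier L"
    using x by (simp add: D_L)
  \<comment> \<open>All diagonal positions have weight zero, so one and the same contraction is used
    along the diagonal and the trace of its value, which is zero, can be taken.\<close>
  have "(\<Sum>i\<in>Field r. contr F (wt (i, i)) (dg x) (i, i)) = (\<Sum>i\<in>Field r. contr F (\<lambda>h. 0) (dg x) (i, i))"
  proof (rule sum.cong)
    show "contr F (wt (i, i)) (dg x) (i, i) = contr F (\<lambda>h. 0) (dg x) (i, i)" for i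
      using contr_cong[of "wt (i, i)" "\<lambda>h. 0" F] by (simp add: wt_def)
  qed simp
  moreover have "(\<Sum>i\<in>Field r. \<Sum>q\<in>off. x q * contr F (\<lambda>h. wt (i, i) h - wt q h) (E q) (i, i)) =
      (\<Sum>q\<in>off. x q * (\<Sum>i\<in>Field r. contr F (\<lambda>h. - wt q h) (E q) (i, i)))"
    by (subst sum.swap) (simp add: wt_def sum_distrib_left)
  moreover have "\<dots> = 0"
    by (intro sum.neutral) (simp add: contr_trace[OF F])
  ultimately have "prim F x \<in> carrier L"
    by (simp add: prim_def rest_in_L sum.distrib contr_trace[OF F dx])
  then show "(\<lambda>xs\<in>tuples L (Suc 0). prim F (hd xs)) [x] \<in> carrier L"
    using x by (simp add: t)
  show "(\<lambda>xs\<in>tuples L (Suc 0). prim F (hd xs)) [c \<odot>\<^bsub>L\<^esub> x] =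
      c \<odot>\<^bsub>L\<^esub> (\<lambda>xs\<in>tuples L (Suc 0). prim F (hd xs)) [x]" for c
    using x dx by (simp add: t L_ops L_closed prim_def dg_linear rest_eq_iff contr_linear[OF F])
      (simp add: scale_def off_diag algebra_simps sum_distrib_left)
  fix y assume y: "y \<in> carrier L"
  have dy: "dg y \<in> carrier L"
    using y by (simp add: D_L)
  show "(\<lambda>xs\<in>tuples L (Suc 0). prim F (hd xs)) [x \<oplus>\<^bsub>L\<^esub> y] =
      (\<lambda>xs\<in>tuples L (Suc 0). prim F (hd xs)) [x] \<oplus>\<^bsub>L\<^esub> (\<lambda>xs\<in>tuples L (Suc 0). prim F (hd xs)) [y]"
    using x y dx dy by (simp add: t L_ops L_closed prim_def dg_linear rest_eq_iff contr_linear[OF F])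
      (simp add: off_diag algebra_simps sum.distrib)
qed simp

lemma wt_trans: "wt (i, k) h = wt (i, j) h + wt (j, k) h"
  by (simp add: wt_def)

text \<open>Weights add along the path from a through j to c. Wherever the factor from
  \<open>x\<close> is nonzero it has weight \<open>\<gamma>\<close>, so the factor from
  \<open>prim\<close> needs the same weight \<open>wt p h - \<gamma> h - \<delta> h\<close> for
  every j.\<close>

lemma mm_prim:
  assumes F: "F \<in> carrier (C 2)" and x: "of_weight x \<gamma>" and y: "of_weight y \<delta>" and p: "p \<in> r"
  shows "mm x (prim F y) p = mm x (contr F (\<lambda>h. wt p h - \<gamma> h - \<delta> h) y) p"
    and "mm (prim F y) x p = mm (contr F (\<lambda>h. wt p h - \<gamma> h - \<delta> h) y) x p"
proof -
  obtain a c where ac: "p = (a, c)" by (cases p)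
  have "cut r x (a, j) * cut r (prim F y) (j, c) =
      cut r x (a, j) * cut r (contr F (\<lambda>h. wt p h - \<gamma> h - \<delta> h) y) (j, c)" for j
  proof (cases "(a, j) \<in> r \<and> (j, c) \<in> r \<and> x (a, j) \<noteq> 0")
    case True
    then have "contr F (\<lambda>h. wt (j, c) h - \<delta> h) = contr F (\<lambda>h. wt p h - \<gamma> h - \<delta> h)"
      using of_weightD[OF x, of "(a, j)"] unfolding ac wt_trans[of a c _ j] by (intro contr_cong) auto
    then show ?thesis
      using True prim_of_weight[OF F y, of "(j, c)"] by (simp add: cut_def)
  qed (auto simp: cut_def)
  then show "mm x (prim F y) p = mm x (contr F (\<lambda>h. wt p h - \<gamma> h - \<delta> h) y) p"
    unfolding mat_mult_def ac fst_conv snd_conv by (intro sum.cong refl)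
  have "cut r (prim F y) (a, j) * cut r x (j, c) =
      cut r (contr F (\<lambda>h. wt p h - \<gamma> h - \<delta> h) y) (a, j) * cut r x (j, c)" for j
  proof (cases "(a, j) \<in> r \<and> (j, c) \<in> r \<and> x (j, c) \<noteq> 0")
    case True
    then have "contr F (\<lambda>h. wt (a, j) h - \<delta> h) = contr F (\<lambda>h. wt p h - \<gamma> h - \<delta> h)"
      using of_weightD[OF x, of "(j, c)"] unfolding ac wt_trans[of a c _ j] by (intro contr_cong) auto
    then show ?thesis
      using True prim_of_weight[OF F y, of "(a, j)"] by (simp add: cut_def)
  qed (auto simp: cut_def)
  then show "mm (prim F y) x p = mm (contr F (\<lambda>h. wt p h - \<gamma> h - \<delta> h) y) x p"
    unfolding mat_mult_def ac fst_conv snd_conv by (intro sum.cong refl)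
qed

lemma br_prim:
  assumes "F \<in> carrier (C 2)" "of_weight x \<gamma>" "of_weight y \<delta>" "p \<in> r"
  shows "br x (prim F y) p = br x (contr F (\<lambda>h. wt p h - \<gamma> h - \<delta> h) y) p"
  using mm_prim[OF assms] by (simp add: commutator_def)

lemma of_weight_mm:
  assumes x: "of_weight x \<gamma>" and y: "of_weight y \<delta>" and "q \<in> r" "mm x y q \<noteq> 0" "h \<in> D"
  shows "wt q h = \<gamma> h + \<delta> h"
proof -
  obtain a c where ac: "q = (a, c)" by (cases q)
  obtain j where "cut r x (a, j) * cut r y (j, c) \<noteq> 0"
    using assms(4) unfolding mat_mult_def ac fst_conv snd_conv by (rule sum.not_neutral_contains_not_neutral)
  then have "(a, j) \<in> r" "(j, c) \<in> r" "x (a, j) \<noteq> 0" "y (j, c) \<noteq> 0"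
    by (auto simp: cut_def split: if_splits)
  then show ?thesis
    using of_weightD[OF x _ _ assms(5)] of_weightD[OF y _ _ assms(5)] by (simp add: ac wt_trans[of a c h j])
qed

lemma of_weight_bracket:
  assumes x: "of_weight x \<gamma>" and y: "of_weight y \<delta>"
  shows "of_weight (rest (br x y)) (\<lambda>h. \<gamma> h + \<delta> h)"
  unfolding of_weight_def
proof (intro conjI ballI impI)
  show "rest (br x y) \<in> carrier L"
    using x y by (simp add: of_weight_def)
  fix q h assume q: "q \<in> r" "rest (br x y) q \<noteq> 0" and h: "h \<in> D"
  then have "mm x y q \<noteq> 0 \<or> mm y x q \<noteq> 0"
    by (auto simp: commutator_def)
  then show "wt q h = \<gamma> h + \<delta> h"
    using of_weight_mm[OF x y q(1) _ h] of_weight_mm[OF y x q(1) _ h] by auto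
qed

lemma br_of_weight:
  assumes "of_weight x \<gamma>" "h \<in> D"
  shows "rest (br h x) = rest (scale (\<gamma> h) x)"
  unfolding rest_eq_iff using assms of_weightD[OF assms(1)] by (auto simp: br_D scale_def)

text \<open>By the preceding lemmas all three terms of the differential use the contraction for one
  weight. If that weight is nonzero, this is Cartan's formula divided by its value at c; if it is
  zero, the contractions vanish and \<open>zero\<close> takes care of the other side.\<close>

lemma d1_prim:
  assumes F: "F \<in> cocycles C d 2" and x: "of_weight x \<gamma>" and y: "of_weight y \<delta>" and p: "p \<in> r"
    and zero: "(\<And>h. h \<in> D \<Longrightarrow> wt p h = \<gamma> h + \<delta> h) \<Longrightarrow> F [x, y] p = 0"
  shows "d (Suc 0) (\<lambda>xs\<in>tuples L (Suc 0). prim F (hd xs)) [x, y] p = F [x, y] p"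
proof -
  have F2: "F \<in> carrier (C 2)"
    using F by (simp add: cocycles_iff)
  have L: "x \<in> carrier L" "y \<in> carrier L"
    using x y by (auto simp: of_weight_def)
  let ?\<beta> = "\<lambda>h. wt p h - \<gamma> h - \<delta> h"
  have t: "[x] \<in> tuples L (Suc 0) \<longleftrightarrow> x \<in> carrier L" for x
    by (simp add: tuples_1)
  have \<beta>: "(\<lambda>h. wt p h - \<delta> h - \<gamma> h) = ?\<beta>" "(\<lambda>h. wt p h - (\<gamma> h + \<delta> h)) = ?\<beta>"
    by (simp_all add: fun_eq_iff)
  have dG: "d (Suc 0) (\<lambda>xs\<in>tuples L (Suc 0). prim F (hd xs)) [x, y] p =
      br x (contr F ?\<beta> y) p - br y (contr F ?\<beta> x) p - contr F ?\<beta> (rest (br x y)) p"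
    using L p br_prim[OF F2 x y p] br_prim[OF F2 y x p]
      prim_of_weight[OF F2 of_weight_bracket[OF x y] p]
    by (simp add: d1_eq[OF prim_C1[OF F2]] t \<beta>)
  show ?thesis
  proof (cases rule: contr_cases[of ?\<beta> F])
    case 1
    then have "F [x, y] p = 0"
      by (intro zero) (simp add: algebra_simps)
    then show ?thesis
      using 1 dG by (simp add: commutator_linear)
  next
    case (2 c)
    have c: "c \<in> carrier L"
      using 2 by (simp add: D_L)
    define b where "b = ?\<beta> c"
    \<comment> \<open>The cocycle identity at (c, x, y): c acts on the value, on x and on y by
      scalars, which combine to the factor b.\<close>
    have "b * F [x, y] p = br x (F [c, y]) p - br y (F [c, x]) p - F [c, rest (br x y)] p"
      using cocycle_eq[OF F c L p] C2_swap[OF F2 L p] C2_swap[OF F2 c _ p, of "rest (br x y)"] L p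
        br_of_weight[OF x 2(1)] br_of_weight[OF y 2(1)]
      by (simp add: b_def br_D[OF 2(1) p] C2_simps[OF F2] algebra_simps)
    then have "F [x, y] p = 1 / b * (br x (F [c, y]) p - br y (F [c, x]) p - F [c, rest (br x y)] p)"
      using 2(2) b_def by (simp add: eq_divide_eq mult.commute)
    also have "\<dots> = d (Suc 0) (\<lambda>xs\<in>tuples L (Suc 0). prim F (hd xs)) [x, y] p"
      unfolding dG 2(3) commutator_linear b_def[symmetric] by (simp add: scale_def right_diff_distrib)
    finally show ?thesis ..
  qed
qed

lemma of_weight_D: "h \<in> D \<Longrightarrow> of_weight h (\<lambda>_. 0)"
  by (auto simp: of_weight_def D_L) (auto simp: D_iff off_iff wt_def)

lemma of_weight_E: "q \<in> off \<Longrightarrow> of_weight (E q) (wt q)"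
  by (auto simp: of_weight_def E_eval split: if_splits)

text \<open>On generators \<open>prim\<close> is a primitive away from weight zero, and the lemmas
  on weights show that the entries of weight zero are, up to swapping arguments, those assumed to
  vanish or zero by alternation.\<close>

lemma coboundaryI:
  assumes F: "F \<in> cocycles C d 2"
    and DD: "\<And>h h' i. h \<in> D \<Longrightarrow> h' \<in> D \<Longrightarrow> (i, i) \<in> r \<Longrightarrow> F [h, h'] (i, i) = 0"
    and DE: "\<And>h q. h \<in> D \<Longrightarrow> q \<in> off \<Longrightarrow> F [h, E q] q = 0"
    and EE: "\<And>i j k. (i, j) \<in> off \<Longrightarrow> (j, k) \<in> off \<Longrightarrow> F [E (i, j), E (j, k)] (i, k) = 0"
  shows "F \<in> coboundaries C d 2"
proof -
  let ?G = "\<lambda>xs\<in>tuples L (Suc 0). prim F (hd xs)"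
  have F2: "F \<in> carrier (C 2)"
    using F by (simp add: cocycles_iff)
  have G: "?G \<in> carrier (C (Suc 0))"
    by (rule prim_C1[OF F2])
  have D_E: "d (Suc 0) ?G [h, E q] p = F [h, E q] p" if h: "h \<in> D" and q: "q \<in> off" and p: "p \<in> r" for h q p
  proof (rule d1_prim[OF F of_weight_D[OF h] of_weight_E[OF q] p])
    assume "\<And>h. h \<in> D \<Longrightarrow> wt p h = 0 + wt q h"
    then have "p = q"
      using weight_2[of "fst q" "snd q" "fst p" "snd p"] p q by (auto simp: prod_eq_iff)
    then show "F [h, E q] p = 0"
      using DE h q by simp
  qed
  have dG2: "d (Suc 0) ?G \<in> carrier (C 2)"
    by (rule d1_in_C2[OF G])
  have "F = d (Suc 0) ?G"
  proof (rule C2_eq_on_gens[OF F2 dG2])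
    fix x y p assume xy: "x \<in> gens" "y \<in> gens" and p: "p \<in> r"
    consider "x \<in> D" "y \<in> D" | q where "x \<in> D" "y = E q" "q \<in> off" | q where "y \<in> D" "x = E q" "q \<in> off"
      | q q' where "x = E q" "y = E q'" "q \<in> off" "q' \<in> off"
      using xy by (auto simp: gens_def)
    then show "F [x, y] p = d (Suc 0) ?G [x, y] p"
    proof cases
      case 1
      show ?thesis
      proof (rule d1_prim[OF F of_weight_D[OF 1(1)] of_weight_D[OF 1(2)] p, symmetric])
        assume 0: "\<And>h. h \<in> D \<Longrightarrow> wt p h = 0 + 0"
        have "p \<notin> off"
          using weight_1[of "fst p" "snd p"] 0 by (metis add.right_neutral prod.collapse)
        then obtain i where "p = (i, i)"
          using p by (cases p) (auto simp: off_iff)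
        then show "F [x, y] p = 0"
          using DD 1 p by simp
      qed
    next
      case (2 q)
      then show ?thesis
        using D_E p by simp
    next
      case (3 q)
      then show ?thesis
        using D_E[OF 3(1) 3(3) p] C2_swap[OF F2 D_L[OF 3(1)] E_L[OF 3(3)] p]
          C2_swap[OF dG2 D_L[OF 3(1)] E_L[OF 3(3)] p] by simp
    next
      case (4 q q')
      have L: "E q \<in> carrier L" "E q' \<in> carrier L"
        using 4 by auto
      show ?thesis
        unfolding 4
      proof (rule d1_prim[OF F of_weight_E of_weight_E p, symmetric])
        assume eq: "\<And>h. h \<in> D \<Longrightarrow> wt p h = wt q h + wt q' h"
        obtain i j k l m n where ijk: "q = (i, j)" "q' = (k, l)" "p = (m, n)"
          by (cases q, cases q', cases p)
        show "F [E q, E q'] p = 0"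
        \<comment> \<open>Equal units would have to be compared with twice a root, which
          \<open>weight_3\<close> does not cover; there alternation applies.\<close>
        proof (cases "q = q'")
          case False
          then have "j = k \<and> m = i \<and> n = l \<or> i = l \<and> m = k \<and> n = j"
            using 4 p eq unfolding ijk by (intro weight_3) auto
          then show ?thesis
            using EE[of i j l] EE[of k l j] 4 C2_swap[OF F2 L(2,1) p] unfolding ijk by auto
        qed (use C2_simps[OF F2 L(1) p] in simp)
      qed (use 4 in auto)
    qed
  qed
  then show ?thesis
    using G by (auto simp: coboundaries_eq)
qed

end


subsection \<open>Cocycles with prescribed coefficients of weight zero\<close>

context poset_lie
begin

definition cochain2 where
  "cochain2 f = (\<lambda>xs\<in>tuples L 2. rest (f (xs ! 0) (xs ! 1)))"

lemma cochain2_eval: "x \<in> carrier L \<Longrightarrow> y \<in> carrier L \<Longrightarrow> cochain2 f [x, y] = rest (f x y)"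
  by (simp add: cochain2_def tuples_2)

lemma cochain2_cocycle:
  assumes closed: "\<And>x y. x \<in> carrier L \<Longrightarrow> y \<in> carrier L \<Longrightarrow> rest (f x y) \<in> carrier L"
    and restrict: "\<And>x y. rest (f (rest x) y) = rest (f x y)"
    and add: "\<And>x x' y. f (x + x') y = f x y + f x' y"
    and scale: "\<And>c x y. f (scale c x) y = scale c (f x y)"
    and alt: "\<And>x y. f y x = - f x y" "\<And>x. f x x = 0"
    and cyc: "\<And>x y w. x \<in> carrier L \<Longrightarrow> y \<in> carrier L \<Longrightarrow> w \<in> carrier L \<Longrightarrow>
      rest (br x (f y w) - br y (f x w) + br w (f x y) - f (br x y) w + f (br x w) y - f (br y w) x) = rest 0"
  shows "cochain2 f \<in> cocycles C d 2"
  unfolding cocycles_iff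
proof (intro conjI ballI)
  show "cochain2 f \<in> carrier (C 2)"
  proof (rule C2_I)
    show "cochain2 f [y, x] = rest (- cochain2 f [x, y])" if "x \<in> carrier L" "y \<in> carrier L" for x y
    proof -
      have "f y x = - f x y"
        by (rule alt)
      then show ?thesis
        using that by (simp add: cochain2_eval)
    qed
    show "cochain2 f \<in> extensional (tuples L 2)"
      by (simp add: cochain2_def)
  qed (simp_all add: cochain2_eval closed restrict add scale alt(2) L_closed)
  fix x y w p assume L: "x \<in> carrier L" "y \<in> carrier L" "w \<in> carrier L" and p: "p \<in> r"
  have "cyc (\<lambda>x y. cochain2 f [x, y]) x y w p =
      (br x (f y w) - br y (f x w) + br w (f x y) - f (br x y) w + f (br x w) y - f (br y w) x) p"
    using L p by (simp add: cyc_def cochain2_eval restrict)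
  also have "\<dots> = 0"
    using cyc[OF L] p unfolding rest_eq_iff by simp
  finally show "cyc (\<lambda>x y. cochain2 f [x, y]) x y w p = 0" .
qed

text \<open>The cup product of the trivial-coefficient cocycle \<open>x \<mapsto> x (b, b)\<close> with a derivation.\<close>

definition wedge where
  "wedge b \<Delta> x y = scale (x (b, b)) (\<Delta> y) - scale (y (b, b)) (\<Delta> x)"
  for \<Delta> :: "(nat \<times> nat \<Rightarrow> 'k) \<Rightarrow> nat \<times> nat \<Rightarrow> 'k"

text \<open>Commutators have zero diagonal, so \<open>x (b, b)\<close> is a 1-cocycle with trivial
  coefficients, and a derivation is a 1-cocycle with adjoint ones; their product is closed by the
  Leibniz rule.\<close>

lemma wedge_cocycle:
  assumes b: "b \<in> Field r"
    and closed: "\<And>x. x \<in> carrier L \<Longrightarrow> rest (\<Delta> x) \<in> carrier L"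
    and restrict: "\<And>x. rest (\<Delta> (rest x)) = rest (\<Delta> x)"
    and add: "\<And>x y. \<Delta> (x + y) = \<Delta> x + \<Delta> y" and scale: "\<And>c x. \<Delta> (scale c x) = scale c (\<Delta> x)"
    and deriv: "\<And>x y. x \<in> carrier L \<Longrightarrow> y \<in> carrier L \<Longrightarrow> rest (\<Delta> (br x y)) = rest (br (\<Delta> x) y + br x (\<Delta> y))"
  shows "cochain2 (wedge b \<Delta>) \<in> cocycles C d 2"
proof (rule cochain2_cocycle)
  have bb: "(b, b) \<in> r"
    using b by (rule r_diag)
  show "rest (wedge b \<Delta> x y) \<in> carrier L" if "x \<in> carrier L" "y \<in> carrier L" for x y
    using that L_closed(3)[OF L_closed(4)[OF closed] L_closed(4)[OF closed], of y x "x (b, b)" "y (b, b)"]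
    by (simp add: wedge_def)
  show "rest (wedge b \<Delta> (rest x) y) = rest (wedge b \<Delta> x y)" for x y
    using restrict[of x] bb by (simp add: wedge_def rest_eq_iff scale_def)
  show "wedge b \<Delta> (x + x') y = wedge b \<Delta> x y + wedge b \<Delta> x' y" for x x' y
    by (simp add: wedge_def add scale_linear)
  show "wedge b \<Delta> (scale c x) y = scale c (wedge b \<Delta> x y)" for c x y
    by (simp add: wedge_def scale fun_eq_iff) (simp add: scale_def algebra_simps)
  show "wedge b \<Delta> y x = - wedge b \<Delta> x y" "wedge b \<Delta> x x = 0" for x y
    by (simp_all add: wedge_def)
  fix x y w assume L: "x \<in> carrier L" "y \<in> carrier L" "w \<in> carrier L"
  have D: "\<Delta> (br x y) p = br x (\<Delta> y) p - br y (\<Delta> x) p"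
    if "x \<in> carrier L" "y \<in> carrier L" "p \<in> r" for x y p
    using deriv[OF that(1,2)] that(3) unfolding rest_eq_iff
    by (simp add: commutator_swap[of r "\<Delta> x" y])
  show "rest (br x (wedge b \<Delta> y w) - br y (wedge b \<Delta> x w) + br w (wedge b \<Delta> x y)
    - wedge b \<Delta> (br x y) w + wedge b \<Delta> (br x w) y - wedge b \<Delta> (br y w) x) = rest 0"
    by (simp add: wedge_def rest_eq_iff commutator_linear scale_linear br_diag[OF bb])
      (simp add: D[OF L(1,2)] D[OF L(1,3)] D[OF L(2,3)] scale_def algebra_simps)
qed

text \<open>Commuting with diagonal elements annihilates every off-diagonal entry, since by
  \<open>weight_1\<close> some diagonal element has nonzero weight there.\<close>

lemma center_iff:
  assumes "z \<in> carrier (lie_center L)"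
  shows "z \<in> D" "x \<in> carrier L \<Longrightarrow> rest (br z x) = rest 0"
proof -
  have z: "z \<in> carrier L" and br: "rest (br z x) = rest 0" if "x \<in> carrier L" for x
    using assms that by (auto simp: lie_center_def bracket_L L_ops)
  have zL: "z \<in> carrier L"
    using assms by (auto simp: lie_center_def)
  have "z (i, j) = 0" if ij: "(i, j) \<in> off" for i j
  proof -
    obtain h where h: "h \<in> D" "wt (i, j) h \<noteq> 0"
      using weight_1[OF ij] .
    have "br z h (i, j) = 0"
      using br[OF D_L[OF h(1)]] ij unfolding rest_eq_iff by (auto simp: off_iff)
    then have "br h z (i, j) = 0"
      by (simp add: commutator_swap[of r h z])
    then show ?thesis
      using h ij by (simp add: br_D off_diag)
  qed
  then show "z \<in> D"
    using zL by (simp add: D_iff)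
  show "x \<in> carrier L \<Longrightarrow> rest (br z x) = rest 0"
    by (rule br)
qed

text \<open>The map from y to \<open>y (b, b)\<close> times z is a derivation: it vanishes on
  brackets, and its values are central.\<close>

lemma center_cocycle:
  assumes "a \<in> Field r" "b \<in> Field r" and z: "z \<in> carrier (lie_center L)"
  shows "cochain2 (wedge a (\<lambda>y. scale (y (b, b)) z)) \<in> cocycles C d 2"
proof (rule wedge_cocycle)
  have bb: "(b, b) \<in> r"
    using assms by (simp add: r_diag)
  note z = D_L[OF center_iff(1)[OF z]] center_iff(2)[OF z]
  show "rest (scale (x (b, b)) z) \<in> carrier L" for x :: "nat \<times> nat \<Rightarrow> 'k"
    using z by (simp add: L_closed)
  show "rest (scale (br x y (b, b)) z) = rest (br (scale (x (b, b)) z) y + br x (scale (y (b, b)) z))"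
    if "x \<in> carrier L" "y \<in> carrier L" for x y
    using z(2)[OF that(1)] z(2)[OF that(2)] bb
    by (simp add: rest_eq_iff br_diag scale_def commutator_linear commutator_swap[of r x z])
qed (use assms in \<open>auto simp: r_diag fun_eq_iff scale_def algebra_simps restrict_def\<close>)

definition deriv :: "(nat \<Rightarrow> nat \<Rightarrow> 'k) \<Rightarrow> (nat \<times> nat \<Rightarrow> 'k) \<Rightarrow> nat \<times> nat \<Rightarrow> 'k"
  where "deriv u x = (\<lambda>(i, j). (if i = j then 0 else u i j) * x (i, j))"

text \<open>Multiplying the unit at (i, j) by \<open>u i j\<close> satisfies the Leibniz rule on
  composable units exactly when \<open>u\<close> is additive along chains.\<close>

lemma deriv_cocycle:
  assumes b: "b \<in> Field r"
    and u: "\<And>i j k. (i, j) \<in> off \<Longrightarrow> (j, k) \<in> off \<Longrightarrow> u i k = u i j + u j k"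
  shows "cochain2 (wedge b (deriv u)) \<in> cocycles C d 2"
proof (rule wedge_cocycle[OF b])
  show "rest (deriv u x) \<in> carrier L" for x
    by (simp add: rest_in_L deriv_def)
  show "rest (deriv u (rest x)) = rest (deriv u x)" for x
    by (auto simp: rest_eq_iff deriv_def)
  show "deriv u (x + y) = deriv u x + deriv u y" "deriv u (scale c x) = scale c (deriv u x)" for c x y
    by (auto simp: deriv_def fun_eq_iff scale_def algebra_simps)
  have mm: "deriv u (mm x y) p = mm (deriv u x) y p + mm x (deriv u y) p" if p: "p \<in> r" for x y p
  proof -
    obtain i k where ik: "p = (i, k)" by (cases p)
    let ?U = "\<lambda>i j. if i = j then 0 else u i j"
    \<comment> \<open>With zeros on the diagonal, additivity extends to chains with repeated
      elements; antisymmetry rules out i = k with j different.\<close>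
    have U: "?U i k = ?U i j + ?U j k" if "(i, j) \<in> r" "(j, k) \<in> r" for j
      using u[of i j k] that r_antisym by (auto simp: off_iff)
    have "deriv u (mm x y) p = (\<Sum>j\<in>Field r. ?U i k * (cut r x (i, j) * cut r y (j, k)))"
      by (simp add: deriv_def ik mat_mult_def sum_distrib_left)
    also have "\<dots> = (\<Sum>j\<in>Field r. cut r (deriv u x) (i, j) * cut r y (j, k) + cut r x (i, j) * cut r (deriv u y) (j, k))"
    proof (rule sum.cong)
      show "?U i k * (cut r x (i, j) * cut r y (j, k)) =
          cut r (deriv u x) (i, j) * cut r y (j, k) + cut r x (i, j) * cut r (deriv u y) (j, k)" for j
      proof (cases "(i, j) \<in> r \<and> (j, k) \<in> r")
        case True
        then show ?thesis
          unfolding U[OF conjunct1[OF True] conjunct2[OF True]]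
          by (simp add: cut_def deriv_def algebra_simps)
      qed (auto simp: cut_def)
    qed simp
    also have "\<dots> = mm (deriv u x) y p + mm x (deriv u y) p"
      by (simp add: mat_mult_def ik sum.distrib)
    finally show ?thesis .
  qed
  have "deriv u (x - y) = deriv u x - deriv u y" for x y
    by (auto simp: deriv_def fun_eq_iff algebra_simps)
  then show "rest (deriv u (br x y)) = rest (br (deriv u x) y + br x (deriv u y))"
    if "x \<in> carrier L" "y \<in> carrier L" for x y
    by (simp add: rest_eq_iff commutator_def mm)
qed

text \<open>The normalised extension: zero on chains with a repetition, which makes the Hochschild
  cochain below vanish on diagonal elements.\<close>

definition ext2 :: "(nat \<Rightarrow> nat \<Rightarrow> nat \<Rightarrow> 'k) \<Rightarrow> nat \<Rightarrow> nat \<Rightarrow> nat \<Rightarrow> 'k"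
  where "ext2 v i j k = (if i \<noteq> j \<and> j \<noteq> k then v i j k else 0)"

text \<open>The Hochschild 2-cochain that sends a composable pair of units to their product,
  weighted by the value of \<open>v\<close> on the chain.\<close>

definition hoch :: "(nat \<Rightarrow> nat \<Rightarrow> nat \<Rightarrow> 'k) \<Rightarrow> (nat \<times> nat \<Rightarrow> 'k) \<Rightarrow> (nat \<times> nat \<Rightarrow> 'k) \<Rightarrow> nat \<times> nat \<Rightarrow> 'k"
  where "hoch v x y p = (\<Sum>j\<in>Field r. ext2 v (fst p) j (snd p) * (cut r x (fst p, j) * cut r y (j, snd p)))"

lemma hoch_linear:
  "hoch v (x + x') y = hoch v x y + hoch v x' y" "hoch v x (y + y') = hoch v x y + hoch v x y'"
  "hoch v (x - x') y = hoch v x y - hoch v x' y" "hoch v x (y - y') = hoch v x y - hoch v x y'"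
  "hoch v (scale c x) y = scale c (hoch v x y)" "hoch v x (scale c y) = scale c (hoch v x y)"
proof -
  have c: "cut r (u + v) = cut r u + cut r v" "cut r (u - v) = cut r u - cut r v"
    "cut r (scale c u) = scale c (cut r u)" for u v :: "nat \<times> nat \<Rightarrow> 'k"
    by (auto simp: cut_def scale_def fun_eq_iff)
  show "hoch v (x + x') y = hoch v x y + hoch v x' y" "hoch v x (y + y') = hoch v x y + hoch v x y'"
    "hoch v (x - x') y = hoch v x y - hoch v x' y" "hoch v x (y - y') = hoch v x y - hoch v x y'"
    "hoch v (scale c x) y = scale c (hoch v x y)" "hoch v x (scale c y) = scale c (hoch v x y)"
    by (auto simp: hoch_def fun_eq_iff c algebra_simps sum.distrib sum_subtractf scale_def
        sum_distrib_left intro!: sum.cong)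
qed

lemma cut_hoch: "cut r (hoch v x y) = hoch v x y"
proof (rule ext)
  fix p
  have "cut r x (fst p, j) * cut r y (j, snd p) = 0" if "p \<notin> r" for j
    using that r_trans[of "fst p" j "snd p"] by (auto simp: cut_def)
  then show "cut r (hoch v x y) p = hoch v x y p"
    by (auto simp: cut_def[of _ "hoch v x y"] hoch_def)
qed

text \<open>All four expressions are sums over paths from i through j and k to l; the coefficients
  of each path satisfy the simplicial cocycle identity.\<close>

lemma hochschild:
  assumes v: "\<And>i j k l. (i, j) \<in> off \<Longrightarrow> (j, k) \<in> off \<Longrightarrow> (k, l) \<in> off \<Longrightarrow> v j k l - v i k l + v i j l - v i j k = 0"
  shows "mm x (hoch v y w) = hoch v (mm x y) w - hoch v x (mm y w) + mm (hoch v x y) w"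
proof (rule ext)
  fix p :: "nat \<times> nat"
  obtain i l where il: "p = (i, l)" by (cases p)
  define m where "m j k = cut r x (i, j) * cut r y (j, k) * cut r w (k, l)" for j k
  let ?V = "ext2 v"
  have 1: "mm x (hoch v y w) p = (\<Sum>j\<in>Field r. \<Sum>k\<in>Field r. ?V j k l * m j k)"
    unfolding mat_mult_def[of _ x] cut_hoch
    by (simp add: hoch_def il sum_distrib_left m_def ac_simps)
  have 2: "hoch v (mm x y) w p = (\<Sum>j\<in>Field r. \<Sum>k\<in>Field r. ?V i k l * m j k)"
    unfolding hoch_def[of _ "mm x y"] cut_mm
    by (subst sum.swap) (simp add: mat_mult_def il sum_distrib_left sum_distrib_right m_def ac_simps)
  have 3: "hoch v x (mm y w) p = (\<Sum>j\<in>Field r. \<Sum>k\<in>Field r. ?V i j l * m j k)"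
    unfolding hoch_def[of _ x] cut_mm
    by (simp add: mat_mult_def il sum_distrib_left sum_distrib_right m_def ac_simps)
  have 4: "mm (hoch v x y) w p = (\<Sum>j\<in>Field r. \<Sum>k\<in>Field r. ?V i j k * m j k)"
    unfolding mat_mult_def[of _ "hoch v x y"] cut_hoch
    by (subst sum.swap) (simp add: hoch_def il sum_distrib_left sum_distrib_right m_def ac_simps)
  have "?V j k l * m j k = ?V i k l * m j k - ?V i j l * m j k + ?V i j k * m j k" for j k
  proof (cases "(i, j) \<in> r \<and> (j, k) \<in> r \<and> (k, l) \<in> r")
    case True
    \<comment> \<open>With a repetition in the path the remaining terms cancel in pairs. Otherwise
      antisymmetry gives that i, k and j, l differ, and \<open>ext2\<close> agrees with
      \<open>v\<close> on all four faces.\<close>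
    have eq: "?V j k l = ?V i k l - ?V i j l + ?V i j k"
    proof (cases "i = j \<or> j = k \<or> k = l")
      case False
      then have "(i, j) \<in> off" "(j, k) \<in> off" "(k, l) \<in> off"
        using True by (auto simp: off_iff)
      moreover from this have "i \<noteq> k" "j \<noteq> l"
        using off_trans[of i j k] off_trans[of j k l] by (auto simp: off_iff)
      ultimately show ?thesis
        using v[of i j k l] False by (simp add: ext2_def algebra_simps)
    qed (auto simp: ext2_def)
    show ?thesis
      unfolding eq by (simp add: algebra_simps)
  qed (auto simp: m_def cut_def)
  then show "mm x (hoch v y w) p = (hoch v (mm x y) w - hoch v x (mm y w) + mm (hoch v x y) w) p"
    by (simp add: 1 2 3 4 sum.distrib sum_subtractf)
qed

lemma hoch_diag: "hoch v x y (i, i) = 0"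
proof -
  have "ext2 v i j i * (cut r x (i, j) * cut r y (j, i)) = 0" for j
    using r_antisym by (auto simp: ext2_def cut_def)
  then show ?thesis
    by (simp add: hoch_def)
qed

text \<open>Antisymmetrising a Hochschild 2-cocycle of an associative algebra gives a Lie 2-cocycle
  for the commutator. The values are traceless because \<open>hoch\<close> has zero
  diagonal.\<close>

lemma hoch_cocycle:
  assumes "\<And>i j k l. (i, j) \<in> off \<Longrightarrow> (j, k) \<in> off \<Longrightarrow> (k, l) \<in> off \<Longrightarrow> v j k l - v i k l + v i j l - v i j k = 0"
  shows "cochain2 (\<lambda>x y. hoch v x y - hoch v y x) \<in> cocycles C d 2"
proof (rule cochain2_cocycle)
  note hs = hochschild[OF assms]
  have res: "hoch v (rest x) y = hoch v x y" "hoch v x (rest y) = hoch v x y" for x y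
    by (auto simp: hoch_def fun_eq_iff)
  show "rest (hoch v (rest x) y - hoch v y (rest x)) = rest (hoch v x y - hoch v y x)" for x y
    by (simp add: res)
  show "rest (hoch v x y - hoch v y x) \<in> carrier L" for x y
    by (simp add: rest_in_L hoch_diag)
  show "rest (br x (hoch v y w - hoch v w y) - br y (hoch v x w - hoch v w x) + br w (hoch v x y - hoch v y x)
    - (hoch v (br x y) w - hoch v w (br x y)) + (hoch v (br x w) y - hoch v y (br x w))
    - (hoch v (br y w) x - hoch v x (br y w))) = rest 0" for x y w
    by (rule arg_cong[of _ _ rest]) (simp add: commutator_def mat_mult_linear hoch_linear hs algebra_simps)
qed (auto simp: hoch_linear scale_linear)

lemma sum_cocycles:
  assumes "finite A" "\<And>a. a \<in> A \<Longrightarrow> F a \<in> cocycles C d 2"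
  shows "\<exists>G\<in>cocycles C d 2. \<forall>x\<in>carrier L. \<forall>y\<in>carrier L. \<forall>p\<in>r. G [x, y] p = (\<Sum>a\<in>A. F a [x, y] p)"
  using assms
proof (induction A)
  case empty
  interpret S: LinearCombinations.submodule class_ring "cocycles C d 2" "C 2"
    by (rule submodule_cocycles)
  show ?case
    by (rule bexI[of _ "\<zero>\<^bsub>C 2\<^esub>"]) (simp_all add: C2_zero)
next
  case (insert a A)
  interpret S: LinearCombinations.submodule class_ring "cocycles C d 2" "C 2"
    by (rule submodule_cocycles)
  from insert obtain G where G: "G \<in> cocycles C d 2"
    "\<And>x y p. x \<in> carrier L \<Longrightarrow> y \<in> carrier L \<Longrightarrow> p \<in> r \<Longrightarrow> G [x, y] p = (\<Sum>a\<in>A. F a [x, y] p)"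
    by auto
  have "F a \<in> carrier (C 2)" "G \<in> carrier (C 2)" "F a \<oplus>\<^bsub>C 2\<^esub> G \<in> cocycles C d 2"
    using insert.prems G S.subset by auto
  then show ?case
    using insert.hyps G(2) by (intro bexI[of _ "F a \<oplus>\<^bsub>C 2\<^esub> G"]) (simp_all add: C2_add)
qed

text \<open>The three summands do not interfere. The first has diagonal values; the derivations kill
  diagonal arguments, while units have no diagonal for the functionals to see; the Hochschild part
  vanishes once an argument is diagonal.\<close>

lemma cocycle_exists:
  assumes B: "finite B" "B \<subseteq> Field r" and P: "finite P" "P \<subseteq> B \<times> B"
    and z: "\<And>q. q \<in> P \<Longrightarrow> z q \<in> carrier (lie_center L)"
    and u: "\<And>b i j k. b \<in> B \<Longrightarrow> (i, j) \<in> off \<Longrightarrow> (j, k) \<in> off \<Longrightarrow> u b i k = u b i j + u b j k"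
    and v: "\<And>i j k l. (i, j) \<in> off \<Longrightarrow> (j, k) \<in> off \<Longrightarrow> (k, l) \<in> off \<Longrightarrow> v j k l - v i k l + v i j l - v i j k = 0"
  obtains F where "F \<in> cocycles C d 2"
    "\<And>h h' i. h \<in> D \<Longrightarrow> h' \<in> D \<Longrightarrow> (i, i) \<in> r \<Longrightarrow>
      F [h, h'] (i, i) = (\<Sum>(a, b)\<in>P. (h (a, a) * h' (b, b) - h' (a, a) * h (b, b)) * z (a, b) (i, i))"
    "\<And>h i j. h \<in> D \<Longrightarrow> (i, j) \<in> off \<Longrightarrow> F [h, E (i, j)] (i, j) = (\<Sum>b\<in>B. h (b, b) * u b i j)"
    "\<And>i j k. (i, j) \<in> off \<Longrightarrow> (j, k) \<in> off \<Longrightarrow> F [E (i, j), E (j, k)] (i, k) = v i j k"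
proof -
  define f1 where "f1 q = wedge (fst q) (\<lambda>y. scale (y (snd q, snd q)) (z q))" for q
  define f2 where "f2 b = wedge b (deriv (u b))" for b
  define f3 where "f3 x y = hoch v x y - hoch v y x" for x y
  have PB: "fst q \<in> Field r" "snd q \<in> Field r" if "q \<in> P" for q
  proof -
    have "q \<in> B \<times> B"
      using that P by blast
    then show "fst q \<in> Field r" "snd q \<in> Field r"
      using B(2) by auto
  qed
  obtain F1 where F1: "F1 \<in> cocycles C d 2"
    "\<And>x y p. x \<in> carrier L \<Longrightarrow> y \<in> carrier L \<Longrightarrow> p \<in> r \<Longrightarrow> F1 [x, y] p = (\<Sum>q\<in>P. cochain2 (f1 q) [x, y] p)"
    using sum_cocycles[OF P(1), of "\<lambda>q. cochain2 (f1 q)"] center_cocycle[OF PB z] unfolding f1_def by auto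
  obtain F2 where F2: "F2 \<in> cocycles C d 2"
    "\<And>x y p. x \<in> carrier L \<Longrightarrow> y \<in> carrier L \<Longrightarrow> p \<in> r \<Longrightarrow> F2 [x, y] p = (\<Sum>b\<in>B. cochain2 (f2 b) [x, y] p)"
    using sum_cocycles[OF B(1), of "\<lambda>b. cochain2 (f2 b)"] deriv_cocycle[of _ "u _"] B(2) u unfolding f2_def
    by (auto simp: subset_iff)
  have F3: "cochain2 f3 \<in> cocycles C d 2"
    unfolding f3_def[abs_def] by (rule hoch_cocycle[OF v])
  interpret S: LinearCombinations.submodule class_ring "cocycles C d 2" "C 2"
    by (rule submodule_cocycles)
  define F where "F = F1 \<oplus>\<^bsub>C 2\<^esub> F2 \<oplus>\<^bsub>C 2\<^esub> cochain2 f3"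
  have Z: "F \<in> cocycles C d 2"
    unfolding F_def using F1(1) F2(1) F3 by auto
  have F: "F [x, y] p = (\<Sum>q\<in>P. f1 q x y p) + (\<Sum>b\<in>B. f2 b x y p) + f3 x y p"
    if "x \<in> carrier L" "y \<in> carrier L" "p \<in> r" for x y p
  proof -
    have "F1 \<in> carrier (C 2)" "F2 \<in> carrier (C 2)" "F1 \<oplus>\<^bsub>C 2\<^esub> F2 \<in> carrier (C 2)" "cochain2 f3 \<in> carrier (C 2)"
      using F1(1) F2(1) F3 S.subset S.m_closed by blast+
    then show ?thesis
      using that unfolding F_def by (simp add: C2_add F1(2) F2(2) cochain2_eval)
  qed
  have zD: "z q (i, j) = 0" if "q \<in> P" "(i, j) \<in> off" for q i j
    using center_iff(1)[OF z[OF that(1)]] that(2) by (simp add: D_iff)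
  have Ebb: "E q (b, b) = 0" if "q \<in> off" "b \<in> Field r" for q b
    using that by (cases q) (auto simp: E_eval r_diag off_iff)
  \<comment> \<open>A diagonal factor leaves only paths with a repetition, on which
    \<open>ext2\<close> is zero.\<close>
  have hoch0: "cut r x (i, k) * cut r h (k, j) * ext2 v i k j = 0" "cut r h (i, k) * cut r x (k, j) * ext2 v i k j = 0"
    if "h \<in> D" for h x i j k
    using that by (auto simp: cut_def ext2_def D_iff off_iff)
  show ?thesis
  proof (rule that[OF Z])
    show "F [h, h'] (i, i) = (\<Sum>(a, b)\<in>P. (h (a, a) * h' (b, b) - h' (a, a) * h (b, b)) * z (a, b) (i, i))"
      if "h \<in> D" "h' \<in> D" "(i, i) \<in> r" for h h' i
    proof -
      have "f1 q h h' (i, i) = (case q of (a, b) \<Rightarrow> (h (a, a) * h' (b, b) - h' (a, a) * h (b, b)) * z (a, b) (i, i))" for q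
        by (cases q) (simp add: f1_def wedge_def scale_def algebra_simps)
      moreover have "f2 b h h' (i, i) = 0" for b
        by (simp add: f2_def wedge_def scale_def deriv_def)
      moreover have "f3 h h' (i, i) = 0"
        by (simp add: f3_def hoch_diag)
      ultimately show ?thesis
        using that by (simp add: F D_L)
    qed
    show "F [h, E (i, j)] (i, j) = (\<Sum>b\<in>B. h (b, b) * u b i j)" if h: "h \<in> D" and ij: "(i, j) \<in> off" for h i j
    proof -
      have "f1 q h (E (i, j)) (i, j) = 0" if "q \<in> P" for q
        using zD[OF that ij] by (simp add: f1_def wedge_def scale_def)
      moreover have "f2 b h (E (i, j)) (i, j) = h (b, b) * u b i j" if "b \<in> B" for b
        using ij that B(2) Ebb[OF ij, of b] by (auto simp: f2_def wedge_def scale_def deriv_def E_eval off_iff)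
      moreover have "f3 h (E (i, j)) (i, j) = 0"
        using hoch0[OF h] by (simp add: f3_def hoch_def mult.commute[of "ext2 v _ _ _"])
      ultimately show ?thesis
        using h ij by (simp add: F D_L off_diag)
    qed
    show "F [E (i, j), E (j, k)] (i, k) = v i j k" if ij: "(i, j) \<in> off" and jk: "(j, k) \<in> off" for i j k
    proof -
      have ik: "(i, k) \<in> off"
        using ij jk by (rule off_trans)
      have "f1 q (E (i, j)) (E (j, k)) (i, k) = 0" if "q \<in> P" for q
        using zD[OF that ik] by (simp add: f1_def wedge_def scale_def)
      moreover have "f2 b (E (i, j)) (E (j, k)) (i, k) = 0" if "b \<in> B" for b
        using that B(2) Ebb[OF ij, of b] Ebb[OF jk, of b] by (auto simp: f2_def wedge_def scale_def)
      moreover have "hoch v (E (i, j)) (E (j, k)) (i, k) = v i j k"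
      proof -
        have "hoch v (E (i, j)) (E (j, k)) (i, k) = (\<Sum>m\<in>Field r. if m = j then v i j k else 0)"
          unfolding hoch_def using ij jk
          by (intro sum.cong) (auto simp: cut_def E_eval ext2_def off_iff)
        then show ?thesis
          using in_Field ij by (auto simp: off_iff Field_r)
      qed
      moreover have "hoch v (E (j, k)) (E (i, j)) (i, k) = 0"
        unfolding hoch_def using ij jk by (intro sum.neutral) (auto simp: cut_def E_eval off_iff)
      ultimately show ?thesis
        using ij jk ik by (simp add: F off_diag f3_def)
    qed
  qed
qed

end


subsection \<open>Cochains of the nerve\<close>

lemma delete_nth_simps:
  "delete_nth 0 (x # xs) = xs" "delete_nth (Suc i) (x # xs) = x # delete_nth i xs"
  by (simp_all add: delete_nth_def)

section \<open>The nerve in low degrees, and coordinates on the dual of the diagonal\<close>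

context poset_lie
begin

abbreviation S where "S \<equiv> nerve_simplices r"
abbreviation K :: "nat \<Rightarrow> ('k, nat list \<Rightarrow> 'k) module" where "K \<equiv> nerve_cochains r"
abbreviation dn :: "nat \<Rightarrow> (nat list \<Rightarrow> 'k) \<Rightarrow> nat list \<Rightarrow> 'k" where "dn \<equiv> nerve_differential r"

lemma S_0: "S 0 = {[i] | i. i \<in> Field r}"
  by (auto simp: nerve_simplices_def length_Suc_conv)

lemma S_1: "S (Suc 0) = {[i, j] | i j. (i, j) \<in> off}"
  by (auto simp: nerve_simplices_def length_Suc_conv off_iff Field_def)

text \<open>Sortedness asks for all pairs to be comparable in order; consecutive ones suffice
  because the strict order is transitive.\<close>

lemma S_2: "S (Suc (Suc 0)) = {[i, j, k] | i j k. (i, j) \<in> off \<and> (j, k) \<in> off}"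
proof -
  have "s \<in> S (Suc (Suc 0)) \<longleftrightarrow> (\<exists>i j k. s = [i, j, k] \<and> (i, j) \<in> off \<and> (j, k) \<in> off)" for s
  proof
    assume "s \<in> S (Suc (Suc 0))"
    then show "\<exists>i j k. s = [i, j, k] \<and> (i, j) \<in> off \<and> (j, k) \<in> off"
      by (auto simp: nerve_simplices_def length_Suc_conv off_iff)
  next
    assume "\<exists>i j k. s = [i, j, k] \<and> (i, j) \<in> off \<and> (j, k) \<in> off"
    then obtain i j k where s: "s = [i, j, k]" and o: "(i, j) \<in> off" "(j, k) \<in> off"
      by blast
    have "(i, k) \<in> off"
      using off_trans o by blast
    then show "s \<in> S (Suc (Suc 0))"
      using s o in_Field by (auto simp: nerve_simplices_def off_iff)
  qed
  then show ?thesis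
    by blast
qed

lemma S_3: "S (Suc (Suc (Suc 0))) =
    {[i, j, k, l] | i j k l. (i, j) \<in> off \<and> (j, k) \<in> off \<and> (k, l) \<in> off}"
proof -
  have "s \<in> S (Suc (Suc (Suc 0))) \<longleftrightarrow>
      (\<exists>i j k l. s = [i, j, k, l] \<and> (i, j) \<in> off \<and> (j, k) \<in> off \<and> (k, l) \<in> off)" for s
  proof
    assume "s \<in> S (Suc (Suc (Suc 0)))"
    then show "\<exists>i j k l. s = [i, j, k, l] \<and> (i, j) \<in> off \<and> (j, k) \<in> off \<and> (k, l) \<in> off"
      by (auto simp: nerve_simplices_def length_Suc_conv off_iff)
  next
    assume "\<exists>i j k l. s = [i, j, k, l] \<and> (i, j) \<in> off \<and> (j, k) \<in> off \<and> (k, l) \<in> off"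
    then obtain i j k l where s: "s = [i, j, k, l]" and o: "(i, j) \<in> off" "(j, k) \<in> off" "(k, l) \<in> off"
      by blast
    have "(i, k) \<in> off" "(j, l) \<in> off"
      using off_trans o by blast+
    moreover from this have "(i, l) \<in> off"
      using off_trans o by blast
    ultimately show "s \<in> S (Suc (Suc (Suc 0)))"
      using s o in_Field by (auto simp: nerve_simplices_def off_iff)
  qed
  then show ?thesis
    by blast
qed

lemma K_simps:
  "carrier (K n) = S n \<rightarrow>\<^sub>E UNIV"
  "\<zero>\<^bsub>K n\<^esub> = (\<lambda>s\<in>S n. 0)"
  "f \<oplus>\<^bsub>K n\<^esub> g = (\<lambda>s\<in>S n. f s + g s)"
  "c \<odot>\<^bsub>K n\<^esub> f = (\<lambda>s\<in>S n. c * f s)"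
  by (simp_all add: nerve_cochains_def class_ring.func_space_def)

lemma module_K: "module class_ring (K n)"
  unfolding nerve_cochains_def using class_cring.func_space_is_module by blast

lemma dn_0: "(i, j) \<in> off \<Longrightarrow> dn 0 w [i, j] = w [j] - w [i]"
  by (simp add: nerve_differential_def S_1 delete_nth_simps)

lemma dn_1: "(i, j) \<in> off \<Longrightarrow> (j, k) \<in> off \<Longrightarrow> dn (Suc 0) u [i, j, k] = u [j, k] - u [i, k] + u [i, j]"
  by (simp add: nerve_differential_def S_2 delete_nth_simps)

lemma dn_2: "(i, j) \<in> off \<Longrightarrow> (j, k) \<in> off \<Longrightarrow> (k, l) \<in> off \<Longrightarrow>
    dn (Suc (Suc 0)) v [i, j, k, l] = v [j, k, l] - v [i, k, l] + v [i, j, l] - v [i, j, k]"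
  by (simp add: nerve_differential_def S_3 delete_nth_simps)

lemma dn_closed: "dn n w \<in> carrier (K (Suc n))"
  by (simp add: nerve_differential_def K_simps)

lemma delete_nth_S:
  assumes "s \<in> S (Suc n)" "i \<le> Suc n"
  shows "delete_nth i s \<in> S n"
proof -
  have s: "length s = Suc (Suc n)" "set s \<subseteq> Field r" "sorted_wrt (\<lambda>i j. (i, j) \<in> r \<and> i \<noteq> j) s"
    using assms by (auto simp: nerve_simplices_def)
  have "s = take i s @ s ! i # drop (Suc i) s"
    using s(1) assms(2) by (simp add: id_take_nth_drop)
  then have "sorted_wrt (\<lambda>i j. (i, j) \<in> r \<and> i \<noteq> j) (take i s @ s ! i # drop (Suc i) s)"
    using s(3) by simp
  then have "sorted_wrt (\<lambda>i j. (i, j) \<in> r \<and> i \<noteq> j) (delete_nth i s)"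
    by (auto simp: delete_nth_def sorted_wrt_append)
  then show ?thesis
    using s assms(2) set_take_subset[of i s] set_drop_subset[of "Suc i" s]
    by (auto simp: nerve_simplices_def delete_nth_def)
qed

lemma dn_linear:
  "dn n (f \<oplus>\<^bsub>K n\<^esub> g) = dn n f \<oplus>\<^bsub>K (Suc n)\<^esub> dn n g"
  "dn n (c \<odot>\<^bsub>K n\<^esub> f) = c \<odot>\<^bsub>K (Suc n)\<^esub> dn n f"
  "dn n \<zero>\<^bsub>K n\<^esub> = \<zero>\<^bsub>K (Suc n)\<^esub>"
  by (auto simp: nerve_differential_def K_simps delete_nth_S distrib_left sum.distrib sum_distrib_left
      right_diff_distrib ac_simps simp del: sum.atMost_Suc intro!: restrict_ext sum.cong)

text \<open>That the square of the differential is zero enters as a hypothesis, to be verified on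
  explicit chains in the two degrees that occur.\<close>

lemma quotient_nerve:
  assumes dd: "\<And>w. dn (Suc n) (dn n w) = \<zero>\<^bsub>K (Suc (Suc n))\<^esub>"
  shows "quotient_module ((K (Suc n))\<lparr>carrier := cocycles K dn (Suc n)\<rparr>) (coboundaries K dn (Suc n))"
proof (rule quotient_module.intro)
  interpret M: Module.module class_ring "K (Suc n)" by (rule module_K)
  interpret M': Module.module class_ring "K (Suc (Suc n))" by (rule module_K)
  interpret M0: Module.module class_ring "K n" by (rule module_K)
  have "submodule class_ring (cocycles K dn (Suc n)) (K (Suc n))"
    by (rule submodule_class_ringI[OF module_K])
      (auto simp: cocycles_def dn_linear module_class_ring_simps[OF module_K])
  then show Z: "module class_ring ((K (Suc n))\<lparr>carrier := cocycles K dn (Suc n)\<rparr>)"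
    by (rule M.submodule_is_module)
  show "submodule class_ring (coboundaries K dn (Suc n)) ((K (Suc n))\<lparr>carrier := cocycles K dn (Suc n)\<rparr>)"
  proof (rule submodule_class_ringI[OF Z])
    show "coboundaries K dn (Suc n) \<subseteq> carrier ((K (Suc n))\<lparr>carrier := cocycles K dn (Suc n)\<rparr>)"
      by (auto simp: coboundaries_def cocycles_def dd dn_closed)
  qed (auto simp: coboundaries_def simp flip: dn_linear intro!: imageI)
qed

lemma dn_dn_0: "dn (Suc 0) (dn 0 w) = \<zero>\<^bsub>K (Suc (Suc 0))\<^esub>"
proof -
  have "dn (Suc 0) (dn 0 w) s = 0" if s: "s \<in> S (Suc (Suc 0))" for s
  proof -
    obtain i j k where s: "s = [i, j, k]" and o: "(i, j) \<in> off" "(j, k) \<in> off"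
      using s unfolding S_2 by blast
    have "(i, k) \<in> off"
      using off_trans o by blast
    then show ?thesis
      using o by (simp add: s dn_1 dn_0)
  qed
  then show ?thesis
    unfolding K_simps by (intro extensionalityI[of _ "S (Suc (Suc 0))"]) (auto simp: nerve_differential_def)
qed

lemma dn_dn_1: "dn (Suc (Suc 0)) (dn (Suc 0) w) = \<zero>\<^bsub>K (Suc (Suc (Suc 0)))\<^esub>"
proof -
  have "dn (Suc (Suc 0)) (dn (Suc 0) w) s = 0" if s: "s \<in> S (Suc (Suc (Suc 0)))" for s
  proof -
    obtain i j k l where s: "s = [i, j, k, l]" and o: "(i, j) \<in> off" "(j, k) \<in> off" "(k, l) \<in> off"
      using s unfolding S_3 by blast
    have "(i, k) \<in> off" "(j, l) \<in> off"
      using off_trans o by blast+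
    then show ?thesis
      using o by (simp add: s dn_2 dn_1)
  qed
  then show ?thesis
    unfolding K_simps
    by (intro extensionalityI[of _ "S (Suc (Suc (Suc 0)))"]) (auto simp: nerve_differential_def)
qed

lemmas quotient_nerve_1 = quotient_nerve[OF dn_dn_0]
lemmas quotient_nerve_2 = quotient_nerve[OF dn_dn_1, folded numeral_2_eq_2]


subsection \<open>A basis of the dual of the diagonal\<close>

abbreviation Dm where "Dm \<equiv> (diagonal_subalgebra r :: ('k, nat \<times> nat \<Rightarrow> 'k) lie_algebra)"

lemma D_ops: "x \<oplus>\<^bsub>Dm\<^esub> y = rest (x + y)" "c \<odot>\<^bsub>Dm\<^esub> x = rest (scale c x)"
  by (simp_all add: diagonal_subalgebra_def L_ops)

abbreviation V where "V \<equiv> dual_space Dm"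

lemma V_simps:
  "f \<in> carrier V \<longleftrightarrow> f \<in> extensional D \<and> (\<forall>x\<in>D. \<forall>y\<in>D. f (rest (x + y)) = f x + f y) \<and>
    (\<forall>c. \<forall>x\<in>D. f (rest (scale c x)) = c * f x)"
  "\<zero>\<^bsub>V\<^esub> = (\<lambda>x\<in>D. 0)"
  "f \<oplus>\<^bsub>V\<^esub> g = (\<lambda>x\<in>D. f x + g x)"
  "c \<odot>\<^bsub>V\<^esub> f = (\<lambda>x\<in>D. c * f x)"
  by (auto simp: dual_space_def class_ring.func_space_def LinearCombinations.module_hom_def ground_space_simps D_ops)

lemma module_V: "module class_ring V"
  by (rule module_class_ringI)
    (auto simp: V_simps D_closed algebra_simps intro!: restrict_ext extensionalityI[of _ D])

definition xi :: "nat \<Rightarrow> (nat \<times> nat \<Rightarrow> 'k) \<Rightarrow> 'k"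
  where "xi b = (\<lambda>x\<in>D. x (b, b))"

lemma HH_eval: "(i, i) \<in> r \<Longrightarrow> HH s t (i, i) = (if i = s then 1 else 0) - (if i = t then 1 else 0)"
  by (simp add: HH_def)

text \<open>The coordinate functionals are dual to the \<open>H b\<close>, so the functionals on the
  dual space are evaluations at \<open>H b\<close> and the coefficients of f are the
  \<open>f (H b)\<close>.\<close>

lemma dual_basis_V: "dual_basis V {1..<N} xi (\<lambda>b f. f (H b))"
proof (rule dual_basis.intro)
  have H: "H b \<in> D" if "b \<in> {1..<N}" for b
    using that by (simp add: Field_r)
  show "module class_ring V"
    by (rule module_V)
  show xi: "xi b \<in> carrier V" if "b \<in> {1..<N}" for b
    using that by (auto simp: V_simps xi_def D_closed scale_def r_refl)
  show "(\<lambda>f. f (H b)) \<in> linear_maps V ground_space" if "b \<in> {1..<N}" for b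
    using H[OF that] by (intro linear_mapsI) (simp_all add: ground_space_simps V_simps)
  show "xi c (H b) = (if b = c then 1 else 0)" if "b \<in> {1..<N}" "c \<in> {1..<N}" for b c
    using that H[OF that(1)] by (auto simp: xi_def HH_eval r_refl)
  show "spanning V (xi ` {1..<N})"
    unfolding spanning_def
  proof (intro conjI allI impI subsetI)
    fix T f assume "submodule class_ring T V" and T: "xi ` {1..<N} \<subseteq> T" and f: "f \<in> carrier V"
    then interpret T: LinearCombinations.submodule class_ring T V
      by simp
    have partial: "(\<lambda>x\<in>D. \<Sum>b\<in>A. x (b, b) * f (H b)) \<in> T" if "finite A" "A \<subseteq> {1..<N}" for A
      using that
    proof (induction A)
      case empty
      then show ?case
        using T.zero_closed unfolding V_simps by (simp only: sum.empty)
    next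
      case (insert b A)
      have "(\<lambda>x\<in>D. \<Sum>b\<in>A. x (b, b) * f (H b)) \<in> T" "xi b \<in> T"
        using insert.IH insert.prems T by blast+
      then have "f (H b) \<odot>\<^bsub>V\<^esub> xi b \<oplus>\<^bsub>V\<^esub> (\<lambda>x\<in>D. \<Sum>b\<in>A. x (b, b) * f (H b)) \<in> T"
        by (intro T.m_closed T.smult_closed) simp
      moreover have eq: "f (H b) \<odot>\<^bsub>V\<^esub> xi b \<oplus>\<^bsub>V\<^esub> (\<lambda>x\<in>D. \<Sum>b\<in>A. x (b, b) * f (H b)) =
          (\<lambda>x\<in>D. \<Sum>b\<in>insert b A. x (b, b) * f (H b))"
        using insert.hyps by (auto simp: V_simps xi_def mult.commute intro!: restrict_ext)
      ultimately show ?case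
        by (simp only:)
    qed
    have "(\<lambda>x\<in>D. \<Sum>b\<in>{1..<N}. x (b, b) * f (H b)) \<in> T"
      by (rule partial) auto
    also have "(\<lambda>x\<in>D. \<Sum>b\<in>{1..<N}. x (b, b) * f (H b)) = f"
    proof (rule extensionalityI)
      show "f \<in> extensional D"
        using f by (simp add: V_simps)
      fix x assume x: "x \<in> D"
      have f0: "f (rest 0) = 0"
        using f D_closed(1) by (auto simp: V_simps scale_linear dest!: bspec[of _ _ "rest 0"] spec[of _ 0])
      \<comment> \<open>Both sides are linear in x, so it suffices to compare them at the
        \<open>H b\<close>.\<close>
      have "x \<in> {x \<in> D. (\<Sum>b\<in>{1..<N}. x (b, b) * f (H b)) = f x}"
      proof (rule D_induct[OF _ _ _ _ x])
        show "rest 0 \<in> {x \<in> D. (\<Sum>b\<in>{1..<N}. x (b, b) * f (H b)) = f x}"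
          using f0 D_closed(1) by (simp add: r_refl)
        show "rest (x + y) \<in> {x \<in> D. (\<Sum>b\<in>{1..<N}. x (b, b) * f (H b)) = f x}"
          if "x \<in> {x \<in> D. (\<Sum>b\<in>{1..<N}. x (b, b) * f (H b)) = f x}"
            "y \<in> {x \<in> D. (\<Sum>b\<in>{1..<N}. x (b, b) * f (H b)) = f x}" for x y
          using that f D_closed(2) by (auto simp: V_simps r_refl distrib_right sum.distrib)
        show "rest (scale c x) \<in> {x \<in> D. (\<Sum>b\<in>{1..<N}. x (b, b) * f (H b)) = f x}"
          if "x \<in> {x \<in> D. (\<Sum>b\<in>{1..<N}. x (b, b) * f (H b)) = f x}" for c x
          using that f D_closed(3) by (auto simp: V_simps r_refl scale_def mult.assoc simp flip: sum_distrib_left)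
        show "H b \<in> {x \<in> D. (\<Sum>b\<in>{1..<N}. x (b, b) * f (H b)) = f x}" if b: "b \<in> {1..<N}" for b
        proof -
          have "(\<Sum>c\<in>{1..<N}. H b (c, c) * f (H c)) = (\<Sum>c\<in>{1..<N}. if c = b then f (H c) else 0)"
            by (intro sum.cong) (auto simp: HH_eval r_refl)
          then show ?thesis
            using b H[OF b] by simp
        qed
      qed
      then show "(\<lambda>x\<in>D. \<Sum>b\<in>{1..<N}. x (b, b) * f (H b)) x = f x"
        using x by simp
    qed simp
    finally show "f \<in> T" .
  qed (use xi in auto)
qed simp

end


subsection \<open>Comparison with the cohomology of the nerve\<close>

context poset_lie
begin

abbreviation K1 where "K1 \<equiv> (K (Suc 0))\<lparr>carrier := cocycles K dn (Suc 0)\<rparr>"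
abbreviation K2 where "K2 \<equiv> (K 2)\<lparr>carrier := cocycles K dn 2\<rparr>"

sublocale Q: quotient_module Z "coboundaries C d 2"
  by (rule quotient_CE)
sublocale N1: quotient_module K1 "coboundaries K dn (Suc 0)"
  by (rule quotient_nerve_1)
sublocale N2: quotient_module K2 "coboundaries K dn 2"
  by (rule quotient_nerve_2)

abbreviation center where "center \<equiv> lie_center L"

text \<open>A diagonal z scales the unit at (i, j) by the difference of its entries at i and j. The
  center thus consists of the traceless diagonals constant on connected components.\<close>

lemma center_iff_locally_constant: "z \<in> carrier center \<longleftrightarrow> z \<in> D \<and> (\<forall>i j. (i, j) \<in> off \<longrightarrow> z (i, i) = z (j, j))"
proof
  assume z: "z \<in> carrier center"
  have "z (i, i) = z (j, j)" if ij: "(i, j) \<in> off" for i j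
  proof -
    have "br z (E (i, j)) (i, j) = 0"
      using center_iff(2)[OF z E_L[OF ij]] ij unfolding rest_eq_iff by (auto simp: off_diag)
    then show ?thesis
      using ij by (simp add: br_D[OF center_iff(1)[OF z]] off_diag E_eval wt_def)
  qed
  then show "z \<in> D \<and> (\<forall>i j. (i, j) \<in> off \<longrightarrow> z (i, i) = z (j, j))"
    using center_iff(1)[OF z] by blast
next
  assume z: "z \<in> D \<and> (\<forall>i j. (i, j) \<in> off \<longrightarrow> z (i, i) = z (j, j))"
  have "wt p z = 0" if "p \<in> r" for p
    using that z by (cases p) (auto simp: wt_def off_iff)
  then have "rest (br z x) = rest 0" for x
    using z by (simp add: rest_eq_iff br_D)
  then show "z \<in> carrier center"
    using z by (simp add: lie_center_def D_L bracket_L L_ops)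
qed

lemma center_ops: "x \<oplus>\<^bsub>center\<^esub> y = rest (x + y)" "c \<odot>\<^bsub>center\<^esub> x = rest (scale c x)" "\<zero>\<^bsub>center\<^esub> = rest 0"
  by (simp_all add: lie_center_def L_ops)

lemma module_center: "module class_ring center"
proof -
  interpret L: Module.module class_ring L by (rule module_L)
  have "submodule class_ring (carrier center) L"
    by (rule submodule_class_ringI[OF module_L])
      (auto simp: center_iff_locally_constant D_L L_ops D_closed off_diag scale_def)
  then have "module class_ring (L\<lparr>carrier := carrier center\<rparr>)"
    by (rule L.submodule_is_module)
  then show ?thesis
    by (simp add: lie_center_def)
qed

definition pairs :: "(nat \<times> nat) set"
  where "pairs = {(a, b). a \<in> {1..<N} \<and> b \<in> {1..<N} \<and> a < b}"

text \<open>
  The three coordinates of the weight-zero part of a cocycle \<open>F\<close>, for the summands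
  \<open>\<Lambda>\<^sup>2 V \<otimes> center\<close>, \<open>V \<otimes> H\<^sup>1\<close> and \<open>H\<^sup>2\<close> of the target, with respect to the basis
  \<open>H b\<close> of the diagonal, \<open>1 \<le> b < N\<close>.
\<close>

definition zF where "zF F = (\<lambda>q\<in>pairs. dg (F [H (fst q), H (snd q)]))"
definition uF where "uF b F = (\<lambda>s\<in>S (Suc 0). F [H b, E (s ! 0, s ! 1)] (s ! 0, s ! 1) :: 'k)"
definition vF where "vF F = (\<lambda>s\<in>S (Suc (Suc 0)). F [E (s ! 0, s ! 1), E (s ! 1, s ! 2)] (s ! 0, s ! 2) :: 'k)"

lemma H_D: "b \<in> {1..<N} \<Longrightarrow> H b \<in> D"
  by (simp add: Field_r)

lemma H_L: "b \<in> {1..<N} \<Longrightarrow> H b \<in> carrier L"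
  by (simp add: H_D D_L)

lemma pairsD: "(a, b) \<in> pairs \<Longrightarrow> a \<in> {1..<N} \<and> b \<in> {1..<N} \<and> a < b"
  by (auto simp: pairs_def)

lemma finite_pairs: "finite pairs"
  by (rule finite_subset[of _ "{1..<N} \<times> {1..<N}"]) (auto simp: pairs_def)

lemma Z_iff: "F \<in> carrier Z \<longleftrightarrow> F \<in> cocycles C d 2"
  by simp

lemma cocycle_C2: "F \<in> cocycles C d 2 \<Longrightarrow> F \<in> carrier (C 2)"
  by (simp add: cocycles_iff)

lemma Z_add: "F \<in> cocycles C d 2 \<Longrightarrow> G \<in> cocycles C d 2 \<Longrightarrow> x \<in> carrier L \<Longrightarrow> y \<in> carrier L \<Longrightarrow> p \<in> r \<Longrightarrow>
    (F \<oplus>\<^bsub>Z\<^esub> G) [x, y] p = F [x, y] p + G [x, y] p"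
  and Z_smult: "x \<in> carrier L \<Longrightarrow> y \<in> carrier L \<Longrightarrow> p \<in> r \<Longrightarrow> (c \<odot>\<^bsub>Z\<^esub> F) [x, y] p = c * F [x, y] p"
  using C2_add C2_smult cocycle_C2 by (auto simp: scale_def)

lemma dg_cong: "(\<And>i. (i, i) \<in> r \<Longrightarrow> x (i, i) = y (i, i)) \<Longrightarrow> dg x = dg y"
  unfolding dg_def rest_eq_iff by auto

lemma dg_diag: "(i, i) \<in> r \<Longrightarrow> dg x (i, i) = x (i, i)"
  by (simp add: dg_def)

text \<open>That the values are central is \<open>cocycle_DDE\<close> combined with the description
  of the center by locally constant diagonals.\<close>

lemma zF_linear: "zF \<in> linear_maps Z (function_space pairs center)"
proof (rule linear_mapsI)
  show "zF F \<in> carrier (function_space pairs center)" if F: "F \<in> carrier Z" for F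
  proof -
    have "dg (F [H a, H b]) \<in> carrier center" if "a \<in> {1..<N}" "b \<in> {1..<N}" for a b
      using cocycle_DDE[OF _ H_D[OF that(1)] H_D[OF that(2)]] F C2_D(1)[OF cocycle_C2 H_L[OF that(1)] H_L[OF that(2)]]
      by (simp add: center_iff_locally_constant dg_diag off_diag)
    then show ?thesis
      by (auto simp: function_space_simps zF_def dest!: pairsD)
  qed
  show "zF (F \<oplus>\<^bsub>Z\<^esub> G) = zF F \<oplus>\<^bsub>function_space pairs center\<^esub> zF G"
    if "F \<in> carrier Z" "G \<in> carrier Z" for F G
  proof -
    have "dg ((F \<oplus>\<^bsub>Z\<^esub> G) [H a, H b]) = rest (dg (F [H a, H b]) + dg (G [H a, H b]))"
      if "a \<in> {1..<N}" "b \<in> {1..<N}" for a b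
      using Z_add[OF _ _ H_L[OF that(1)] H_L[OF that(2)]] \<open>F \<in> carrier Z\<close> \<open>G \<in> carrier Z\<close>
      by (simp flip: dg_linear) (intro dg_cong, simp)
    note eq = this
    show ?thesis
      unfolding function_space_simps zF_def center_ops
    proof (rule restrict_ext)
      fix q assume "q \<in> pairs"
      then show "dg ((F \<oplus>\<^bsub>Z\<^esub> G) [H (fst q), H (snd q)]) =
          rest ((\<lambda>q\<in>pairs. dg (F [H (fst q), H (snd q)])) q + (\<lambda>q\<in>pairs. dg (G [H (fst q), H (snd q)])) q)"
        using eq[of "fst q" "snd q"] pairsD[of "fst q" "snd q"] by simp
    qed
  qed
  show "zF (c \<odot>\<^bsub>Z\<^esub> F) = c \<odot>\<^bsub>function_space pairs center\<^esub> zF F" if "F \<in> carrier Z" for c F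
  proof -
    have "dg ((c \<odot>\<^bsub>Z\<^esub> F) [H a, H b]) = rest (scale c (dg (F [H a, H b])))"
      if "a \<in> {1..<N}" "b \<in> {1..<N}" for a b
      using Z_smult[OF H_L[OF that(1)] H_L[OF that(2)]]
      by (simp flip: dg_linear) (intro dg_cong, simp add: scale_def)
    note eq = this
    show ?thesis
      unfolding function_space_simps zF_def center_ops
    proof (rule restrict_ext)
      fix q assume "q \<in> pairs"
      then show "dg ((c \<odot>\<^bsub>Z\<^esub> F) [H (fst q), H (snd q)]) =
          rest (scale c ((\<lambda>q\<in>pairs. dg (F [H (fst q), H (snd q)])) q))"
        using eq[of "fst q" "snd q"] pairsD[of "fst q" "snd q"] by simp
    qed
  qed
qed

lemma uF_eval: "(i, j) \<in> off \<Longrightarrow> uF b F [i, j] = F [H b, E (i, j)] (i, j)"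
  by (simp add: uF_def S_1)

lemma vF_eval: "(i, j) \<in> off \<Longrightarrow> (j, k) \<in> off \<Longrightarrow> vF F [i, j, k] = F [E (i, j), E (j, k)] (i, k)"
  by (simp add: vF_def S_2)

lemma K_cocycle_1: "u \<in> cocycles K dn (Suc 0) \<longleftrightarrow> u \<in> extensional (S (Suc 0)) \<and>
    (\<forall>i j k. (i, j) \<in> off \<longrightarrow> (j, k) \<in> off \<longrightarrow> u [j, k] - u [i, k] + u [i, j] = 0)"
proof -
  have "dn (Suc 0) u = \<zero>\<^bsub>K (Suc (Suc 0))\<^esub> \<longleftrightarrow> (\<forall>s\<in>S (Suc (Suc 0)). dn (Suc 0) u s = 0)"
    unfolding K_simps by (auto simp: nerve_differential_def fun_eq_iff)
  also have "\<dots> \<longleftrightarrow> (\<forall>i j k. (i, j) \<in> off \<longrightarrow> (j, k) \<in> off \<longrightarrow> u [j, k] - u [i, k] + u [i, j] = 0)"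
    unfolding S_2 by (fastforce simp: dn_1)
  finally show ?thesis
    by (simp add: cocycles_def K_simps PiE_def)
qed

lemma K_cocycle_2: "v \<in> cocycles K dn 2 \<longleftrightarrow> v \<in> extensional (S (Suc (Suc 0))) \<and>
    (\<forall>i j k l. (i, j) \<in> off \<longrightarrow> (j, k) \<in> off \<longrightarrow> (k, l) \<in> off \<longrightarrow>
      v [j, k, l] - v [i, k, l] + v [i, j, l] - v [i, j, k] = 0)"
proof -
  have "dn (Suc (Suc 0)) v = \<zero>\<^bsub>K (Suc (Suc (Suc 0)))\<^esub> \<longleftrightarrow>
      (\<forall>s\<in>S (Suc (Suc (Suc 0))). dn (Suc (Suc 0)) v s = 0)"
    unfolding K_simps by (auto simp: nerve_differential_def fun_eq_iff)
  also have "\<dots> \<longleftrightarrow> (\<forall>i j k l. (i, j) \<in> off \<longrightarrow> (j, k) \<in> off \<longrightarrow> (k, l) \<in> off \<longrightarrow>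
      v [j, k, l] - v [i, k, l] + v [i, j, l] - v [i, j, k] = 0)"
    unfolding S_3 by (fastforce simp: dn_2)
  finally show ?thesis
    unfolding numeral_2_eq_2 by (simp add: cocycles_def K_simps PiE_def)
qed

lemma S_1_elim: "s \<in> S (Suc 0) \<Longrightarrow> (\<And>i j. s = [i, j] \<Longrightarrow> [i, j] \<in> S (Suc 0) \<Longrightarrow> (i, j) \<in> off \<Longrightarrow> thesis) \<Longrightarrow> thesis"
  unfolding S_1 by blast

lemma S_2_elim: "s \<in> S (Suc (Suc 0)) \<Longrightarrow>
    (\<And>i j k. s = [i, j, k] \<Longrightarrow> [i, j, k] \<in> S (Suc (Suc 0)) \<Longrightarrow>
      (i, j) \<in> off \<Longrightarrow> (j, k) \<in> off \<Longrightarrow> (i, k) \<in> off \<Longrightarrow> thesis) \<Longrightarrow> thesis"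
  unfolding S_2 using off_trans by blast

lemma uF_linear:
  assumes b: "b \<in> {1..<N}"
  shows "uF b \<in> linear_maps Z K1"
proof (rule linear_mapsI)
  show "uF b F \<in> carrier K1" if "F \<in> carrier Z" for F
  proof -
    have "uF b F [j, k] - uF b F [i, k] + uF b F [i, j] = 0" if "(i, j) \<in> off" "(j, k) \<in> off" for i j k
      using cocycle_DEE[OF _ H_D[OF b] that] \<open>F \<in> carrier Z\<close> that off_trans[OF that] by (simp add: uF_eval)
    then show ?thesis
      by (simp add: K_cocycle_1) (simp add: uF_def)
  qed
  show "uF b (F \<oplus>\<^bsub>Z\<^esub> G) = uF b F \<oplus>\<^bsub>K1\<^esub> uF b G" if "F \<in> carrier Z" "G \<in> carrier Z" for F G
  proof (rule extensionalityI[of _ "S (Suc 0)"])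
    fix s assume s: "s \<in> S (Suc 0)"
    from s obtain i j where ij: "s = [i, j]" "[i, j] \<in> S (Suc 0)" "(i, j) \<in> off"
      by (rule S_1_elim)
    show "uF b (F \<oplus>\<^bsub>Z\<^esub> G) s = (uF b F \<oplus>\<^bsub>K1\<^esub> uF b G) s"
      using ij that Z_add[of F G] H_L[OF b]
      by (simp add: K_simps uF_eval off_diag)
  qed (simp_all add: uF_def K_simps)
  show "uF b (c \<odot>\<^bsub>Z\<^esub> F) = c \<odot>\<^bsub>K1\<^esub> uF b F" if "F \<in> carrier Z" for c F
  proof (rule extensionalityI[of _ "S (Suc 0)"])
    fix s assume s: "s \<in> S (Suc 0)"
    from s obtain i j where ij: "s = [i, j]" "[i, j] \<in> S (Suc 0)" "(i, j) \<in> off"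
      by (rule S_1_elim)
    show "uF b (c \<odot>\<^bsub>Z\<^esub> F) s = (c \<odot>\<^bsub>K1\<^esub> uF b F) s"
      using ij Z_smult H_L[OF b] by (simp add: K_simps uF_eval off_diag)
  qed (simp_all add: uF_def K_simps)
qed

lemma vF_linear: "vF \<in> linear_maps Z K2"
proof (rule linear_mapsI)
  show "vF F \<in> carrier K2" if "F \<in> carrier Z" for F
  proof -
    have "vF F [j, k, l] - vF F [i, k, l] + vF F [i, j, l] - vF F [i, j, k] = 0"
      if "(i, j) \<in> off" "(j, k) \<in> off" "(k, l) \<in> off" for i j k l
      using cocycle_EEE[OF _ that] \<open>F \<in> carrier Z\<close> that off_trans[OF that(1,2)] off_trans[OF that(2,3)]
      by (simp add: vF_eval)
    then show ?thesis
      by (simp add: K_cocycle_2) (simp add: vF_def)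
  qed
  show "vF (F \<oplus>\<^bsub>Z\<^esub> G) = vF F \<oplus>\<^bsub>K2\<^esub> vF G" if "F \<in> carrier Z" "G \<in> carrier Z" for F G
  proof (rule extensionalityI[of _ "S (Suc (Suc 0))"])
    fix s assume s: "s \<in> S (Suc (Suc 0))"
    from s obtain i j k where ij: "s = [i, j, k]" "[i, j, k] \<in> S (Suc (Suc 0))" "(i, j) \<in> off" "(j, k) \<in> off" "(i, k) \<in> off"
      by (rule S_2_elim)
    show "vF (F \<oplus>\<^bsub>Z\<^esub> G) s = (vF F \<oplus>\<^bsub>K2\<^esub> vF G) s"
      using ij that Z_add[of F G]
      by (simp add: K_simps numeral_2_eq_2[symmetric] vF_eval off_diag)
  qed (simp_all add: vF_def K_simps numeral_2_eq_2)
  show "vF (c \<odot>\<^bsub>Z\<^esub> F) = c \<odot>\<^bsub>K2\<^esub> vF F" if "F \<in> carrier Z" for c F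
  proof (rule extensionalityI[of _ "S (Suc (Suc 0))"])
    fix s assume s: "s \<in> S (Suc (Suc 0))"
    from s obtain i j k where ij: "s = [i, j, k]" "[i, j, k] \<in> S (Suc (Suc 0))" "(i, j) \<in> off" "(j, k) \<in> off" "(i, k) \<in> off"
      by (rule S_2_elim)
    show "vF (c \<odot>\<^bsub>Z\<^esub> F) s = (c \<odot>\<^bsub>K2\<^esub> vF F) s"
      using ij Z_smult by (simp add: K_simps numeral_2_eq_2[symmetric] vF_eval off_diag)
  qed (simp_all add: vF_def K_simps numeral_2_eq_2)
qed

text \<open>For h and a unit, the action of h cancels against \<open>G\<close> of the bracket, both
  being scaled by the weight of the unit; only the unit acting on \<open>G [h]\<close> is left. For
  two composable units each action contributes one entry.\<close>

lemma d1_weight_zero: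
  assumes G: "G \<in> carrier (C (Suc 0))"
  shows "h \<in> D \<Longrightarrow> h' \<in> D \<Longrightarrow> (i, i) \<in> r \<Longrightarrow> d (Suc 0) G [h, h'] (i, i) = 0"
    and "h \<in> D \<Longrightarrow> (i, j) \<in> off \<Longrightarrow> d (Suc 0) G [h, E (i, j)] (i, j) = G [h] (i, i) - G [h] (j, j)"
    and "(i, j) \<in> off \<Longrightarrow> (j, k) \<in> off \<Longrightarrow> d (Suc 0) G [E (i, j), E (j, k)] (i, k) =
      G [E (j, k)] (j, k) - G [E (i, k)] (i, k) + G [E (i, j)] (i, j)"
proof -
  have G0: "G [rest 0] = rest 0"
    using C1_D(3)[OF G L_closed(1), of 0] by (simp add: scale_linear)
  show "h \<in> D \<Longrightarrow> h' \<in> D \<Longrightarrow> (i, i) \<in> r \<Longrightarrow> d (Suc 0) G [h, h'] (i, i) = 0"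
    by (simp add: d1_eq[OF G] D_L br_diag bracket_generators(2) G0)
  show "d (Suc 0) G [h, E (i, j)] (i, j) = G [h] (i, i) - G [h] (j, j)" if "h \<in> D" "(i, j) \<in> off"
    using that off_diag[OF that(2)] by (simp add: d1_eq[OF G] D_L bracket_generators(1) C1_D(3)[OF G] br_D br_E)
      (simp add: scale_def)
  show "d (Suc 0) G [E (i, j), E (j, k)] (i, k) =
      G [E (j, k)] (j, k) - G [E (i, k)] (i, k) + G [E (i, j)] (i, j)" if "(i, j) \<in> off" "(j, k) \<in> off"
  proof -
    have "(i, k) \<in> off" "i \<noteq> j" "j \<noteq> k"
      using that off_trans[OF that] by (auto simp: off_iff)
    then show ?thesis
      using that by (simp add: d1_eq[OF G] bracket_generators(3) br_E off_diag)
  qed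
qed

lemma coboundary_imp:
  assumes G: "G \<in> carrier (C (Suc 0))"
  shows "zF (d (Suc 0) G) = \<zero>\<^bsub>function_space pairs center\<^esub>"
    and "b \<in> {1..<N} \<Longrightarrow> uF b (d (Suc 0) G) \<in> coboundaries K dn (Suc 0)"
    and "vF (d (Suc 0) G) \<in> coboundaries K dn 2"
proof -
  show "zF (d (Suc 0) G) = \<zero>\<^bsub>function_space pairs center\<^esub>"
  proof -
    have "dg (d (Suc 0) G [H a, H b]) = rest 0" if "a \<in> {1..<N}" "b \<in> {1..<N}" for a b
      using d1_weight_zero(1)[OF G H_D[OF that(1)] H_D[OF that(2)]] by (auto simp: dg_def rest_eq_iff)
    then show ?thesis
      by (auto simp: zF_def function_space_simps center_ops dest!: pairsD intro!: restrict_ext)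
  qed
  show "uF b (d (Suc 0) G) \<in> coboundaries K dn (Suc 0)" if b: "b \<in> {1..<N}"
  proof -
    \<comment> \<open>The minus sign reconciles the orders: the Lie differential gives the entry at
      i minus the one at j, the simplicial one takes end minus start.\<close>
    let ?w = "\<lambda>s\<in>S 0. - G [H b] (s ! 0, s ! 0)"
    have "uF b (d (Suc 0) G) = dn 0 ?w"
    proof (rule extensionalityI[of _ "S (Suc 0)"])
      fix s assume s: "s \<in> S (Suc 0)"
      from s obtain i j where ij: "s = [i, j]" "[i, j] \<in> S (Suc 0)" "(i, j) \<in> off"
        by (rule S_1_elim)
      show "uF b (d (Suc 0) G) s = dn 0 ?w s"
        using ij in_Field
        by (auto simp: uF_eval dn_0 d1_weight_zero(2)[OF G H_D[OF b]] S_0 off_iff)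
    qed (simp_all add: uF_def nerve_differential_def)
    moreover have "?w \<in> carrier (K 0)"
      by (simp add: K_simps)
    ultimately show ?thesis
      by (auto simp: coboundaries_def)
  qed
  show "vF (d (Suc 0) G) \<in> coboundaries K dn 2"
  proof -
    let ?t = "\<lambda>s\<in>S (Suc 0). G [E (s ! 0, s ! 1)] (s ! 0, s ! 1)"
    have "vF (d (Suc 0) G) = dn (Suc 0) ?t"
    proof (rule extensionalityI[of _ "S (Suc (Suc 0))"])
      fix s assume s: "s \<in> S (Suc (Suc 0))"
      from s obtain i j k where ij: "s = [i, j, k]" "[i, j, k] \<in> S (Suc (Suc 0))" "(i, j) \<in> off" "(j, k) \<in> off" "(i, k) \<in> off"
        by (rule S_2_elim)
      show "vF (d (Suc 0) G) s = dn (Suc 0) ?t s"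
        using ij by (simp add: vF_eval dn_1 d1_weight_zero(3)[OF G] S_1)
    qed (simp_all add: vF_def nerve_differential_def)
    moreover have "?t \<in> carrier (K (Suc 0))"
      by (simp add: K_simps)
    ultimately show ?thesis
      by (auto simp: coboundaries_def numeral_2_eq_2)
  qed
qed

text \<open>The average is subtracted to make the trace vanish; this is where \<open>N\<close> has to be invertible.\<close>

definition corr where
  "corr w t x = rest (\<lambda>(i, j). if i = j
    then \<Sum>b\<in>{1..<N}. x (b, b) * ((\<Sum>m\<in>Field r. w b [m]) / of_nat N - w b [i]) else t [i, j] * x (i, j))"

lemma corr_C1: "(\<lambda>xs\<in>tuples L (Suc 0). corr w t (hd xs)) \<in> carrier (C (Suc 0))"
  unfolding ce_cochains_1_iff
proof (intro conjI linear_mapsI)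
  have t: "[x] \<in> tuples L (Suc 0) \<longleftrightarrow> x \<in> carrier L" for x
    by (simp add: tuples_1)
  have bb: "(b, b) \<in> r" if "b \<in> {1..<N}" for b
    using that by (simp add: r_refl)
  fix x assume x: "x \<in> carrier L"
  show "(\<lambda>xs\<in>tuples L (Suc 0). corr w t (hd xs)) [x] \<in> carrier L"
  proof -
    have "(\<Sum>i\<in>Field r. \<Sum>b\<in>{1..<N}. x (b, b) * ((\<Sum>m\<in>Field r. w b [m]) / of_nat N - w b [i])) =
        (\<Sum>b\<in>{1..<N}. x (b, b) * (\<Sum>i\<in>Field r. (\<Sum>m\<in>Field r. w b [m]) / of_nat N - w b [i]))"
      by (subst sum.swap) (simp add: sum_distrib_left)
    also have "\<dots> = 0"
    proof (rule sum.neutral, rule ballI)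
      fix b assume "b \<in> {1..<N}"
      then have "of_nat N \<noteq> (0::'k)"
        using of_int_eq_0_imp[of "int N"] by auto
      then show "x (b, b) * (\<Sum>i\<in>Field r. (\<Sum>m\<in>Field r. w b [m]) / of_nat N - w b [i]) = 0"
        by (simp add: sum_subtractf) (simp add: Field_r)
    qed
    finally show ?thesis
      using x by (simp add: t corr_def rest_in_L)
  qed
  show "(\<lambda>xs\<in>tuples L (Suc 0). corr w t (hd xs)) [c \<odot>\<^bsub>L\<^esub> x] =
      c \<odot>\<^bsub>L\<^esub> (\<lambda>xs\<in>tuples L (Suc 0). corr w t (hd xs)) [x]" for c
    using x by (auto simp: t L_ops L_closed corr_def rest_eq_iff scale_def bb sum_distrib_left mult.assoc mult.left_commute)
  fix y assume y: "y \<in> carrier L"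
  show "(\<lambda>xs\<in>tuples L (Suc 0). corr w t (hd xs)) [x \<oplus>\<^bsub>L\<^esub> y] =
      (\<lambda>xs\<in>tuples L (Suc 0). corr w t (hd xs)) [x] \<oplus>\<^bsub>L\<^esub> (\<lambda>xs\<in>tuples L (Suc 0). corr w t (hd xs)) [y]"
    using x y by (auto simp: t L_ops L_closed corr_def rest_eq_iff bb sum.distrib distrib_right distrib_left)
qed simp

lemma bilinear_zero_D:
  assumes F: "F \<in> carrier (C 2)" and y: "y \<in> carrier L" and p: "p \<in> r"
    and zero: "\<And>b. b \<in> {1..<N} \<Longrightarrow> F [H b, y] p = 0" and h: "h \<in> D"
  shows "F [h, y] p = 0"
proof -
  have "h \<in> {h \<in> D. F [h, y] p = 0}"
  proof (rule D_induct[OF _ _ _ _ h])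
    show "rest 0 \<in> {h \<in> D. F [h, y] p = 0}"
      using C2_simps[OF F y p] D_closed(1) by blast
    show "rest (x + x') \<in> {h \<in> D. F [h, y] p = 0}" if "x \<in> {h \<in> D. F [h, y] p = 0}" "x' \<in> {h \<in> D. F [h, y] p = 0}" for x x'
      using that D_closed(2)[of x x'] C2_D(2)[OF F D_L y D_L, of x x'] p by simp
    show "rest (scale c x) \<in> {h \<in> D. F [h, y] p = 0}" if "x \<in> {h \<in> D. F [h, y] p = 0}" for c x
      using that D_closed(3)[of x c] C2_simps(3)[OF F y p D_L, of x c] by simp
  qed (use zero H_D in auto)
  then show ?thesis
    by simp
qed

text \<open>For the converse, primitives on the nerve are assembled into one 1-cochain whose
  differential has the same coefficients of weight zero as \<open>F\<close>; the difference then
  satisfies \<open>coboundaryI\<close>.\<close>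

lemma coboundary_iff:
  assumes F: "F \<in> cocycles C d 2"
  shows "F \<in> coboundaries C d 2 \<longleftrightarrow> zF F = \<zero>\<^bsub>function_space pairs center\<^esub> \<and>
    (\<forall>b\<in>{1..<N}. uF b F \<in> coboundaries K dn (Suc 0)) \<and> vF F \<in> coboundaries K dn 2"
proof
  assume "F \<in> coboundaries C d 2"
  then obtain G where "G \<in> carrier (C (Suc 0))" "F = d (Suc 0) G"
    by (auto simp: coboundaries_eq)
  then show "zF F = \<zero>\<^bsub>function_space pairs center\<^esub> \<and>
    (\<forall>b\<in>{1..<N}. uF b F \<in> coboundaries K dn (Suc 0)) \<and> vF F \<in> coboundaries K dn 2"
    using coboundary_imp by blast
next
  assume *: "zF F = \<zero>\<^bsub>function_space pairs center\<^esub> \<and>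
    (\<forall>b\<in>{1..<N}. uF b F \<in> coboundaries K dn (Suc 0)) \<and> vF F \<in> coboundaries K dn 2"
  then have "\<forall>b\<in>{1..<N}. \<exists>w. uF b F = dn 0 w"
    by (auto simp: coboundaries_def)
  then obtain w where w: "\<And>b. b \<in> {1..<N} \<Longrightarrow> uF b F = dn 0 (w b)"
    by metis
  obtain t where t: "vF F = dn (Suc 0) t"
    using * by (auto simp: coboundaries_def numeral_2_eq_2)
  define G where "G = (\<lambda>xs\<in>tuples L (Suc 0). corr w t (hd xs))"
  have G: "G \<in> carrier (C (Suc 0))"
    unfolding G_def by (rule corr_C1)
  have Ge: "G [x] = corr w t x" if "x \<in> carrier L" for x
    using that by (simp add: G_def tuples_1)
  define F' where "F' = F \<oplus>\<^bsub>Z\<^esub> (- 1) \<odot>\<^bsub>Z\<^esub> d (Suc 0) G"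
  have dG: "d (Suc 0) G \<in> cocycles C d 2"
    by (rule coboundary_cocycle[OF G])
  have mdG: "(- 1) \<odot>\<^bsub>Z\<^esub> d (Suc 0) G \<in> cocycles C d 2"
    using Q.V.smult_closed[of "-1" "d (Suc 0) G"] dG by simp
  have F': "F' \<in> cocycles C d 2"
    unfolding F'_def using Q.V.a_closed[of F "(- 1) \<odot>\<^bsub>Z\<^esub> d (Suc 0) G"] F mdG by simp
  have F'e: "F' [x, y] p = F [x, y] p - d (Suc 0) G [x, y] p" if "x \<in> carrier L" "y \<in> carrier L" "p \<in> r" for x y p
    unfolding F'_def using Z_add[OF F mdG that] Z_smult[OF that] by simp
  note F2 = cocycle_C2[OF F] and F'2 = cocycle_C2[OF F']
  have HH: "F' [H a, H b] (i, i) = 0" if a: "a \<in> {1..<N}" and b: "b \<in> {1..<N}" and i: "(i, i) \<in> r" for a b i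
  proof -
    have less: "F [H a, H b] (i, i) = 0" if "a < b" "a \<in> {1..<N}" "b \<in> {1..<N}" for a b
    proof -
      have "(a, b) \<in> pairs"
        using that by (simp add: pairs_def)
      then have "dg (F [H a, H b]) = rest 0"
        using fun_cong[OF conjunct1[OF *], of "(a, b)"] by (simp add: zF_def function_space_simps center_ops)
      then show ?thesis
        using dg_diag[OF i, of "F [H a, H b]"] i by simp
    qed
    have "F [H a, H b] (i, i) = 0"
      using less[of a b] less[of b a] C2_swap[OF F2 H_L[OF b] H_L[OF a] i] C2_simps(2)[OF F2 H_L[OF a] i] a b
      by (cases a b rule: linorder_cases) auto
    then show ?thesis
      using F'e[OF H_L[OF a] H_L[OF b] i] d1_weight_zero(1)[OF G H_D[OF a] H_D[OF b] i] by simp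
  qed
  have "F' \<in> coboundaries C d 2"
  proof (rule coboundaryI[OF F'])
    show "F' [h, h'] (i, i) = 0" if "h \<in> D" "h' \<in> D" "(i, i) \<in> r" for h h' i
    proof (rule bilinear_zero_D[OF F'2 D_L[OF that(2)] that(3) _ that(1)])
      fix b assume b: "b \<in> {1..<N}"
      have "F' [h', H b] (i, i) = 0"
        by (rule bilinear_zero_D[OF F'2 H_L[OF b] that(3) _ that(2)]) (rule HH[OF _ b that(3)])
      then show "F' [H b, h'] (i, i) = 0"
        using C2_swap[OF F'2 D_L[OF that(2)] H_L[OF b] that(3)] by simp
    qed
    show "F' [h, E q] q = 0" if h: "h \<in> D" and q: "q \<in> off" for h q
    proof (rule bilinear_zero_D[OF F'2 E_L[OF q] off_diag(3)[OF q] _ h])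
      fix b assume b: "b \<in> {1..<N}"
      obtain i j where ij: "q = (i, j)" by (cases q)
      have o: "(i, j) \<in> off" and r: "(i, j) \<in> r" "(i, i) \<in> r" "(j, j) \<in> r"
        using q ij off_diag by auto
      have "F [H b, E (i, j)] (i, j) = w b [j] - w b [i]"
        using uF_eval[OF o, of b F] w[OF b] dn_0[OF o] by simp
      \<comment> \<open>The average does not depend on m, so it drops out of the difference of the
        entries at i and j, which is all that matters here.\<close>
      moreover have "G [H b] (m, m) = (\<Sum>n\<in>Field r. w b [n]) / of_nat N - w b [m]" if m: "(m, m) \<in> r" for m
      proof -
        have "G [H b] (m, m) = (\<Sum>c\<in>{1..<N}. H b (c, c) * ((\<Sum>n\<in>Field r. w c [n]) / of_nat N - w c [m]))"
          using m by (simp add: Ge[OF H_L[OF b]] corr_def)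
        also have "\<dots> = (\<Sum>c\<in>{1..<N}. if c = b then (\<Sum>n\<in>Field r. w c [n]) / of_nat N - w c [m] else 0)"
          by (intro sum.cong) (auto simp: HH_eval r_refl)
        finally show ?thesis
          using b by simp
      qed
      ultimately show "F' [H b, E q] q = 0"
        unfolding ij using F'e[OF H_L[OF b] E_L[OF o] r(1)] d1_weight_zero(2)[OF G H_D[OF b] o] r by simp
    qed
    show "F' [E (i, j), E (j, k)] (i, k) = 0" if "(i, j) \<in> off" "(j, k) \<in> off" for i j k
    proof -
      have Gt: "G [E (i, j)] (i, j) = t [i, j]" if "(i, j) \<in> off" for i j
        using that by (simp add: Ge corr_def off_diag E_eval) (simp add: off_iff)
      have ik: "(i, k) \<in> off"
        using off_trans[OF that] .
      show ?thesis
        using F'e[OF E_L[OF that(1)] E_L[OF that(2)] off_diag(3)[OF ik]] d1_weight_zero(3)[OF G that]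
          Gt[OF that(1)] Gt[OF that(2)] Gt[OF ik] vF_eval[OF that, of F] dn_1[OF that, of t] t by simp
    qed
  qed
  moreover have "d (Suc 0) G \<in> coboundaries C d 2"
    using G by (simp add: coboundaries_eq)
  moreover have "F = F' \<oplus>\<^bsub>Z\<^esub> d (Suc 0) G"
  proof (rule C2_eqI[OF F2])
    show "F' \<oplus>\<^bsub>Z\<^esub> d (Suc 0) G \<in> carrier (C 2)"
      using cocycle_C2 Q.V.a_closed[of F' "d (Suc 0) G"] F' dG by simp
    show "F [x, y] p = (F' \<oplus>\<^bsub>Z\<^esub> d (Suc 0) G) [x, y] p" if "x \<in> carrier L" "y \<in> carrier L" "p \<in> r" for x y p
      unfolding Z_add[OF F' dG that] F'e[OF that] by simp
  qed
  ultimately show "F \<in> coboundaries C d 2"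
    using Q.U.m_closed by metis
qed

lemma extraction_onto:
  assumes z: "z \<in> carrier (function_space pairs center)"
    and u: "\<And>b. b \<in> {1..<N} \<Longrightarrow> u b \<in> cocycles K dn (Suc 0)" and v: "v \<in> cocycles K dn 2"
  obtains F where "F \<in> cocycles C d 2" "zF F = z" "\<And>b. b \<in> {1..<N} \<Longrightarrow> uF b F = u b" "vF F = v"
proof -
  have zc: "z q \<in> carrier center" if "q \<in> pairs" for q
    using z that by (auto simp: function_space_simps)
  have uc: "u b [i, k] = u b [i, j] + u b [j, k]" if b: "b \<in> {1..<N}" and o: "(i, j) \<in> off" "(j, k) \<in> off" for b i j k
  proof -
    have "u b [j, k] - u b [i, k] + u b [i, j] = 0"
      using u[OF b] o unfolding K_cocycle_1 by blast
    then show ?thesis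
      by (simp add: algebra_simps)
  qed
  have vc: "v [j, k, l] - v [i, k, l] + v [i, j, l] - v [i, j, k] = 0"
    if "(i, j) \<in> off" "(j, k) \<in> off" "(k, l) \<in> off" for i j k l
    using v that unfolding K_cocycle_2 by blast
  have fin: "finite pairs" "pairs \<subseteq> {1..<N} \<times> {1..<N}" "finite {1..<N}" "{1..<N} \<subseteq> Field r"
    using finite_pairs by (auto simp: Field_r dest!: pairsD)
  obtain F where F: "F \<in> cocycles C d 2"
    and DD: "\<And>h h' i. h \<in> D \<Longrightarrow> h' \<in> D \<Longrightarrow> (i, i) \<in> r \<Longrightarrow>
      F [h, h'] (i, i) = (\<Sum>(a, b)\<in>pairs. (h (a, a) * h' (b, b) - h' (a, a) * h (b, b)) * z (a, b) (i, i))"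
    and DE: "\<And>h i j. h \<in> D \<Longrightarrow> (i, j) \<in> off \<Longrightarrow> F [h, E (i, j)] (i, j) = (\<Sum>b\<in>{1..<N}. h (b, b) * u b [i, j])"
    and EE: "\<And>i j k. (i, j) \<in> off \<Longrightarrow> (j, k) \<in> off \<Longrightarrow> F [E (i, j), E (j, k)] (i, k) = v [i, j, k]"
    using cocycle_exists[OF fin(3,4,1,2), of z "\<lambda>b i j. u b [i, j]" "\<lambda>i j k. v [i, j, k]"] zc uc vc by blast
  have Hb: "H a (b, b) = (if a = b then 1 else 0)" if "a \<in> {1..<N}" "b \<in> {1..<N}" for a b
    using that by (auto simp: HH_eval r_refl)
  show ?thesis
  proof (rule that[OF F])
    show "zF F = z"
    proof (rule extensionalityI[of _ pairs])
      fix q assume q: "q \<in> pairs"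
      obtain a b where ab: "q = (a, b)" by (cases q)
      then have ab': "a \<in> {1..<N}" "b \<in> {1..<N}" "a < b"
        using q by (auto simp: pairs_def)
      have zD: "z q \<in> D"
        using zc[OF q] by (simp add: center_iff_locally_constant)
      have "F [H a, H b] (i, i) = z q (i, i)" if i: "(i, i) \<in> r" for i
      proof -
        \<comment> \<open>Among pairs in increasing order the 2 by 2 minor of \<open>H a\<close> and
          \<open>H b\<close> is 1 at q and 0 elsewhere; the order excludes the transposed pair,
          where it would be -1.\<close>
        have "F [H a, H b] (i, i) = (\<Sum>q'\<in>pairs. if q' = q then z q (i, i) else 0)"
          unfolding DD[OF H_D[OF ab'(1)] H_D[OF ab'(2)] i]
        proof (rule sum.cong)
          fix q' assume "q' \<in> pairs"
          then show "(case q' of (a', b') \<Rightarrow> (H a (a', a') * H b (b', b') - H b (a', a') * H a (b', b')) * z (a', b') (i, i)) =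
              (if q' = q then z q (i, i) else 0)"
            using ab ab' by (auto simp: pairs_def Hb split: if_splits)
        qed simp
        then show ?thesis
          using fin(1) q by simp
      qed
      then have "dg (F [H a, H b]) = dg (z q)"
        by (rule dg_cong)
      then show "zF F q = z q"
        using q ab dg_id[OF zD] by (simp add: zF_def)
    qed (use z in \<open>auto simp: zF_def function_space_simps PiE_iff\<close>)
    show "uF b F = u b" if b: "b \<in> {1..<N}" for b
    proof (rule extensionalityI[of _ "S (Suc 0)"])
      fix s assume "s \<in> S (Suc 0)"
      then show "uF b F s = u b s"
      proof (rule S_1_elim)
        fix i j assume s: "s = [i, j]" and o: "(i, j) \<in> off"
        have "F [H b, E (i, j)] (i, j) = (\<Sum>c\<in>{1..<N}. if c = b then u c [i, j] else 0)"
          unfolding DE[OF H_D[OF b] o] by (intro sum.cong) (auto simp: Hb[OF b])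
        then show ?thesis
          using b s o by (simp add: uF_eval)
      qed
    qed (use u[OF b] in \<open>auto simp: uF_def K_cocycle_1\<close>)
    show "vF F = v"
    proof (rule extensionalityI[of _ "S (Suc (Suc 0))"])
      fix s assume s: "s \<in> S (Suc (Suc 0))"
      from s obtain i j k where ij: "s = [i, j, k]" "[i, j, k] \<in> S (Suc (Suc 0))" "(i, j) \<in> off" "(j, k) \<in> off" "(i, k) \<in> off"
        by (rule S_2_elim)
      show "vF F s = v s"
        using ij by (simp add: vF_eval EE)
    qed (use v in \<open>auto simp: vF_def K_cocycle_2\<close>)
  qed
qed

text \<open>The bijections \<open>f1\<close> and \<open>f2\<close> turn coordinates into tensors, so
  the two requirements on the common cover concern coordinates only: \<open>extraction_onto\<close>
  gives surjectivity and \<open>coboundary_iff\<close> the kernel.\<close>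

theorem adjoint_cohomology_2:
  "adjoint_cohomology 2 L \<cong>\<^sub>k
    (exterior_square V \<otimes>\<^sub>k center) \<oplus>\<^sub>k (V \<otimes>\<^sub>k nerve_cohomology 1 r) \<oplus>\<^sub>k nerve_cohomology 2 r"
proof -
  have spaces: "adjoint_cohomology 2 L = Q.Q" "nerve_cohomology 1 r = N1.Q" "nerve_cohomology 2 r = N2.Q"
    by (simp_all add: adjoint_cohomology_def ce_cohomology_def cohomology_def nerve_cohomology_def)
  obtain v' l' where "dual_basis (exterior_square V) pairs v' l'"
    using exterior_square_dual_basis[OF dual_basis_V] unfolding pairs_def by blast
  from tensor_product_dual_basis[OF this module_center]
  obtain f1 where f1: "f1 \<in> linear_maps (function_space pairs center) (exterior_square V \<otimes>\<^sub>k center)"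
    "bij_betw f1 (carrier (function_space pairs center)) (carrier (exterior_square V \<otimes>\<^sub>k center))"
    by (auto simp: linearly_isomorphic_def)
  from tensor_product_dual_basis[OF dual_basis_V N1.module_quotient]
  obtain f2 where f2: "f2 \<in> linear_maps (function_space {1..<N} N1.Q) (V \<otimes>\<^sub>k N1.Q)"
    "bij_betw f2 (carrier (function_space {1..<N} N1.Q)) (carrier (V \<otimes>\<^sub>k N1.Q))"
    by (auto simp: linearly_isomorphic_def)
  define cu where "cu F = (\<lambda>b\<in>{1..<N}. N1.coset (uF b F))" for F
  have z: "zF F \<in> carrier (function_space pairs center)" if "F \<in> carrier Z" for F
    by (rule linear_mapsD(1)[OF zF_linear that])
  have u: "uF b F \<in> carrier K1" if "F \<in> carrier Z" "b \<in> {1..<N}" for F b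
    by (rule linear_mapsD(1)[OF uF_linear[OF that(2)] that(1)])
  have v: "vF F \<in> carrier K2" if "F \<in> carrier Z" for F
    by (rule linear_mapsD(1)[OF vF_linear that])
  have cu_linear: "cu \<in> linear_maps Z (function_space {1..<N} N1.Q)"
  proof (rule linear_mapsI)
    show "cu F \<in> carrier (function_space {1..<N} N1.Q)" if "F \<in> carrier Z" for F
      using u[OF that] by (auto simp: cu_def function_space_simps N1.carrier_quotient)
    show "cu (F \<oplus>\<^bsub>Z\<^esub> G) = cu F \<oplus>\<^bsub>function_space {1..<N} N1.Q\<^esub> cu G" if "F \<in> carrier Z" "G \<in> carrier Z" for F G
      unfolding cu_def function_space_simps
    proof (rule restrict_ext)
      fix b assume b: "b \<in> {1..<N}"
      show "N1.coset (uF b (F \<oplus>\<^bsub>Z\<^esub> G)) = (\<lambda>b\<in>{1..<N}. N1.coset (uF b F)) b \<oplus>\<^bsub>N1.Q\<^esub> (\<lambda>b\<in>{1..<N}. N1.coset (uF b G)) b"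
        unfolding linear_mapsD(2)[OF uF_linear[OF b] that] N1.coset_add[OF u[OF that(1) b] u[OF that(2) b]] using b by simp
    qed
    show "cu (c \<odot>\<^bsub>Z\<^esub> F) = c \<odot>\<^bsub>function_space {1..<N} N1.Q\<^esub> cu F" if "F \<in> carrier Z" for c F
      unfolding cu_def function_space_simps
    proof (rule restrict_ext)
      fix b assume b: "b \<in> {1..<N}"
      show "N1.coset (uF b (c \<odot>\<^bsub>Z\<^esub> F)) = c \<odot>\<^bsub>N1.Q\<^esub> (\<lambda>b\<in>{1..<N}. N1.coset (uF b F)) b"
        unfolding linear_mapsD(3)[OF uF_linear[OF b] that] N1.coset_smult[OF u[OF that b]] using b by simp
    qed
  qed
  define g where "g F = (f1 (zF F), f2 (cu F), N2.coset (vF F))" for F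
  note cu = linear_mapsD(1)[OF cu_linear]
  show ?thesis
    unfolding spaces
  proof (rule linearly_isomorphic_common_cover[where X = "carrier Z" and f = Q.coset and g = g])
    show "Q.coset ` carrier Z = carrier Q.Q"
      by (simp only: Q.carrier_quotient)
    show "g ` carrier Z = carrier ((exterior_square V \<otimes>\<^sub>k center) \<oplus>\<^sub>k (V \<otimes>\<^sub>k N1.Q) \<oplus>\<^sub>k N2.Q)"
    proof (intro equalityI subsetI)
      fix y assume "y \<in> g ` carrier Z"
      then show "y \<in> carrier ((exterior_square V \<otimes>\<^sub>k center) \<oplus>\<^sub>k (V \<otimes>\<^sub>k N1.Q) \<oplus>\<^sub>k N2.Q)"
        using z cu v linear_mapsD(1)[OF f1(1)] linear_mapsD(1)[OF f2(1)]
        by (auto simp: g_def direct_sum_def N2.carrier_quotient simp del: partial_object.update_convs)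
    next
      fix y assume "y \<in> carrier ((exterior_square V \<otimes>\<^sub>k center) \<oplus>\<^sub>k (V \<otimes>\<^sub>k N1.Q) \<oplus>\<^sub>k N2.Q)"
      then obtain y1 y2 y3 where y: "y = (y1, y2, y3)" "y1 \<in> carrier (exterior_square V \<otimes>\<^sub>k center)"
        "y2 \<in> carrier (V \<otimes>\<^sub>k N1.Q)" "y3 \<in> carrier N2.Q"
        by (auto simp: direct_sum_def)
      obtain z' where z': "z' \<in> carrier (function_space pairs center)" "y1 = f1 z'"
        using f1(2) y(2) by (auto simp: bij_betw_def)
      obtain w where w: "w \<in> carrier (function_space {1..<N} N1.Q)" "y2 = f2 w"
        using f2(2) y(3) by (auto simp: bij_betw_def)
      have "\<forall>b\<in>{1..<N}. \<exists>u'\<in>carrier K1. w b = N1.coset u'"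
        using w(1) unfolding function_space_simps N1.carrier_quotient by blast
      then obtain u' where u': "\<And>b. b \<in> {1..<N} \<Longrightarrow> u' b \<in> carrier K1" "\<And>b. b \<in> {1..<N} \<Longrightarrow> w b = N1.coset (u' b)"
        by metis
      obtain v' where v': "v' \<in> carrier K2" "y3 = N2.coset v'"
        using y(4) unfolding N2.carrier_quotient by blast
      obtain F where F: "F \<in> cocycles C d 2" "zF F = z'" "\<And>b. b \<in> {1..<N} \<Longrightarrow> uF b F = u' b" "vF F = v'"
        using extraction_onto[OF z'(1), of u' v'] u'(1) v'(1) by auto
      have "cu F = w"
        using w(1) F(3) u'(2)
        by (intro extensionalityI[of _ "{1..<N}"]) (auto simp: cu_def function_space_simps PiE_def)
      then have "g F = y"
        using F y z' w v' by (simp add: g_def)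
      then show "y \<in> g ` carrier Z"
        using F(1) by auto
    qed
    show "\<exists>G\<in>carrier Z. Q.coset G = Q.coset F \<oplus>\<^bsub>Q.Q\<^esub> Q.coset F' \<and>
        g G = g F \<oplus>\<^bsub>(exterior_square V \<otimes>\<^sub>k center) \<oplus>\<^sub>k (V \<otimes>\<^sub>k N1.Q) \<oplus>\<^sub>k N2.Q\<^esub> g F'"
      if F: "F \<in> carrier Z" "F' \<in> carrier Z" for F F'
    proof (intro bexI conjI)
      show "Q.coset (F \<oplus>\<^bsub>Z\<^esub> F') = Q.coset F \<oplus>\<^bsub>Q.Q\<^esub> Q.coset F'"
        by (rule Q.coset_add[OF F])
      show "g (F \<oplus>\<^bsub>Z\<^esub> F') = g F \<oplus>\<^bsub>(exterior_square V \<otimes>\<^sub>k center) \<oplus>\<^sub>k (V \<otimes>\<^sub>k N1.Q) \<oplus>\<^sub>k N2.Q\<^esub> g F'"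
        unfolding g_def linear_mapsD(2)[OF zF_linear F] linear_mapsD(2)[OF cu_linear F]
          linear_mapsD(2)[OF vF_linear F] linear_mapsD(2)[OF f1(1) z[OF F(1)] z[OF F(2)]]
          linear_mapsD(2)[OF f2(1) cu[OF F(1)] cu[OF F(2)]] N2.coset_add[OF v[OF F(1)] v[OF F(2)]]
        by (simp add: direct_sum_def)
      show "F \<oplus>\<^bsub>Z\<^esub> F' \<in> carrier Z"
        by (rule Q.V.a_closed[OF F])
    qed
    show "\<exists>G\<in>carrier Z. Q.coset G = c \<odot>\<^bsub>Q.Q\<^esub> Q.coset F \<and>
        g G = c \<odot>\<^bsub>(exterior_square V \<otimes>\<^sub>k center) \<oplus>\<^sub>k (V \<otimes>\<^sub>k N1.Q) \<oplus>\<^sub>k N2.Q\<^esub> g F"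
      if F: "F \<in> carrier Z" for c F
    proof (intro bexI conjI)
      show "Q.coset (c \<odot>\<^bsub>Z\<^esub> F) = c \<odot>\<^bsub>Q.Q\<^esub> Q.coset F"
        by (rule Q.coset_smult[OF F])
      show "g (c \<odot>\<^bsub>Z\<^esub> F) = c \<odot>\<^bsub>(exterior_square V \<otimes>\<^sub>k center) \<oplus>\<^sub>k (V \<otimes>\<^sub>k N1.Q) \<oplus>\<^sub>k N2.Q\<^esub> g F"
        unfolding g_def linear_mapsD(3)[OF zF_linear F] linear_mapsD(3)[OF cu_linear F]
          linear_mapsD(3)[OF vF_linear F] linear_mapsD(3)[OF f1(1) z[OF F]]
          linear_mapsD(3)[OF f2(1) cu[OF F]] N2.coset_smult[OF v[OF F]]
        by (simp add: direct_sum_def)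
      show "c \<odot>\<^bsub>Z\<^esub> F \<in> carrier Z"
        using F by (intro Q.V.smult_closed) simp_all
    qed
    show "Q.coset F = Q.coset F' \<longleftrightarrow> g F = g F'" if F: "F \<in> carrier Z" "F' \<in> carrier Z" for F F'
    proof -
      \<comment> \<open>By linearity, equality of images is a statement about the difference of the
        two cocycles, to which \<open>coboundary_iff\<close> applies.\<close>
      let ?G = "F \<ominus>\<^bsub>Z\<^esub> F'"
      have G: "?G \<in> carrier Z"
        by (rule Q.V.minus_closed[OF F])
      interpret FS: Module.module class_ring "function_space pairs center"
        by (rule module_function_space[OF module_center])
      interpret zh: mod_hom class_ring Z "function_space pairs center" zF
        by (rule mod_hom_linear_maps) (fact Q.module module_function_space[OF module_center] zF_linear)+
      interpret vh: mod_hom class_ring Z K2 vF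
        by (rule mod_hom_linear_maps) (fact Q.module N2.module vF_linear)+
      have z_eq: "zF F = zF F' \<longleftrightarrow> zF ?G = \<zero>\<^bsub>function_space pairs center\<^esub>"
        unfolding zh.f_minus[OF F]
        using minus_eq_zeroD[OF module_function_space[OF module_center] z[OF F(1)] z[OF F(2)]] z[OF F(2)]
        by (metis FS.minus_eq FS.r_neg)
      have u_eq: "N1.coset (uF b F) = N1.coset (uF b F') \<longleftrightarrow> uF b ?G \<in> coboundaries K dn (Suc 0)"
        if b: "b \<in> {1..<N}" for b
      proof -
        interpret uh: mod_hom class_ring Z K1 "uF b"
          by (rule mod_hom_linear_maps) (fact Q.module N1.module uF_linear[OF b])+
        show ?thesis
          unfolding uh.f_minus[OF F] by (rule N1.coset_eq_iff[OF u[OF F(1) b] u[OF F(2) b]])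
      qed
      have v_eq: "N2.coset (vF F) = N2.coset (vF F') \<longleftrightarrow> vF ?G \<in> coboundaries K dn 2"
        unfolding vh.f_minus[OF F] by (rule N2.coset_eq_iff[OF v[OF F(1)] v[OF F(2)]])
      have cu_eq: "cu F = cu F' \<longleftrightarrow> (\<forall>b\<in>{1..<N}. N1.coset (uF b F) = N1.coset (uF b F'))"
        by (auto simp: cu_def fun_eq_iff restrict_def)
      have "g F = g F' \<longleftrightarrow> zF F = zF F' \<and> cu F = cu F' \<and> N2.coset (vF F) = N2.coset (vF F')"
        unfolding g_def prod.inject
        using inj_on_eq_iff[OF bij_betw_imp_inj_on[OF f1(2)] z[OF F(1)] z[OF F(2)]]
          inj_on_eq_iff[OF bij_betw_imp_inj_on[OF f2(2)] cu[OF F(1)] cu[OF F(2)]] by blast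
      also have "\<dots> \<longleftrightarrow> ?G \<in> coboundaries C d 2"
        using coboundary_iff[of ?G] G u_eq unfolding z_eq cu_eq v_eq Z_iff by blast
      also have "\<dots> \<longleftrightarrow> Q.coset F = Q.coset F'"
        by (rule Q.coset_eq_iff[OF F, symmetric])
      finally show ?thesis ..
    qed
  qed
qed

end

theorem mainTheorem3:
  fixes N :: nat and r :: "nat rel"
  assumes "partial_order_on {1..N} r"
    and "CHAR('k::field) = 0 \<or> CHAR('k) > N"
  shows "adjoint_cohomology 2 (lie_poset_algebra r :: ('k, nat \<times> nat \<Rightarrow> 'k) lie_algebra) \<cong>\<^sub>k
      (exterior_square (dual_space (diagonal_subalgebra r)) \<otimes>\<^sub>k lie_center (lie_poset_algebra r))
      \<oplus>\<^sub>k (dual_space (diagonal_subalgebra r) \<otimes>\<^sub>k nerve_cohomology 1 r)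
      \<oplus>\<^sub>k nerve_cohomology 2 r"
proof -
  interpret poset_lie N r "TYPE('k)"
    by (rule poset_lie.intro) (use assms in auto)
  show ?thesis
    by (rule adjoint_cohomology_2)
qed

end
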